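(* Let the integers $a(n)$, $n\ge 1$, be defined by $\sum_{n=1}^\infty a(n)q^n=\phi(q)$. Then, for any nonnegative integer $n$ and each $r\in\{1,3,4\}$, $$a(1250n+250r+219)\equiv 0 \pmod{125}.$$
   Context: Notation, for $|q|<1$: $(a;q)_0:=1$ and $(a;q)_n:=\prod_{k=0}^{n-1}(1-aq^k)$ for $n\ge 1$. The function $\phi$ is $$\phi(q):=\sum_{n=0}^\infty \frac{(-q;q)_{2n}\,q^{n+1}}{(q;q^2)_{n+1}^2},$$ and $a(n)$ is the coefficient of $q^n$ in its power series expansion. *)

theory Defs
  imports Complex_Main "HOL-Number_Theory.Cong"
begin

definition qpoch :: "complex \<Rightarrow> complex \<Rightarrow> nat \<Rightarrow> complex" where
  "qpoch a q n = (\<Prod>k<n. 1 - a * q ^ k)"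

(* Only meaningful for norm q < 1, where the series converges and no denominator vanishes. *)
definition phi :: "complex \<Rightarrow> complex" where
  "phi q = (\<Sum>n. qpoch (- q) q (2 * n) * q ^ (n + 1) / (qpoch q (q ^ 2) (n + 1)) ^ 2)"

end

theory Submission
  imports Defs "HOL-Analysis.Analysis" "HOL-Computational_Algebra.Computational_Algebra"
    "HOL-Real_Asymp.Real_Asymp"
begin

text \<open>
  Write \<open>psi\<close> for the sum of \<open>q ^ (n (n + 1) / 2)\<close> over the natural numbers and \<open>theta4\<close> for the
  sum of \<open>(- 1) ^ n q ^ n\<^sup>2\<close> over the integers. A Bailey pair for the squared
  denominators and a \<open>q\<close>-Gauss sum turn \<open>phi q * theta4 q\<close> into a Lambert series, and in the odd
  part of \<open>phi\<close> this series collapses to theta functions: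
  \<open>theta4 (q\<^sup>2)\<^sup>2 * (phi q - phi (- q)) = 2 * q * psi (q\<^sup>2) ^ 3\<close>. So the generating function
  \<open>F\<close> of the \<open>a (2 * n + 1)\<close> satisfies \<open>F * theta4\<^sup>2 = psi ^ 3\<close>. The dissection of \<open>psi\<close> modulo 5
  and its norm over the fifth roots of unity relate \<open>psi\<close> and \<open>theta4\<close> at \<open>q\<close> and at \<open>q ^ 5\<close>. With
  these relations, extracting the exponents congruent to 4 and then to 1 modulo 5 from \<open>F\<close> leaves
  a multiple of 50 modulo 125, and extracting 4 once more leaves, modulo 5, a multiple of
  \<open>psi\<^sup>2 * theta4\<close> by a series in \<open>q ^ 5\<close>. By Jacobi's identity \<open>psi\<^sup>2 * theta4\<close> is the sum of
  \<open>(- 1) ^ n (2 n + 1) q ^ (n (n + 1))\<close>, whose exponents congruent to 1, 3 or 4 modulo 5 carry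
  coefficients divisible by 5.
\<close>

section \<open>Integral power series modulo powers of 5\<close>

text \<open>After multiplication by \<open>q^(3/8)\<close>, \<open>psi^3\<close> has exponents
  \<open>(8 m + 3) / 8\<close>; the indices extracted from \<open>F\<close> are those with
  \<open>8 m + 3\<close> divisible by 125. This fixes the residues 4, 1, 4 and the constant 109. The
  same rule makes the dissection usable: in the class \<open>r\<close> of \<open>p^k\<close> with
  \<open>8 r + k\<close> divisible by 5 and \<open>k <= 4\<close>, the parts \<open>D\<close> and
  \<open>E\<close> of \<open>p\<close> occur to equal degree, hence only through
  \<open>w = D E\<close>, a polynomial in \<open>p\<close> and \<open>p5\<close>. Division by
  \<open>theta4^2\<close> brings in negative powers of \<open>p\<close>, which this does not cover;
  there the norm over the fifth roots of unity turns \<open>1 / p\<close> into a polynomial in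
  \<open>p\<close> and \<open>q\<close> over series in \<open>q^5\<close>. Up to simple factors
  everything becomes a polynomial in the one parameter \<open>s = q psi(q^5)^2 / psi(q)^2\<close>,
  and the three extractions contribute 5, 10 and 5, so 250 in all. In the Lambert series of
  \<open>phi\<close> the term with \<open>bet q 0\<close> is never evaluated; being even in
  \<open>q\<close> it drops out of the odd part, which is why only odd indices are reached.\<close>

definition dil :: "nat \<Rightarrow> int fps \<Rightarrow> int fps" where
  "dil m f = f oo fps_X ^ m"

definition sect :: "nat \<Rightarrow> int fps \<Rightarrow> int fps" where
  "sect r f = Abs_fps (\<lambda>n. fps_nth f (5 * n + r))"

lemma dil_nth: "fps_nth (dil m f) n = (if m dvd n then fps_nth f (n div m) else 0)"
  by (simp add: dil_def fps_nth_compose_X_power)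

lemma dil_simps:
  assumes "m > 0"
  shows "dil m (f + g) = dil m f + dil m g" "dil m (f - g) = dil m f - dil m g"
    "dil m (f * g) = dil m f * dil m g" "dil m (f ^ k) = dil m f ^ k" "dil m 1 = 1"
    "dil m fps_X = fps_X ^ m"
  using assms by (simp_all add: dil_def fps_compose_add_distrib fps_compose_sub_distrib
      fps_compose_mult_distrib fps_compose_power power_0_left)

lemmas dil5 = dil_simps[of 5, simplified]

lemma sect_nth [simp]: "fps_nth (sect r f) n = fps_nth f (5 * n + r)"
  by (simp add: sect_def)

lemma sect_simps:
  "sect r (f + g) = sect r f + sect r g" "sect r (f - g) = sect r f - sect r g"
  "sect r (numeral k * f) = numeral k * sect r f"
  by (simp_all add: fps_eq_iff numeral_fps_const)

text \<open>Series in \<open>X^5\<close> act as scalars on sections. Every extraction below rests on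
  this, so formulas are arranged as sums of \<open>dil 5 g * (fps_X^k * f)\<close>.\<close>

lemma sect_dil_mult:
  assumes "r < 5"
  shows "sect r (dil 5 g * f) = g * sect r f"
proof (rule fps_ext)
  fix n
  have "fps_nth (sect r (dil 5 g * f)) n
      = (\<Sum>i = 0..5 * n + r. fps_nth (dil 5 g) i * fps_nth f (5 * n + r - i))"
    by (simp add: fps_mult_nth)
  also have "\<dots> = (\<Sum>i \<in> (\<lambda>j. 5 * j) ` {0..n}. fps_nth (dil 5 g) i * fps_nth f (5 * n + r - i))"
    using assms by (intro sum.mono_neutral_right) (auto simp: dil_nth dvd_def)
  also have "\<dots> = (\<Sum>j = 0..n. fps_nth g j * fps_nth f (5 * n + r - 5 * j))"
    by (subst sum.reindex) (auto simp: dil_nth inj_on_def)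
  also have "\<dots> = (\<Sum>j = 0..n. fps_nth g j * fps_nth (sect r f) (n - j))"
    by (intro sum.cong) (auto simp: algebra_simps diff_mult_distrib2)
  finally show "fps_nth (sect r (dil 5 g * f)) n = fps_nth (g * sect r f) n"
    by (simp add: fps_mult_nth)
qed

lemma sect_dil: "r < 5 \<Longrightarrow> sect r (dil 5 g) = (if r = 0 then g else 0)"
  by (auto simp: fps_eq_iff dil_nth dvd_add_right_iff dest: dvd_imp_le)

lemma sect_X_power_mult: "k \<le> r \<Longrightarrow> sect r (fps_X ^ k * f) = sect (r - k) f"
  by (auto simp: fps_eq_iff fps_X_power_mult_nth)

text \<open>For \<open>k > r\<close> the residue wraps around: the exponents come from the class
  \<open>r + 5 - k\<close>, at the price of one factor \<open>X\<close>.\<close>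

lemma sect_X_power_mult':
  assumes "r < k" "k \<le> r + 5"
  shows "sect r (fps_X ^ k * f) = fps_X * sect (r + 5 - k) f"
proof (rule fps_ext)
  fix n
  show "fps_nth (sect r (fps_X ^ k * f)) n = fps_nth (fps_X * sect (r + 5 - k) f) n"
  proof (cases n)
    case (Suc m)
    have "5 * n + r - k = 5 * m + (r + 5 - k)" using assms Suc by simp
    then show ?thesis using assms Suc by (simp only: sect_nth fps_X_power_mult_nth) simp
  qed (use assms in \<open>simp only: sect_nth fps_X_power_mult_nth, simp\<close>)
qed

lemma fps_decomp5:
  assumes "f = dil 5 a + fps_X * dil 5 b + fps_X^2 * dil 5 c + fps_X^3 * dil 5 d + fps_X^4 * dil 5 e"
  shows "sect 0 f = a" "sect 1 f = b" "sect 2 f = c" "sect 3 f = d" "sect 4 f = e"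
  unfolding assms
  using sect_X_power_mult[of 1] sect_X_power_mult'[of _ 1]
  by (auto simp: sect_simps sect_dil sect_X_power_mult sect_X_power_mult')

section \<open>Congruences between integral power series\<close>

definition fcong :: "int fps \<Rightarrow> int fps \<Rightarrow> int fps \<Rightarrow> bool" where
  "fcong c f g \<longleftrightarrow> c dvd f - g"

lemma fcong_refl [simp, intro]: "fcong c f f"
  by (simp add: fcong_def)

lemma fcong_sym: "fcong c f g \<Longrightarrow> fcong c g f"
  by (metis dvd_minus_iff fcong_def minus_diff_eq)

lemma fcong_trans [trans]: "fcong c f g \<Longrightarrow> fcong c g h \<Longrightarrow> fcong c f h"
  unfolding fcong_def by (metis diff_add_cancel add_diff_eq dvd_add)

lemma fcong_add: "fcong c f g \<Longrightarrow> fcong c h k \<Longrightarrow> fcong c (f + h) (g + k)"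
  unfolding fcong_def by (metis add_diff_add dvd_add)

lemma fcong_diff: "fcong c f g \<Longrightarrow> fcong c h k \<Longrightarrow> fcong c (f - h) (g - k)"
  unfolding fcong_def by (metis (no_types, opaque_lifting) diff_diff_eq2 diff_diff_eq add.commute diff_add_eq dvd_diff)

lemma fcong_mult: "fcong c f g \<Longrightarrow> fcong c h k \<Longrightarrow> fcong c (f * h) (g * k)"
proof -
  assume "fcong c f g" "fcong c h k"
  moreover have "f * h - g * k = (f - g) * h + g * (h - k)"
    by (simp add: algebra_simps)
  ultimately show ?thesis by (simp add: fcong_def)
qed

lemma fcong_power: "fcong c f g \<Longrightarrow> fcong c (f ^ n) (g ^ n)"
  by (induction n) (auto intro: fcong_mult)

text \<open>A term with a factor 5, 10 or 25 in front need only be known modulo a smaller power of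
  5; this rule restores the full modulus.\<close>

lemma fcong_scale: "fcong c f g \<Longrightarrow> fcong (k * c) (k * f) (k * g)"
  unfolding fcong_def by (metis mult_dvd_mono dvd_refl right_diff_distrib)

lemma fcong_weaken: "fcong c f g \<Longrightarrow> d dvd c \<Longrightarrow> fcong d f g"
  unfolding fcong_def using dvd_trans by blast

lemma fcong_eqI: "f = g + c * h \<Longrightarrow> fcong c f g"
  by (simp add: fcong_def)

lemma fcong_sect: "fcong (numeral c) f g \<Longrightarrow> fcong (numeral c) (sect r f) (sect r g)"
  unfolding fcong_def by (metis dvd_def sect_simps(2,3))

lemma fps_inverse_int:
  fixes f :: "int fps"
  assumes "fps_nth f 0 = 1"
  obtains g where "f * g = 1"
  using fps_is_left_unit_iff_zeroth_is_left_unit[of f] assms by (metis mult_1)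

lemma int_fps_decomp: "(f :: int fps) = fps_const (fps_nth f 0) + fps_X * Abs_fps (\<lambda>n. fps_nth f (Suc n))"
  by (auto simp: fps_eq_iff)

lemma int_power5_cong: "(5 :: int) dvd a ^ 5 - a"
proof -
  have "0 \<le> a mod 5" "a mod 5 < 5" by simp_all
  then have "(a mod 5) \<in> {0,1,2,3,4}" by (simp only: insert_iff empty_iff) arith
  then have "(a ^ 5 - a) mod 5 = 0"
    by (subst mod_diff_eq [symmetric], subst power_mod [symmetric]) auto
  then show ?thesis by auto
qed

lemma numeral_dvd_fps_iff:
  "(numeral c :: int fps) dvd f \<longleftrightarrow> (\<forall>n. numeral c dvd fps_nth f n)"
proof
  assume "\<forall>n. numeral c dvd fps_nth f n"
  then have "f = numeral c * Abs_fps (\<lambda>n. fps_nth f n div numeral c)"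
    by (auto simp: fps_eq_iff numeral_fps_const)
  then show "numeral c dvd f" by (metis dvd_triv_left)
qed (auto simp: dvd_def numeral_fps_const)

lemma power5_add_cong: "fcong 5 ((a + b) ^ 5) (a ^ 5 + b ^ 5)"
  by (rule fcong_eqI[where h = "a^4*b + 2*a^3*b^2 + 2*a^2*b^3 + a*b^4"])
    (simp add: algebra_simps power_numeral_reduce)

text \<open>Frobenius modulo 5. With the constant term split off, \<open>f = a + X g\<close> gives
  \<open>f^5 = a^5 + X^5 g^5\<close> modulo 5, so coefficient \<open>n\<close> for \<open>f\<close>
  reduces to coefficient \<open>n - 5\<close> for \<open>g\<close>.\<close>

lemma fps_power5_cong: "fcong 5 (f ^ 5) (dil 5 f)"
proof -
  have "5 dvd fps_nth (f ^ 5 - dil 5 f) n" for n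
  proof (induction n arbitrary: f rule: less_induct)
    case (less n)
    define a where "a = fps_nth f 0"
    define g where "g = Abs_fps (\<lambda>n. fps_nth f (Suc n))"
    have f: "f = fps_const a + fps_X * g"
      using int_fps_decomp[of f] by (simp add: a_def g_def)
    have "fcong 5 (f ^ 5) (fps_const (a ^ 5) + fps_X ^ 5 * g ^ 5)"
      unfolding f using power5_add_cong[of "fps_const a" "fps_X * g"]
      by (simp add: power_mult_distrib)
    then have "5 dvd fps_nth (f ^ 5 - (fps_const (a ^ 5) + fps_X ^ 5 * g ^ 5)) n"
      by (auto simp: fcong_def numeral_dvd_fps_iff)
    moreover have "5 dvd fps_nth (fps_const (a ^ 5) + fps_X ^ 5 * g ^ 5 - dil 5 f) n"
    proof (cases "n < 5")
      case True
      then have "\<not> 5 dvd n \<or> n = 0" by (auto dest: dvd_imp_le)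
      then show ?thesis using True int_power5_cong[of a]
        by (auto simp: fps_X_power_mult_nth dil_nth a_def)
    next
      case False
      have d: "fps_nth (dil 5 f) n = fps_nth (dil 5 g) (n - 5)"
      proof (cases "5 dvd n")
        case True
        then obtain k where "n = 5 * k" by auto
        with False show ?thesis by (cases k) (auto simp: dil_nth g_def)
      next
        case nd: False
        then have "\<not> 5 dvd n - 5" using False by (metis dvd_add_left_iff dvd_refl le_add_diff_inverse2 not_le)
        with nd show ?thesis by (simp add: dil_nth)
      qed
      have "5 dvd fps_nth (g ^ 5 - dil 5 g) (n - 5)"
        using less.IH[of "n - 5" g] False by simp
      then show ?thesis using False d by (simp add: fps_X_power_mult_nth)
    qed
    ultimately show ?case
      using dvd_add by fastforce
  qed
  then show ?thesis by (auto simp: fcong_def numeral_dvd_fps_iff)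
qed

lemma sect_one: "sect 0 1 = 1"
  using sect_dil[of 0 1] by (simp add: dil5)

text \<open>The right side is the norm form of \<open>fifth_root_norm_form\<close>, one of whose
  five linear factors is \<open>p\<close>. The quotient is written in \<open>p\<close>,
  \<open>z\<close> and \<open>x * y\<close> alone, because the product of the first two parts of the
  dissection can be expressed through \<open>p\<close> and \<open>p5\<close> (assumption
  \<open>DE\<close>), while no such formula is at hand for the separate parts.\<close>

lemma quintic_factor:
  fixes x y z :: "'a :: idom"
  assumes "p = x + y + z"
  shows "p * (p^4 - 5 * z * p^3 + 10 * z^2 * p^2 - 5 * (x * y) * p^2 - 10 * z^3 * p
      + 15 * (x * y) * z * p + 5 * z^4 - 15 * (x * y) * z^2 + 5 * (x * y)^2)
    = x^5 + y^5 + z^5 - 5 * x * y * z^3 + 5 * x^2 * y^2 * z"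
  unfolding assms by algebra

lemma sect_X_mult: "0 < r \<Longrightarrow> sect r (fps_X * f) = sect (r - 1) f"
  using sect_X_power_mult[of 1 r f] by simp

lemma sect_X_power: "sect k (fps_X ^ k) = 1"
  using sect_X_power_mult[of k k 1] sect_one by simp

text \<open>The assumption is \<open>J (1 - 5 s) = Q (1 - s)\<close> solved modulo 25, with the
  exact error kept. The cubic \<open>- 4 - 7 s + s^2 + 10 s^3\<close> is
  \<open>(- 4 - 16 s + 20 s^2) (1 - s) (1 + 5 s)\<close> reduced modulo 25; the multiples of 25
  removed in this way reappear behind the factor 125.\<close>

lemma scaled_geometric:
  fixes J Q u s :: "'a :: idom"
  assumes "J = Q * (1 - s) * (1 + 5 * s) + 25 * (s^2 * J)"
  shows "J * (5 * u * (- 4 - 16 * s + 20 * s^2)) = 5 * (u * Q * (- 4 - 7 * s + s^2 + 10 * s^3))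
    + 125 * (u * (Q * (- s - s^2 + 6 * s^3 - 4 * s^4) + s^2 * J * (- 4 - 16 * s + 20 * s^2)))"
  using assms by algebra

text \<open>
  Here \<open>p\<close> and \<open>P\<close> are the power series of \<open>psi\<close> and \<open>theta4\<close>. The assumption \<open>norm\<close> expresses the
  product of \<open>psi (z * q)\<close> over the fifth roots of unity \<open>z\<close> in terms of the dissection.
\<close>

locale theta_fps =
  fixes p P D E w p5 P5 :: "int fps"
  defines "p5 \<equiv> dil 5 p" and "P5 \<equiv> dil 5 P" and "w \<equiv> p^2 - fps_X * p5^2"
  assumes p0: "fps_nth p 0 = 1" and P0: "fps_nth P 0 = 1"
    and dissection: "p = dil 5 D + fps_X * dil 5 E + fps_X^3 * dil 5 p5"
    and DE: "D * E = w"
    and norm: "((dil 5 D)^5 + (fps_X * dil 5 E)^5 + (fps_X^3 * dil 5 p5)^5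
        - 5 * dil 5 D * (fps_X * dil 5 E) * (fps_X^3 * dil 5 p5)^3
        + 5 * (dil 5 D)^2 * (fps_X * dil 5 E)^2 * (fps_X^3 * dil 5 p5)) * dil 5 p5 = p5^6"
    and PP: "(P^2 - P5^2) * w = - 4 * fps_X * p5^2 * P5^2"
    and w3: "w^3 * P = p * p5 * P5^5"
    and cubic: "\<And>r. r \<in> {1, 3, 4} \<Longrightarrow> fcong 5 (sect r (p^2 * P)) 0"
begin

section \<open>Sections of the positive powers of psi\<close>

lemma sect_p: "sect 3 p = p5"
  using fps_decomp5(4)[of p D E 0 p5 0] dissection by (simp add: dil_def)

text \<open>Here and in the next two lemmas: a monomial \<open>D^i E^j p5^l\<close> of the expanded
  power sits at an exponent congruent to \<open>j + 3 l\<close>, and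
  \<open>8 (j + 3 l) + (i + j + l)\<close> is congruent to \<open>i - j\<close> modulo 5. The chosen
  class therefore collects exactly the monomials with \<open>i = j\<close>, and \<open>DE\<close>
  applies. The witnesses are the other classes of the expansion.\<close>

lemma sect_p_sq: "sect 1 (p^2) = 2 * w + fps_X * p5^2"
  by (rule fps_decomp5(2)[where a = "D^2" and c = "E^2" and d = "2 * D * p5" and e = "2 * E * p5"])
    (subst dissection, simp add: dil5 flip: DE, simp add: dil_simps dil_def algebra_simps power_numeral_reduce)

lemma sect_p_cube: "sect 4 (p^3) = 6 * w * p5 + fps_X * p5^3"
  by (rule fps_decomp5(5)[where a = "D^3 + 3 * fps_X * E^2 * p5" and b = "3 * D^2 * E + 3 * fps_X * D * p5^2"
        and c = "3 * D * E^2 + 3 * fps_X * E * p5^2" and d = "E^3 + 3 * D^2 * p5"])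
    (subst dissection, simp add: dil5 flip: DE, simp add: dil_simps dil_def algebra_simps power_numeral_reduce)

lemma sect_p_pow4: "sect 2 (p^4) = 6 * w^2 + 12 * fps_X * w * p5^2 + fps_X^2 * p5^4"
  by (rule fps_decomp5(3)[where a = "D^4 + 12 * fps_X * D * E^2 * p5 + 4 * fps_X^2 * E * p5^3"
        and b = "4 * D^3 * E + 6 * fps_X * D^2 * p5^2 + 4 * fps_X * E^3 * p5"
        and d = "4 * D^3 * p5 + 4 * D * E^3 + 6 * fps_X * E^2 * p5^2"
        and e = "12 * D^2 * E * p5 + 4 * fps_X * D * p5^3 + E^4"])
    (subst dissection, simp add: dil5 flip: DE, simp add: dil_simps dil_def algebra_simps power_numeral_reduce)

text \<open>The quotient of \<open>quintic_factor\<close> for the dissection of \<open>p\<close>,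
  where \<open>x * y = X * dil 5 w\<close> and \<open>z = X^3 * dil 5 p5\<close>. Multiples of 5 in
  the exponent of \<open>X\<close> are moved into \<open>dil 5\<close>, and the remaining power is
  kept explicit, even as \<open>fps_X^1\<close> or \<open>fps_X^2 * 1\<close>, so that the section
  rules match.\<close>

definition cofactor :: "int fps" where
  "cofactor = p^4 - 5 * (dil 5 p5 * (fps_X^3 * p^3)) + 10 * (dil 5 (fps_X * p5^2) * (fps_X^1 * p^2))
    - 5 * (dil 5 w * (fps_X^1 * p^2)) - 10 * (dil 5 (fps_X * p5^3) * (fps_X^4 * p))
    + 15 * (dil 5 (w * p5) * (fps_X^4 * p)) + 5 * (dil 5 (fps_X^2 * p5^4) * (fps_X^2 * 1))
    - 15 * (dil 5 (fps_X * w * p5^2) * (fps_X^2 * 1)) + 5 * (dil 5 (w^2) * (fps_X^2 * 1))"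

lemma cofactor: "p * cofactor * dil 5 p5 = p5^6"
proof -
  have "cofactor = p^4 - 5 * (fps_X^3 * dil 5 p5) * p^3 + 10 * (fps_X^3 * dil 5 p5)^2 * p^2
      - 5 * (dil 5 D * (fps_X * dil 5 E)) * p^2 - 10 * (fps_X^3 * dil 5 p5)^3 * p
      + 15 * (dil 5 D * (fps_X * dil 5 E)) * (fps_X^3 * dil 5 p5) * p + 5 * (fps_X^3 * dil 5 p5)^4
      - 15 * (dil 5 D * (fps_X * dil 5 E)) * (fps_X^3 * dil 5 p5)^2
      + 5 * (dil 5 D * (fps_X * dil 5 E))^2"
    unfolding cofactor_def DE [symmetric] dil5
    by algebra
  then show ?thesis
    using quintic_factor[OF dissection] norm by simp
qed

section \<open>Sections of the negative powers of psi\<close>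

context
  fixes V :: "int fps"
  assumes pV: "p * V = 1"
begin

lemma V5: "p5 * dil 5 V = 1"
  by (metis pV dil5(3,5) p5_def)

text \<open>Rationalizing the denominator: \<open>V\<close> is the cofactor divided by the norm, and
  the norm is \<open>p5^6 / dil 5 p5\<close>, a series in \<open>X^5\<close> with inverse
  \<open>dil 5 (p5 * V^6)\<close>.\<close>

lemma V_eq: "V = dil 5 (p5 * V^6) * cofactor"
proof -
  have "V = V * (p5 * dil 5 V)^6" using V5 by simp
  also have "\<dots> = V * (dil 5 V)^6 * (p * cofactor * dil 5 p5)" by (simp add: cofactor power_mult_distrib)
  also have "\<dots> = (p * V) * (dil 5 (p5 * V^6) * cofactor)"
    by (simp add: dil5 algebra_simps)
  finally show ?thesis using pV by simp
qed

lemma sect_cofactor: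
  "sect 2 cofactor = p^4 - 5 * fps_X * p^2 * p5^2 + 5 * fps_X^2 * p5^4"
proof -
  have "sect 2 cofactor = sect 2 (p^4) - 5 * (p5 * (fps_X * sect 4 (p^3)))
     + 10 * (fps_X * p5^2 * sect 1 (p^2)) - 5 * (w * sect 1 (p^2)) - 10 * (fps_X * p5^3 * (fps_X * sect 3 p))
     + 15 * (w * p5 * (fps_X * sect 3 p)) + 5 * (fps_X^2 * p5^4) - 15 * (fps_X * w * p5^2) + 5 * w^2"
    unfolding cofactor_def
    by (simp only: sect_simps sect_dil_mult sect_X_power_mult sect_X_power_mult') 
      (simp add: sect_X_power_mult sect_X_power_mult' sect_dil_mult sect_one)
  then show ?thesis
    unfolding sect_p sect_p_sq sect_p_cube sect_p_pow4 w_def by algebra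
qed

lemma sect_V: "sect 2 V = p5 * V^2 * (1 - 5 * (fps_X * p5^2 * V^2) + 5 * (fps_X * p5^2 * V^2)^2)"
  by (subst V_eq) (simp add: sect_dil_mult sect_cofactor, use pV in algebra)

lemma sect_V_cube: "fcong 5 (sect 1 (V^3)) (V * (2 * w + fps_X * p5^2))"
proof -
  have "fcong 5 (V^3 * p^5 * dil 5 V) (V^3 * p5 * dil 5 V)"
    unfolding p5_def by (intro fcong_mult fps_power5_cong fcong_refl)
  moreover have "V^3 * p^5 * dil 5 V = dil 5 V * p^2" using pV by algebra
  moreover have "V^3 * p5 * dil 5 V = V^3" using V5 by algebra
  ultimately have "fcong 5 (V^3) (dil 5 V * p^2)" using fcong_sym by simp
  from fcong_sect[OF this, of 1] show ?thesis
    by (simp add: sect_dil_mult sect_p_sq del: One_nat_def)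
qed

lemma sect_V_pow4: "fcong 5 (sect 3 (V^4)) (V * p5)"
proof -
  have "fcong 5 (V^4 * p^5 * dil 5 V) (V^4 * p5 * dil 5 V)"
    unfolding p5_def by (intro fcong_mult fps_power5_cong fcong_refl)
  moreover have "V^4 * p^5 * dil 5 V = dil 5 V * p" using pV by algebra
  moreover have "V^4 * p5 * dil 5 V = V^4" using V5 by algebra
  ultimately have "fcong 5 (V^4) (dil 5 V * p)" using fcong_sym by simp
  from fcong_sect[OF this, of 3] show ?thesis
    by (simp add: sect_dil_mult sect_p)
qed

text \<open>This section enters \<open>sect_sect_F\<close> with only a factor 5 in front, so a
  congruence modulo 5 would not suffice. One factor \<open>V\<close> is expanded by
  \<open>V_eq\<close>; the other lowers each power of \<open>p\<close> in the cofactor by one, and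
  the terms free of \<open>p\<close> keep a \<open>V\<close>, to which \<open>sect_V\<close>
  applies.\<close>

lemma sect_V_sq:
  "sect 4 (V^2) = p5^2 * V^6 * (6 * p^2 - 10 * fps_X * p5^2
      + 5 * p^2 * (1 - 5 * (fps_X * p5^2 * V^2) + 5 * (fps_X * p5^2 * V^2)^2)^2)"
proof -
  have eq: "V^2 = dil 5 (p5 * V^6) * (p^3 - 5 * (dil 5 p5 * (fps_X^3 * p^2)) + 10 * (dil 5 (fps_X * p5^2) * (fps_X^1 * p))
    - 5 * (dil 5 w * (fps_X^1 * p)) - 10 * (dil 5 (fps_X * p5^3) * (fps_X^4 * 1))
    + 15 * (dil 5 (w * p5) * (fps_X^4 * 1)) + 5 * (dil 5 (fps_X^2 * p5^4) * (fps_X^2 * V))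
    - 15 * (dil 5 (fps_X * w * p5^2) * (fps_X^2 * V)) + 5 * (dil 5 (w^2) * (fps_X^2 * V)))"
    (is "_ = _ * ?N")
  proof -
    have "cofactor * V = ?N" unfolding cofactor_def using pV by algebra
    then show ?thesis using V_eq by (metis power2_eq_square mult.assoc)
  qed
  have "sect 4 (V^2) = p5 * V^6 * (sect 4 (p^3) - 5 * (p5 * sect 1 (p^2)) + 10 * (fps_X * p5^2 * sect 3 p)
    - 5 * (w * sect 3 p) - 10 * (fps_X * p5^3) + 15 * (w * p5)
    + 5 * (fps_X^2 * p5^4 * sect 2 V) - 15 * (fps_X * w * p5^2 * sect 2 V) + 5 * (w^2 * sect 2 V))"
    by (subst eq, simp only: sect_simps sect_dil_mult)
      (simp add: sect_simps sect_X_power_mult sect_X_mult sect_dil_mult sect_X_power)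
  then show ?thesis
    unfolding sect_p sect_p_sq sect_p_cube sect_V w_def using pV by algebra
qed

text \<open>The relation \<open>PP\<close> divided by \<open>p^2\<close>. With
  \<open>s = X * p5^2 * V^2\<close> it makes the ratio of \<open>P^2\<close> to \<open>P5^2\<close>
  a rational function of \<open>s\<close> alone.\<close>

lemma P_sq_V: "P^2 * (1 - fps_X * p5^2 * V^2) = P5^2 * (1 - 5 * (fps_X * p5^2 * V^2))"
  using PP pV unfolding w_def by algebra

section \<open>The three extractions from psi^3 / theta4^2\<close>

context
  fixes I F :: "int fps"
  assumes PI: "P * I = 1" and F: "F * P^2 = p^3"
begin

lemma I5: "P5 * dil 5 I = 1"
  by (metis PI dil5(3,5) P5_def)

lemma F_eq: "F = p^3 * I^2"
  using F PI by algebra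

lemma I_sq: "I^2 * (1 - 5 * (fps_X * p5^2 * V^2)) = (dil 5 I)^2 * (1 - fps_X * p5^2 * V^2)"
  using P_sq_V PI I5 by algebra

text \<open>By \<open>I_sq\<close>, \<open>I^2\<close> is
  \<open>(dil 5 I)^2 (1 - s) / (1 - 5 s)\<close>, and
  \<open>(1 - s) (1 + 5 s + 25 s^2) = 1 + 4 s + 20 s^2 - 25 s^3\<close> with error
  \<open>125 s^3 I^2\<close>. Multiplied by \<open>p^3\<close>, these four terms are the ones whose
  sections are taken; their sum acquires a factor 5.\<close>

lemma sect_F: "fcong 125 (sect 4 F)
    (I^2 * (5 * p5 * (- 4 * p^2 - 16 * fps_X * p5^2 + 20 * fps_X^2 * p5^4 * V^2)))"
proof -
  have "F = dil 5 (I^2) * (p^3 + 4 * (dil 5 (p^2) * (fps_X^1 * p)) + 20 * (dil 5 (p^4) * (fps_X^2 * V))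
      - 25 * (dil 5 (p^6) * (fps_X^3 * V^3))) + 125 * ((fps_X * p5^2 * V^2)^3 * p^3 * I^2)"
    unfolding F_eq dil5 p5_def [symmetric] using I_sq pV by algebra
  then have "fcong 125 F (dil 5 (I^2) * (p^3 + 4 * (dil 5 (p^2) * (fps_X^1 * p)) + 20 * (dil 5 (p^4) * (fps_X^2 * V))
      - 25 * (dil 5 (p^6) * (fps_X^3 * V^3))))"
    by (rule fcong_eqI)
  from fcong_sect[OF this, of 4] have "fcong 125 (sect 4 F)
      (I^2 * (sect 4 (p^3) + 4 * (p^2 * sect 3 p) + 20 * (p^4 * sect 2 V) - 25 * (p^6 * sect 1 (V^3))))"
    by (simp add: sect_dil_mult sect_simps sect_X_power_mult sect_X_mult)
  also have "fcong 125 \<dots> (I^2 * (6 * w * p5 + fps_X * p5^3 + 4 * (p^2 * p5)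
       + 20 * (p^4 * (p5 * V^2 * (1 - 5 * (fps_X * p5^2 * V^2) + 5 * (fps_X * p5^2 * V^2)^2)))
       - 25 * (p5 * (2 * w + fps_X * p5^2))))"
  proof -
    \<comment> \<open>The coefficient 25 in front allows this term to be computed modulo 5.\<close>
    have "fcong 5 (p^6 * sect 1 (V^3)) (p^6 * (V * (2 * w + fps_X * p5^2)))"
      by (intro fcong_mult sect_V_cube fcong_refl)
    also have "p^6 * (V * (2 * w + fps_X * p5^2)) = p^5 * (2 * w + fps_X * p5^2)" using pV by algebra
    also have "fcong 5 \<dots> (p5 * (2 * w + fps_X * p5^2))"
      unfolding p5_def by (intro fcong_mult fps_power5_cong fcong_refl)
    finally have "fcong 125 (25 * (p^6 * sect 1 (V^3))) (25 * (p5 * (2 * w + fps_X * p5^2)))"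
      by (drule_tac k = 25 in fcong_scale) simp
    from fcong_mult[OF fcong_refl fcong_diff[OF fcong_refl this]]
    show ?thesis unfolding sect_p sect_p_cube sect_V .
  qed
  also have "\<dots> = I^2 * (5 * p5 * (- 4 * p^2 - 16 * fps_X * p5^2 + 20 * fps_X^2 * p5^4 * V^2))"
    unfolding w_def using pV by algebra
  finally show ?thesis .
qed

lemma sect_sect_F: "fcong 125 (sect 1 (sect 4 F)) (50 * (p^3 * I^2 * (1 - (fps_X * p5^2 * V^2)^2)))"
proof -
  \<comment> \<open>The cubic of \<open>scaled_geometric\<close> times
    \<open>p5 * p^2 * (dil 5 I)^2\<close>, multiplied out so that each summand is a series in
    \<open>X^5\<close> times a power of \<open>X\<close> and a power of \<open>p\<close> or
    \<open>V\<close>. Since \<open>sect_F\<close> has supplied a factor 5, \<open>A\<close> matters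
    only modulo 25.\<close>
  define A where "A = dil 5 (p * I^2) * (dil 5 (p^4) * (fps_X^2 * V^2) + 10 * (dil 5 (p^6) * (fps_X^3 * V^4))
      - 4 * p^2 - 7 * (dil 5 (p^2) * fps_X^1))"
  define s where "s = fps_X * p5^2 * V^2"
  have A: "A = p5 * p^2 * (dil 5 I)^2 * (- 4 - 7 * s + s^2 + 10 * s^3)"
    unfolding A_def dil5 p5_def [symmetric] using pV s_def by algebra
  have I: "I^2 = (dil 5 I)^2 * (1 - s) * (1 + 5 * s) + 25 * (s^2 * I^2)"
    using I_sq unfolding s_def by algebra
  have "I^2 * (5 * p5 * (- 4 * p^2 - 16 * fps_X * p5^2 + 20 * fps_X^2 * p5^4 * V^2))
      = I^2 * (5 * (p5 * p^2) * (- 4 - 16 * s + 20 * s^2))"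
    using pV s_def by algebra
  also have "\<dots> = 5 * A + 125 * (p5 * p^2 * ((dil 5 I)^2 * (- s - s^2 + 6 * s^3 - 4 * s^4)
      + s^2 * I^2 * (- 4 - 16 * s + 20 * s^2)))"
    unfolding A by (rule scaled_geometric[OF I])
  finally have "fcong 125 (sect 4 F) (5 * A)"
    by (rule fcong_trans[OF sect_F fcong_eqI])
  then have "fcong 125 (sect 1 (sect 4 F)) (sect 1 (5 * A))"
    by (rule fcong_sect)
  also have "sect 1 (5 * A) = 5 * (p * I^2 * (p^4 * (fps_X * sect 4 (V^2)) + 10 * (p^6 * (fps_X * sect 3 (V^4)))
      - 4 * (2 * w + fps_X * p5^2) - 7 * p^2))"
    unfolding A_def sect_p_sq [symmetric]
    by (simp only: sect_simps sect_dil_mult[of 1, simplified, folded One_nat_def] sect_X_power_mult'[of 1 2, simplified, folded One_nat_def]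
        sect_X_power_mult'[of 1 3, simplified, folded One_nat_def] sect_X_power mult_1_right)
  also have "fcong 125 \<dots> (5 * (p * I^2 * (p^4 * (fps_X * sect 4 (V^2)) + 10 * (p5 * p5 * fps_X)
      - 4 * (2 * w + fps_X * p5^2) - 7 * p^2)))"
  proof -
    have "fcong 5 (p^6 * (fps_X * sect 3 (V^4))) (p^6 * (fps_X * (V * p5)))"
      by (intro fcong_mult sect_V_pow4 fcong_refl)
    also have "p^6 * (fps_X * (V * p5)) = p^5 * p5 * fps_X" using pV by algebra
    also have "fcong 5 \<dots> (p5 * p5 * fps_X)"
      unfolding p5_def by (intro fcong_mult fps_power5_cong fcong_refl)
    \<comment> \<open>The coefficient 10 lifts the modulus 5 to 50, hence to 25.\<close>
    finally have "fcong 25 (10 * (p^6 * (fps_X * sect 3 (V^4)))) (10 * (p5 * p5 * fps_X))"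
      by (drule_tac k = 10 in fcong_scale) (erule fcong_weaken, auto simp: dvd_def intro: exI[of _ 2])
    from fcong_scale[OF fcong_mult[OF fcong_refl fcong_diff[OF fcong_diff[OF fcong_add[OF fcong_refl this]
        fcong_refl] fcong_refl]], of 5 "p * I^2" "p^4 * (fps_X * sect 4 (V^2))" "4 * (2 * w + fps_X * p5^2)" "7 * p^2"]
    show ?thesis by simp
  qed
  also have "fcong 125 \<dots> (50 * (p^3 * I^2 * (1 - (fps_X * p5^2 * V^2)^2)))"
  proof -
    \<comment> \<open>All terms are rewritten as \<open>p^3 * I^2\<close> times a polynomial in
      \<open>s\<close>; everything beyond \<open>50 (1 - s^2)\<close> is divisible by 125.\<close>
    have s: "fps_X * p5^2 = p^2 * s" unfolding s_def using pV by algebra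
    have "p^4 * (fps_X * sect 4 (V^2)) = p^2 * s * (6 - 10 * s + 5 * (1 - 5 * s + 5 * s^2)^2)"
      unfolding sect_V_sq s_def [symmetric] using s pV by algebra
    moreover have "p5 * p5 * fps_X = p^2 * s" using s by algebra
    moreover have "w = p^2 * (1 - s)" unfolding w_def using s by algebra
    ultimately have "5 * (p * I^2 * (p^4 * (fps_X * sect 4 (V^2)) + 10 * (p5 * p5 * fps_X)
        - 4 * (2 * w + fps_X * p5^2) - 7 * p^2))
      = 50 * (p^3 * I^2 * (1 - s^2)) + 125 * (p^3 * I^2 * (- 1 + s + s * (- 2 * s + 7 * s^2 - 10 * s^3 + 5 * s^4)))"
      using s by algebra
    then show ?thesis unfolding s_def by (rule fcong_eqI)
  qed
  finally show ?thesis .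
qed

text \<open>With the factor 50 of \<open>sect_sect_F\<close>, only divisibility by 5 remains to be
  shown. Modulo 5 the class 4 of \<open>H\<close> is \<open>I^2 * p5 * w\<close>; the rest of the
  proof turns this into a series in \<open>X^5\<close> times \<open>p^2 * P\<close>, to which
  \<open>cubic\<close> applies.\<close>

lemma sect_sect_sect_F:
  assumes r: "r \<in> {1, 3, 4}"
  shows "fcong 125 (sect r (sect 4 (sect 1 (sect 4 F)))) 0"
proof -
  define H where "H = p^3 * I^2 * (1 - (fps_X * p5^2 * V^2)^2)"
  define W where "W = fps_right_inverse w 1"
  have "fps_nth w 0 = 1"
    by (simp add: w_def p0 fps_nth_power_0)
  then have W: "w * W = 1" using fps_right_inverse[of w 1] by (simp add: W_def)
  have "fps_nth (p^2 * P) 0 = 1"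
    by (simp add: p0 P0 fps_nth_power_0)
  have Isq: "fcong 5 (I^2) ((dil 5 I)^2 * (1 - fps_X * p5^2 * V^2))"
    by (rule fcong_eqI[where h = "I^2 * (fps_X * p5^2 * V^2)"]) (use I_sq in algebra)
  have V: "fcong 5 V (dil 5 V * p^4)"
  proof -
    have "fcong 5 (p5 * (dil 5 V * V)) (p^5 * (dil 5 V * V))"
      unfolding p5_def by (intro fcong_mult fcong_sym[OF fps_power5_cong] fcong_refl)
    moreover have "p5 * (dil 5 V * V) = V" using V5 by algebra
    moreover have "p^5 * (dil 5 V * V) = dil 5 V * p^4" using pV by algebra
    ultimately show ?thesis by simp
  qed
  have V3: "fcong 5 (V^3) (dil 5 V * p^2)"
  proof -
    have "fcong 5 (p5 * (dil 5 V * V^3)) (p^5 * (dil 5 V * V^3))"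
      unfolding p5_def by (intro fcong_mult fcong_sym[OF fps_power5_cong] fcong_refl)
    moreover have "p5 * (dil 5 V * V^3) = V^3" using V5 by algebra
    moreover have "p^5 * (dil 5 V * V^3) = dil 5 V * p^2" using pV by algebra
    ultimately show ?thesis by simp
  qed
  have "fcong 5 H (p^3 * ((dil 5 I)^2 * (1 - fps_X * p5^2 * V^2)) * (1 - (fps_X * p5^2 * V^2)^2))"
    unfolding H_def by (intro fcong_mult fcong_refl Isq)
  \<comment> \<open>\<open>(1 - s) (1 - s^2) = 1 - s - s^2 + s^3\<close>, multiplied by
    \<open>p^3\<close>.\<close>
  also have "\<dots> = (dil 5 I)^2 * (p^3 - p5^2 * (fps_X * p) - fps_X^2 * p5^4 * V + fps_X^3 * p5^6 * V^3)"
    using pV by algebra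
  also have "fcong 5 \<dots> ((dil 5 I)^2 * (p^3 - p5^2 * (fps_X * p) - fps_X^2 * p5^4 * (dil 5 V * p^4)
      + fps_X^3 * p5^6 * (dil 5 V * p^2)))"
    by (intro fcong_mult fcong_add fcong_diff fcong_refl V V3)
  also have "\<dots> = dil 5 (I^2) * (p^3 - dil 5 (p^2) * (fps_X * p) - dil 5 (p^3) * (fps_X^2 * p^4)
      + dil 5 (p^5) * (fps_X^3 * p^2))"
    unfolding dil5 p5_def [symmetric] using V5 by algebra
  finally have "fcong 5 (sect 4 H) (sect 4 (dil 5 (I^2) * (p^3 - dil 5 (p^2) * (fps_X * p)
      - dil 5 (p^3) * (fps_X^2 * p^4) + dil 5 (p^5) * (fps_X^3 * p^2))))"
    by (rule fcong_sect)
  also have "\<dots> = I^2 * (6 * w * p5 + fps_X * p5^3 - p^2 * p5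
      - p^3 * (6 * w^2 + 12 * fps_X * w * p5^2 + fps_X^2 * p5^4) + p^5 * (2 * w + fps_X * p5^2))"
    by (simp add: sect_dil_mult sect_simps sect_X_power_mult sect_X_mult sect_p sect_p_sq [unfolded One_nat_def]
        sect_p_cube sect_p_pow4)
  also have "fcong 5 \<dots> (I^2 * (6 * w * p5 + fps_X * p5^3 - p^2 * p5 - p^5 * p^2 + p^5 * (2 * w + fps_X * p5^2)))"
  proof -
    have "fcong 5 (p^3 * (6 * w^2 + 12 * fps_X * w * p5^2 + fps_X^2 * p5^4)) (p^5 * p^2)"
      by (rule fcong_eqI[where h = "p^3 * (w^2 + 2 * fps_X * w * p5^2)"]) (unfold w_def, algebra)
    from fcong_mult[OF fcong_refl fcong_add[OF fcong_diff[OF fcong_refl this] fcong_refl]]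
    show ?thesis .
  qed
  also have "fcong 5 \<dots> (I^2 * (6 * w * p5 + fps_X * p5^3 - p^2 * p5 - p5 * p^2 + p5 * (2 * w + fps_X * p5^2)))"
    unfolding p5_def by (intro fcong_mult fcong_add fcong_diff fcong_refl fps_power5_cong)
  also have "fcong 5 \<dots> (I^2 * (p5 * w))"
    by (rule fcong_eqI[where h = "I^2 * p5 * w"]) (unfold w_def, algebra)
  also have "fcong 5 \<dots> ((dil 5 I)^2 * (1 - fps_X * p5^2 * V^2) * (p5 * w))"
    by (intro fcong_mult fcong_refl Isq)
  \<comment> \<open>The factor \<open>1 - s = V^2 * w\<close> makes the power of \<open>w\<close> a
    square, and \<open>w^2 = w^12 * W^10\<close>: the twelfth power is accessible through
    \<open>w3\<close>, and \<open>W^10\<close> is a series in \<open>X^5\<close> modulo 5.\<close>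
  also have "\<dots> = (dil 5 I)^2 * V^2 * p5 * ((w^3)^4 * (W^5)^2)"
  proof -
    have "(w^3)^4 * (W^5)^2 = w^2 * (w * W)^10"
      by (simp add: power_mult_distrib flip: power_mult power_add)
    moreover have "1 - fps_X * p5^2 * V^2 = V^2 * w" unfolding w_def using pV by algebra
    ultimately show ?thesis using W by (simp add: power2_eq_square)
  qed
  also have "fcong 5 \<dots> ((dil 5 I)^2 * V^2 * p5 * ((w^3)^4 * (dil 5 W)^2))"
    by (intro fcong_mult fcong_refl fcong_power fps_power5_cong)
  also have "\<dots> = (dil 5 I)^2 * p5^5 * P5^20 * (dil 5 W)^2 * p^2 * P * I^5"
  proof -
    have "w^3 = p * p5 * P5^5 * I" using w3 PI by algebra
    then have "(w^3)^4 = p^4 * p5^4 * P5^20 * I^4"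
      by (simp add: power_mult_distrib flip: power_mult)
    \<comment> \<open>Writing \<open>I^4\<close> as \<open>P * I^5\<close> produces the wanted
      \<open>P\<close>, since \<open>I^5\<close> is again a series in \<open>X^5\<close> modulo
      5.\<close>
    moreover have "V^2 * p^4 = p^2" "I^4 = P * I^5" using pV PI by algebra+
    ultimately show ?thesis by (simp add: power_numeral_reduce) algebra
  qed
  also have "fcong 5 \<dots> ((dil 5 I)^2 * p5^5 * P5^20 * (dil 5 W)^2 * p^2 * P * dil 5 I)"
    by (intro fcong_mult fcong_refl fps_power5_cong)
  also have "\<dots> = dil 5 (I^3 * p^5 * P^20 * W^2) * (p^2 * P)"
    unfolding dil5 p5_def [symmetric] P5_def [symmetric] by algebra
  finally have "fcong 5 (sect r (sect 4 H)) (sect r (dil 5 (I^3 * p^5 * P^20 * W^2) * (p^2 * P)))"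
    by (rule fcong_sect)
  also have "\<dots> = I^3 * p^5 * P^20 * W^2 * sect r (p^2 * P)"
    using r by (intro sect_dil_mult) auto
  also have "fcong 5 \<dots> (I^3 * p^5 * P^20 * W^2 * 0)"
    using r by (intro fcong_mult fcong_refl cubic)
  finally have "fcong (50 * 5) (50 * sect r (sect 4 H)) (50 * 0)"
    by (intro fcong_scale) simp
  then have "fcong 125 (sect r (sect 4 (50 * H))) 0"
    by (simp add: sect_simps) (erule fcong_weaken, auto simp: dvd_def intro: exI[of _ 2])
  moreover have "fcong 125 (sect r (sect 4 (sect 1 (sect 4 F)))) (sect r (sect 4 (50 * H)))"
    unfolding H_def by (intro fcong_sect sect_sect_F)
  ultimately show ?thesis by (rule fcong_trans[rotated])
qed

end
end

lemma coefficient_cong: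
  assumes F: "F * P^2 = p^3" and r: "r \<in> {1, 3, 4}"
  shows "125 dvd fps_nth F (625 * n + 125 * r + 109)"
proof -
  obtain V where V: "p * V = 1" using fps_inverse_int[OF p0] .
  obtain I where I: "P * I = 1" using fps_inverse_int[OF P0] .
  have "fcong 125 (sect r (sect 4 (sect 1 (sect 4 F)))) 0"
    by (rule sect_sect_sect_F[OF V I F r])
  then have "125 dvd fps_nth (sect r (sect 4 (sect 1 (sect 4 F)))) n"
    by (simp add: fcong_def numeral_dvd_fps_iff)
  moreover have "5 * (5 * (5 * (5 * n + r) + 4) + 1) + 4 = 625 * n + 125 * r + 109" by simp
  ultimately show ?thesis by (simp only: sect_nth)
qed

end

section \<open>Infinite products and Jacobi's triple product\<close>

lemma qpoch_0 [simp]: "qpoch a q 0 = 1"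
  by (simp add: qpoch_def)

lemma qpoch_Suc: "qpoch a q (Suc n) = qpoch a q n * (1 - a * q ^ n)"
  by (simp add: qpoch_def)

lemma qpoch_Suc': "qpoch a q (Suc n) = (1 - a) * qpoch (a * q) q n"
  unfolding qpoch_def by (subst prod.lessThan_Suc_shift) (simp add: mult.assoc)

lemma qpoch_add: "qpoch a q (m + n) = qpoch a q m * qpoch (a * q ^ m) q n"
  by (induction n) (simp_all add: qpoch_Suc power_add mult.assoc)

lemma qpoch_mult_split: "qpoch a q (m * n) = (\<Prod>i<m. qpoch (a * q ^ i) (q ^ m) n)"
proof (induction n)
  case (Suc n)
  have "qpoch (a * q ^ (m * n)) q m = (\<Prod>i<m. 1 - a * q ^ i * (q ^ m) ^ n)"
    unfolding qpoch_def by (intro prod.cong) (auto simp: power_mult mult_ac)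
  then show ?case using Suc
    by (simp add: qpoch_add[of a q "m * n" m, folded mult_Suc_right] add.commute[of m] qpoch_Suc prod.distrib)
qed simp

lemma qpoch_mult_neg: "qpoch a q n * qpoch (- a) q n = qpoch (a^2) (q^2) n"
  unfolding qpoch_def by (simp flip: prod.distrib, intro prod.cong)
    (auto simp: algebra_simps power2_eq_square power_mult_distrib)

definition qinf :: "complex \<Rightarrow> complex \<Rightarrow> complex" where
  "qinf a q = (\<Prod>k. 1 - a * q ^ k)"

lemma qinf_convergent:
  fixes a q :: complex
  assumes "norm q < 1"
  shows "convergent_prod (\<lambda>k. 1 - a * q ^ k)"
proof -
  have "summable (\<lambda>k. norm (- a * q ^ k))"
    using assms by (simp add: norm_mult norm_power summable_mult summable_geometric)
  then have "abs_convergent_prod (\<lambda>k. 1 + - a * q ^ k)"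
    by (intro summable_imp_abs_convergent_prod) simp
  then show ?thesis by (simp add: abs_convergent_prod_imp_convergent_prod)
qed

lemma qpoch_tendsto:
  assumes "norm q < 1"
  shows "qpoch a q \<longlonglongrightarrow> qinf a q"
  using convergent_prod_LIMSEQ[OF qinf_convergent[OF assms]]
  unfolding qpoch_def qinf_def by (subst (asm) LIMSEQ_lessThan_iff_atMost [symmetric])

lemma qinf_nonzero: "norm q < 1 \<Longrightarrow> (\<And>k. a * q ^ k \<noteq> 1) \<Longrightarrow> qinf a q \<noteq> 0"
  unfolding qinf_def using prodinf_nonzero[OF qinf_convergent] by force

lemma norm_mult_power_less_1: 
  fixes q :: complex
  assumes "norm q < 1" "norm a < 1"
  shows "norm (a * q ^ k) < 1"
  using assms by (metis norm_mult norm_power norm_ge_zero mult_le_one less_le_not_le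
      mult_left_le power_le_one mult.commute le_less_trans)

lemma mult_power_neq_1: "norm q < 1 \<Longrightarrow> norm a < 1 \<Longrightarrow> a * q ^ k \<noteq> (1 :: complex)"
  using norm_mult_power_less_1[of q a k] by auto

lemma qpoch_nonzero: "norm q < 1 \<Longrightarrow> norm a < 1 \<Longrightarrow> qpoch a q n \<noteq> 0"
  using mult_power_neq_1[of q a] by (auto simp: qpoch_def)

lemma qinf_nonzero': "norm q < 1 \<Longrightarrow> norm a < 1 \<Longrightarrow> qinf a q \<noteq> 0"
  by (intro qinf_nonzero mult_power_neq_1)

lemma norm_power_less_1: "norm q < 1 \<Longrightarrow> n > 0 \<Longrightarrow> norm (q ^ n :: complex) < 1"
  by (simp add: norm_power power_less_one_iff)

lemma qinf_split:
  assumes "norm q < 1" "m > 0"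
  shows "qinf a q = (\<Prod>i<m. qinf (a * q ^ i) (q ^ m))"
proof (rule LIMSEQ_unique)
  show "(\<lambda>n. qpoch a q (m * n)) \<longlonglongrightarrow> qinf a q"
    using LIMSEQ_subseq_LIMSEQ[OF qpoch_tendsto[OF assms(1)], of "\<lambda>n. m * n"] assms(2)
    by (simp add: o_def strict_mono_def)
  show "(\<lambda>n. qpoch a q (m * n)) \<longlonglongrightarrow> (\<Prod>i<m. qinf (a * q ^ i) (q ^ m))"
    unfolding qpoch_mult_split using assms by (intro tendsto_prod qpoch_tendsto norm_power_less_1)
qed

lemma qinf_mult_neg:
  assumes "norm q < 1"
  shows "qinf a q * qinf (- a) q = qinf (a^2) (q^2)"
proof (rule LIMSEQ_unique)
  show "(\<lambda>n. qpoch a q n * qpoch (- a) q n) \<longlonglongrightarrow> qinf a q * qinf (- a) q"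
    using assms by (intro tendsto_mult qpoch_tendsto)
  show "(\<lambda>n. qpoch a q n * qpoch (- a) q n) \<longlonglongrightarrow> qinf (a^2) (q^2)"
    unfolding qpoch_mult_neg using assms by (intro qpoch_tendsto norm_power_less_1) auto
qed

lemma qinf_step:
  assumes "norm q < 1"
  shows "qinf a q = (1 - a) * qinf (a * q) q"
proof (rule LIMSEQ_unique)
  show "(\<lambda>n. qpoch a q (Suc n)) \<longlonglongrightarrow> qinf a q"
    using qpoch_tendsto[OF assms] by (rule LIMSEQ_Suc)
  show "(\<lambda>n. qpoch a q (Suc n)) \<longlonglongrightarrow> (1 - a) * qinf (a * q) q"
    unfolding qpoch_Suc' using assms by (intro tendsto_mult qpoch_tendsto tendsto_const)
qed

lemma qpoch_bound:
  assumes "norm q < 1"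
  obtains C where "C > 0" "\<And>n. norm (qpoch a q n) \<le> C"
  using Bseq_def convergent_imp_Bseq convergentI qpoch_tendsto[OF assms] by metis

lemma qpoch_inverse_bound:
  assumes "norm q < 1" "norm a < 1"
  obtains C where "C > 0" "\<And>n. norm (1 / qpoch a q n) \<le> C"
proof -
  have "(\<lambda>n. 1 / qpoch a q n) \<longlonglongrightarrow> 1 / qinf a q"
    using assms qinf_nonzero' by (intro tendsto_divide tendsto_const qpoch_tendsto)
  then show ?thesis using that Bseq_def convergent_imp_Bseq convergentI by metis
qed

section \<open>Triangular numbers and finite forms of Jacobi's identities\<close>

definition tri :: "nat \<Rightarrow> nat" where "tri n = n * (n + 1) div 2"

lemma tri_simps [simp]: "tri 0 = 0" "tri (Suc n) = tri n + Suc n"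
  by (simp_all add: tri_def)

lemma two_tri: "2 * tri n = n * (n + 1)"
  by (simp add: tri_def)

lemma strict_mono_tri: "strict_mono tri"
  by (rule strict_monoI_Suc) simp

lemma tri_ge: "n \<le> tri n"
  by (induction n) auto

text \<open>The exponent \<open>tri (j - 1)\<close> stands for the binomial coefficient \<open>j choose 2\<close>.\<close>

lemma q_binomial:
  assumes "norm Q < 1"
  shows "(\<Prod>k<M. 1 + x * Q ^ k)
    = (\<Sum>j\<le>M. qpoch Q Q M / (qpoch Q Q j * qpoch Q Q (M - j)) * Q ^ tri (j - 1) * x ^ j)"
proof (induction M)
  case (Suc M)
  note nz = qpoch_nonzero[OF assms assms]
  \<comment> \<open>The \<open>q\<close>-binomial coefficient, extended by 0 so that Pascal's rule
    also holds at \<open>j = M\<close>.\<close>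
  define B where "B M j = (if j \<le> M then qpoch Q Q M / (qpoch Q Q j * qpoch Q Q (M - j)) else 0)" for M j
  have B0: "B M 0 = 1" for M using nz by (simp add: B_def)
  have pascal: "B (Suc M) (Suc j) = B M (Suc j) + Q ^ (M - j) * B M j" if "j \<le> M" for j
  proof (cases "j = M")
    case False
    then have "j < M" using that by simp
    then obtain d where M: "M = j + Suc d" by (auto dest: less_imp_Suc_add)
    have nz1: "1 - Q * Q ^ n \<noteq> 0" for n using mult_power_neq_1[OF assms assms, of n] by simp
    show ?thesis using nz nz1 unfolding B_def M
      by (simp add: qpoch_Suc divide_simps) (simp add: power_add algebra_simps)
  qed (use nz in \<open>simp add: B_def\<close>)
  have "(\<Prod>k<Suc M. 1 + x * Q ^ k) = (\<Sum>j\<le>M. B M j * Q ^ tri (j - 1) * x ^ j) * (1 + x * Q ^ M)"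
    using Suc by (simp add: B_def)
  also have "\<dots> = (\<Sum>j\<le>M. B M j * Q ^ tri (j - 1) * x ^ j) + (\<Sum>j\<le>M. B M j * Q ^ (tri (j - 1) + M) * x ^ Suc j)"
    unfolding distrib_left mult_1_right sum_distrib_right
    by (intro arg_cong2[of _ _ _ _ "(+)"] sum.cong refl) (simp add: power_add mult_ac)
  also have "(\<Sum>j\<le>M. B M j * Q ^ tri (j - 1) * x ^ j) = (\<Sum>j\<le>Suc M. B M j * Q ^ tri (j - 1) * x ^ j)"
    by (simp add: B_def)
  also have "\<dots> = 1 + (\<Sum>j\<le>M. B M (Suc j) * Q ^ tri j * x ^ Suc j)"
    by (subst sum.atMost_Suc_shift) (simp add: B0)
  also have "1 + (\<Sum>j\<le>M. B M (Suc j) * Q ^ tri j * x ^ Suc j) + (\<Sum>j\<le>M. B M j * Q ^ (tri (j - 1) + M) * x ^ Suc j)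
     = 1 + (\<Sum>j\<le>M. B (Suc M) (Suc j) * Q ^ tri j * x ^ Suc j)"
  proof -
    have "B M (Suc j) * Q ^ tri j * x ^ Suc j + B M j * Q ^ (tri (j - 1) + M) * x ^ Suc j
        = B (Suc M) (Suc j) * Q ^ tri j * x ^ Suc j" if "j \<le> M" for j
    proof -
      have "tri (j - 1) + M = (M - j) + tri j" using that by (cases j) auto
      then show ?thesis by (simp add: pascal[OF that] power_add algebra_simps)
    qed
    then show ?thesis by (simp flip: sum.distrib)
  qed
  also have "\<dots> = (\<Sum>j\<le>Suc M. B (Suc M) j * Q ^ tri (j - 1) * x ^ j)"
    by (subst sum.atMost_Suc_shift) (simp add: B0)
  finally show ?case by (simp add: B_def)
qed simp

text \<open>The \<open>q\<close>-binomial theorem for \<open>2 N + 1\<close> factors, recentred by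
  \<open>x = a / Q^N\<close>. The indices \<open>j = N + 1 + n\<close> and \<open>j = N - n\<close>
  carry the same \<open>q\<close>-binomial coefficient and, after recentring, the same power
  \<open>Q^(tri n)\<close>, so they are paired into one sum over natural \<open>n\<close>.\<close>

lemma finite_jtp:
  assumes "norm Q < 1" "a \<noteq> 0"
  shows "(\<Prod>k\<le>N. 1 + a * Q ^ k) * (\<Prod>k<N. 1 + Q ^ Suc k / a)
    = (\<Sum>n\<le>N. qpoch Q Q (2 * N + 1) / (qpoch Q Q (N - n) * qpoch Q Q (N + 1 + n))
        * Q ^ tri n * (a ^ Suc n + (1 / a) ^ n))"
proof (cases "Q = 0")
  case True
  have "qpoch 0 0 n = 1" for n by (simp add: qpoch_def)
  moreover have "(\<Prod>k\<le>N. 1 + a * 0 ^ k) = 1 + a"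
    by (subst prod.atMost_shift) simp
  moreover have "(\<Sum>n\<le>N. 0 ^ tri n * (a ^ Suc n + (1 / a) ^ n)) = 1 + a"
  proof -
    have "0 ^ tri (Suc n) = (0 :: complex)" for n by simp
    then show ?thesis by (subst sum.atMost_shift) (simp only: mult_zero_left sum.neutral_const, simp)
  qed
  ultimately show ?thesis using True by simp
next
  case Q: False
  define c where "c n = qpoch Q Q (2 * N + 1) / (qpoch Q Q (N - n) * qpoch Q Q (N + 1 + n)) * Q ^ tri n" for n
  define x where "x = a / Q ^ N"
  have x: "x \<noteq> 0" using assms Q by (simp add: x_def)
  define K where "K = x ^ N * Q ^ tri (N - 1)"
  have K: "K \<noteq> 0" using x Q by (simp add: K_def)
  have "(\<Prod>k<2 * N + 1. 1 + x * Q ^ k) = K * ((\<Prod>k\<le>N. 1 + a * Q ^ k) * (\<Prod>k<N. 1 + Q ^ Suc k / a))"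
  proof -
    have "(\<Prod>k<2 * N + 1. 1 + x * Q ^ k) = (\<Prod>k<N. 1 + x * Q ^ k) * (\<Prod>k=N..<N + Suc N. 1 + x * Q ^ k)"
      using prod.atLeastLessThan_concat[of 0 N "N + Suc N" "\<lambda>k. 1 + x * Q ^ k"]
      by (simp only: atLeast0LessThan mult_2 add_Suc_right add_0_right One_nat_def le_add1 zero_le)
    also have "(\<Prod>k=N..<N + Suc N. 1 + x * Q ^ k) = (\<Prod>k\<le>N. 1 + a * Q ^ k)"
      using prod.shift_bounds_nat_ivl[of "\<lambda>k. 1 + x * Q ^ k" 0 N "Suc N"] Q
      by (simp add: x_def power_add lessThan_Suc_atMost atLeast0LessThan add.commute)
    \<comment> \<open>The first \<open>N\<close> factors are read backwards, and from each the term
      that is large for small \<open>Q\<close> is pulled out.\<close>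
    also have "(\<Prod>k<N. 1 + x * Q ^ k) = (\<Prod>k<N. x * Q ^ (N - Suc k) * (1 + Q ^ Suc k / a))"
    proof (subst prod.nat_diff_reindex [symmetric], intro prod.cong refl)
      fix k assume "k \<in> {..<N}"
      then have "Q ^ N = Q ^ (N - Suc k) * Q ^ Suc k" by (simp del: power_Suc flip: power_add)
      then show "1 + x * Q ^ (N - Suc k) = x * Q ^ (N - Suc k) * (1 + Q ^ Suc k / a)"
        using assms Q by (simp add: x_def field_simps)
    qed
    also have "\<dots> = (\<Prod>k<N. x * Q ^ (N - Suc k)) * (\<Prod>k<N. 1 + Q ^ Suc k / a)"
      by (rule prod.distrib)
    also have "(\<Prod>k<N. x * Q ^ (N - Suc k)) = (\<Prod>k<N. x * Q ^ k)"
      by (rule prod.nat_diff_reindex)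
    also have "\<dots> = K"
    proof -
      have "(\<Prod>k<N. x * Q ^ k) = x ^ N * Q ^ tri (N - 1)"
      proof (induction N)
        case (Suc N)
        then show ?case using x Q by (cases N) (simp_all add: power_add algebra_simps)
      qed simp
      then show ?thesis by (simp add: K_def)
    qed
    finally show ?thesis by (simp add: mult_ac)
  qed
  also have "(\<Prod>k<2 * N + 1. 1 + x * Q ^ k)
      = (\<Sum>j\<le>2 * N + 1. qpoch Q Q (2 * N + 1) / (qpoch Q Q j * qpoch Q Q (2 * N + 1 - j)) * Q ^ tri (j - 1) * x ^ j)"
    (is "_ = sum ?f _") by (rule q_binomial[OF assms(1)])
  also have "\<dots> = (\<Sum>n\<le>N. ?f (N + Suc n)) + (\<Sum>n\<le>N. ?f (N - n))"
  proof -
    have "{..2 * N + 1} = {..N} \<union> {N + Suc 0..N + Suc N}" by auto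
    then have "sum ?f {..2 * N + 1} = sum ?f {..N} + sum ?f {N + Suc 0..N + Suc N}"
      by (simp only:) (rule sum.union_disjoint, auto)
    also have "sum ?f {N + Suc 0..N + Suc N} = (\<Sum>n\<le>N. ?f (N + Suc n))"
      using sum.shift_bounds_cl_nat_ivl[of ?f 0 "Suc N" N]
      by (simp add: atMost_atLeast0 add.commute)
    also have "sum ?f {..N} = (\<Sum>n\<le>N. ?f (N - n))"
      using sum.nat_diff_reindex[of ?f "Suc N"] by (simp add: lessThan_Suc_atMost)
    finally show ?thesis by (simp add: add.commute)
  qed
  also have "(\<Sum>n\<le>N. ?f (N + Suc n)) = K * (\<Sum>n\<le>N. c n * a ^ Suc n)"
  proof (unfold sum_distrib_left, intro sum.cong refl)
    fix n assume n: "n \<in> {..N}"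
    have "2 * tri (N + n) = 2 * (tri (N - 1) + tri n + N * Suc n)"
      by (cases N) (simp_all add: distrib_left two_tri del: tri_simps, simp_all add: algebra_simps)
    then have "tri (N + n) = tri (N - 1) + tri n + N * Suc n" by simp
    then have "Q ^ tri (N + n) = Q ^ tri (N - 1) * Q ^ tri n * (Q ^ N) ^ Suc n"
      by (simp only: power_add power_mult)
    moreover have "a = x * Q ^ N" using Q by (simp add: x_def)
    ultimately have E: "Q ^ tri (N + n) * x ^ (N + Suc n) = K * Q ^ tri n * a ^ Suc n"
      by (simp only: K_def power_add power_mult_distrib mult_ac)
    have i: "2 * N + 1 - (N + Suc n) = N - n" "N + 1 + n = N + Suc n" "N + Suc n - 1 = N + n" by auto
    have "?f (N + Suc n) = qpoch Q Q (2 * N + 1) / (qpoch Q Q (N + Suc n) * qpoch Q Q (N - n))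
        * (Q ^ tri (N + n) * x ^ (N + Suc n))"
      unfolding i by (simp only: mult.assoc)
    then show "?f (N + Suc n) = K * (c n * a ^ Suc n)"
      unfolding E c_def i by (simp only: mult_ac)
  qed
  also have "(\<Sum>n\<le>N. ?f (N - n)) = K * (\<Sum>n\<le>N. c n * (1 / a) ^ n)"
  proof (unfold sum_distrib_left, intro sum.cong refl)
    fix n assume "n \<in> {..N}"
    then obtain d where N: "N = d + n" by (auto simp: le_iff_add add.commute)
    have "2 * (tri (N - n - 1) + N * n) = 2 * (tri (N - 1) + tri n)"
      unfolding N by (cases d; cases n)
        (simp_all add: distrib_left two_tri del: tri_simps, simp_all add: algebra_simps)
    then have "tri (N - n - 1) + N * n = tri (N - 1) + tri n" by simp
    then have "Q ^ tri (N - n - 1) * (Q ^ N) ^ n = Q ^ tri (N - 1) * Q ^ tri n"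
      by (simp only: flip: power_add power_mult)
    moreover have "a = x * Q ^ N" using Q by (simp add: x_def)
    moreover have "x ^ N = x ^ (N - n) * x ^ n" by (simp add: N flip: power_add)
    ultimately have E: "Q ^ tri (N - n - 1) * x ^ (N - n) = K * Q ^ tri n * (1 / a) ^ n"
      using x Q by (simp add: K_def power_mult_distrib power_divide divide_simps)
    have i: "2 * N + 1 - (N - n) = N + 1 + n" using N by auto
    have "?f (N - n) = qpoch Q Q (2 * N + 1) / (qpoch Q Q (N - n) * qpoch Q Q (N + 1 + n))
        * (Q ^ tri (N - n - 1) * x ^ (N - n))"
      unfolding i by (simp only: mult.assoc)
    then show "?f (N - n) = K * (c n * (1 / a) ^ n)"
      unfolding E c_def by (simp only: mult_ac)
  qed
  finally have "K * ((\<Prod>k\<le>N. 1 + a * Q ^ k) * (\<Prod>k<N. 1 + Q ^ Suc k / a)) = K * (\<Sum>n\<le>N. c n * (a ^ Suc n + (1 / a) ^ n))"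
    by (simp add: algebra_simps sum.distrib)
  then show ?thesis using K by (simp add: c_def)
qed

text \<open>For fixed \<open>n\<close> the coefficient tends to \<open>1 / qinf Q Q\<close>. The
  bounds for \<open>qpoch\<close> and its reciprocal dominate it uniformly in \<open>n\<close> and
  \<open>N\<close>, so Tannery's theorem exchanges limit and sum.\<close>

lemma theta_limit:
  assumes Q: "norm Q < 1" and g: "summable (\<lambda>n. norm (Q ^ tri n * g n))"
  shows "(\<lambda>N. \<Sum>n\<le>N. qpoch Q Q (2 * N + 1) / (qpoch Q Q (N - n) * qpoch Q Q (N + 1 + n)) * Q ^ tri n * g n)
    \<longlonglongrightarrow> (\<Sum>n. Q ^ tri n * g n) / qinf Q Q"
proof -
  obtain C where C: "C > 0" "\<And>n. norm (qpoch Q Q n) \<le> C" using qpoch_bound[OF Q] by blast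
  obtain D where D: "D > 0" "\<And>n. norm (1 / qpoch Q Q n) \<le> D" using qpoch_inverse_bound[OF Q Q] by blast
  define f where "f n N = (if n \<le> N then qpoch Q Q (2 * N + 1) * (1 / qpoch Q Q (N - n)) * (1 / qpoch Q Q (N + 1 + n)) * (Q ^ tri n * g n) else 0)" for n N
  have lim: "(\<lambda>N. \<Sum>n. f n N) \<longlonglongrightarrow> (\<Sum>n. Q ^ tri n * g n / qinf Q Q)"
  proof (rule tannerys_theorem[THEN conjunct2, THEN conjunct2])
    fix n
    have "(\<lambda>N. qpoch Q Q (2 * N + 1)) \<longlonglongrightarrow> qinf Q Q" "(\<lambda>N. qpoch Q Q (N - n)) \<longlonglongrightarrow> qinf Q Q" "(\<lambda>N. qpoch Q Q (N + 1 + n)) \<longlonglongrightarrow> qinf Q Q"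
      by (rule filterlim_compose[OF qpoch_tendsto[OF Q]], real_asymp)+
    then have "(\<lambda>N. qpoch Q Q (2 * N + 1) * (1 / qpoch Q Q (N - n)) * (1 / qpoch Q Q (N + 1 + n)) * (Q ^ tri n * g n))
      \<longlonglongrightarrow> qinf Q Q * (1 / qinf Q Q) * (1 / qinf Q Q) * (Q ^ tri n * g n)"
      by (intro tendsto_mult tendsto_divide tendsto_const qinf_nonzero' Q)
    then have "(\<lambda>N. qpoch Q Q (2 * N + 1) * (1 / qpoch Q Q (N - n)) * (1 / qpoch Q Q (N + 1 + n)) * (Q ^ tri n * g n))
      \<longlonglongrightarrow> Q ^ tri n * g n / qinf Q Q"
      using qinf_nonzero'[OF Q Q] by simp
    then show "f n \<longlonglongrightarrow> Q ^ tri n * g n / qinf Q Q"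
      by (rule Lim_transform_eventually) (use eventually_ge_at_top[of n] in eventually_elim, simp add: f_def)
  next
    have "norm (f n N) \<le> C * D * D * norm (Q ^ tri n * g n)" for n N
    proof (cases "n \<le> N")
      case True
      then have "norm (f n N) = norm (qpoch Q Q (2 * N + 1)) * norm (1 / qpoch Q Q (N - n)) * norm (1 / qpoch Q Q (N + 1 + n)) * norm (Q ^ tri n * g n)"
        unfolding f_def by (simp only: if_True norm_mult)
      also have "\<dots> \<le> C * D * D * norm (Q ^ tri n * g n)"
        using C D by (intro mult_right_mono mult_mono) (auto simp del: norm_divide)
      finally show ?thesis .
    qed (use C D in \<open>auto simp: f_def\<close>)
    then show "\<forall>\<^sub>F (n, N) in at_top \<times>\<^sub>F sequentially. norm (f n N) \<le> C * D * D * norm (Q ^ tri n * g n)"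
      by (intro always_eventually) auto
    show "summable (\<lambda>n. C * D * D * norm (Q ^ tri n * g n))"
      using g by (rule summable_mult)
  qed simp
  have "(\<Sum>n. f n N) = (\<Sum>n\<le>N. qpoch Q Q (2 * N + 1) / (qpoch Q Q (N - n) * qpoch Q Q (N + 1 + n)) * Q ^ tri n * g n)" for N
    by (subst suminf_finite[of "{..N}"]) (auto simp: f_def intro!: sum.cong)
  moreover have "summable (\<lambda>n. Q ^ tri n * g n)" using g by (rule summable_norm_cancel)
  ultimately show ?thesis using lim by (simp add: suminf_divide)
qed

lemma summable_power_tri:
  fixes r M :: real
  assumes "0 \<le> r" "r < 1" "M \<ge> 0"
  shows "summable (\<lambda>n. r ^ tri n * M ^ n)"
proof (cases "r = 0 \<or> M = 0")
  case True
  have "r ^ tri n * M ^ n = 0" if "n \<notin> {0}" for n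
    using that True by (cases n) auto
  then show ?thesis by (intro summable_finite[of "{0}"]) auto
next
  case False
  have "(\<lambda>n. r ^ Suc n * M) \<longlonglongrightarrow> 0 * M"
    using assms by (intro tendsto_mult LIMSEQ_power_zero[THEN LIMSEQ_Suc] tendsto_const) auto
  then have "eventually (\<lambda>n. r ^ Suc n * M < 1/2) sequentially"
    by (intro order_tendstoD(2)) auto
  then obtain N where N: "\<And>n. n \<ge> N \<Longrightarrow> r ^ Suc n * M < 1/2"
    by (auto simp: eventually_sequentially)
  show ?thesis
  proof (rule summable_ratio_test[of "1/2" N])
    fix n assume n: "n \<ge> N"
    have "norm (r ^ tri (Suc n) * M ^ Suc n) = (r ^ Suc n * M) * (r ^ tri n * M ^ n)"
      using assms by (simp add: power_add mult_ac)
    also have "\<dots> \<le> 1/2 * (r ^ tri n * M ^ n)"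
      using N[OF n] assms by (intro mult_right_mono) auto
    finally show "norm (r ^ tri (Suc n) * M ^ Suc n) \<le> 1/2 * norm (r ^ tri n * M ^ n)"
      using assms by simp
  qed simp
qed

text \<open>The bilateral series is folded onto the naturals: the indices \<open>n + 1\<close> and
  \<open>- n\<close> share the exponent \<open>tri n\<close>.\<close>

lemma jacobi_triple:
  assumes Q: "norm Q < 1" and a: "a \<noteq> 0"
  shows "qinf (- a) Q * qinf (- Q / a) Q * qinf Q Q = (\<Sum>n. Q ^ tri n * (a ^ Suc n + (1 / a) ^ n))"
proof -
  have s: "summable (\<lambda>n. norm (Q ^ tri n * (a ^ Suc n + (1 / a) ^ n)))"
  proof (rule summable_comparison_test)
    have "summable (\<lambda>n. norm Q ^ tri n * norm a ^ n * norm a + norm Q ^ tri n * norm (1 / a) ^ n)"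
      using Q by (intro summable_add summable_mult2 summable_power_tri) auto
    then show "summable (\<lambda>n. norm Q ^ tri n * norm a ^ n * norm a + norm Q ^ tri n * norm (1 / a) ^ n)" .
    have "norm (norm (Q ^ tri n * (a ^ Suc n + (1 / a) ^ n)))
        \<le> norm Q ^ tri n * norm a ^ n * norm a + norm Q ^ tri n * norm (1 / a) ^ n" for n
    proof -
      have "norm (a ^ Suc n + (1 / a) ^ n) \<le> norm a ^ n * norm a + norm (1 / a) ^ n"
        by (rule order_trans[OF norm_triangle_ineq]) (simp add: norm_mult norm_power norm_divide)
      then have "norm Q ^ tri n * norm (a ^ Suc n + (1 / a) ^ n) \<le> norm Q ^ tri n * (norm a ^ n * norm a + norm (1 / a) ^ n)"
        by (intro mult_left_mono) auto
      moreover have "norm (norm (Q ^ tri n * (a ^ Suc n + (1 / a) ^ n))) = norm Q ^ tri n * norm (a ^ Suc n + (1 / a) ^ n)"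
        by (simp add: norm_mult norm_power)
      ultimately show ?thesis by (simp only: distrib_left mult.assoc)
    qed
    then show "\<exists>N. \<forall>n\<ge>N. norm (norm (Q ^ tri n * (a ^ Suc n + (1 / a) ^ n)))
        \<le> norm Q ^ tri n * norm a ^ n * norm a + norm Q ^ tri n * norm (1 / a) ^ n" by blast
  qed
  have "(\<lambda>N. qpoch (- a) Q (Suc N) * qpoch (- Q / a) Q N) \<longlonglongrightarrow> qinf (- a) Q * qinf (- Q / a) Q"
    using qpoch_tendsto[OF Q] by (intro tendsto_mult LIMSEQ_Suc)
  moreover have "qpoch (- a) Q (Suc N) * qpoch (- Q / a) Q N
      = (\<Sum>n\<le>N. qpoch Q Q (2 * N + 1) / (qpoch Q Q (N - n) * qpoch Q Q (N + 1 + n))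
        * Q ^ tri n * (a ^ Suc n + (1 / a) ^ n))" for N
    by (subst finite_jtp[OF assms, symmetric]) (simp add: qpoch_def lessThan_Suc_atMost)
  ultimately have "qinf (- a) Q * qinf (- Q / a) Q = (\<Sum>n. Q ^ tri n * (a ^ Suc n + (1 / a) ^ n)) / qinf Q Q"
    using theta_limit[OF Q s] LIMSEQ_unique by simp
  then show ?thesis using qinf_nonzero'[OF Q Q] by simp
qed

text \<open>Divide \<open>finite_jtp\<close> by \<open>1 + a\<close>, the factor
  \<open>k = 0\<close> on its left side, and let \<open>a\<close> tend to \<open>- 1\<close>. The
  quotient of \<open>a^(n+1) + a^(-n)\<close> by \<open>1 + a\<close> is a power of
  \<open>1 / a\<close> times a geometric sum of \<open>2 n + 1\<close> terms, all equal to 1 at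
  \<open>a = - 1\<close>.\<close>

lemma finite_jacobi_cube:
  assumes "norm Q < 1"
  shows "qpoch Q Q N ^ 2 = (\<Sum>n\<le>N. qpoch Q Q (2 * N + 1) / (qpoch Q Q (N - n) * qpoch Q Q (N + 1 + n))
        * Q ^ tri n * ((- 1) ^ n * (2 * of_nat n + 1)))"
proof -
  define c where "c n = qpoch Q Q (2 * N + 1) / (qpoch Q Q (N - n) * qpoch Q Q (N + 1 + n)) * Q ^ tri n" for n
  have eq: "(\<Prod>k<N. 1 + a * Q ^ Suc k) * (\<Prod>k<N. 1 + Q ^ Suc k / a)
      = (\<Sum>n\<le>N. c n * ((1 / a) ^ n * (\<Sum>i<2 * n + 1. (- a) ^ i)))" if "a \<noteq> 0" "a \<noteq> - 1" for a
  proof -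
    have nz: "1 + a \<noteq> 0" using that(2) by (metis add_eq_0_iff)
    have geo: "a ^ Suc n + (1 / a) ^ n = (1 + a) * ((1 / a) ^ n * (\<Sum>i<2 * n + 1. (- a) ^ i))" for n
    proof -
      have "(1 + a) * (\<Sum>i<2 * n + 1. (- a) ^ i) = 1 - (- a) ^ (2 * n + 1)"
        using one_diff_power_eq[of "- a" "2 * n + 1"] by simp
      also have "\<dots> = 1 + a * a ^ n * a ^ n" by (simp add: mult_2 power_add power_minus_mult flip: power_mult_distrib)
      finally have "(1 + a) * ((1 / a) ^ n * (\<Sum>i<2 * n + 1. (- a) ^ i)) = (1 / a) ^ n * (1 + a * a ^ n * a ^ n)"
        by (simp add: mult.left_commute)
      also have "\<dots> = a ^ Suc n + (1 / a) ^ n"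
        using that(1) by (simp add: power_divide field_simps)
      finally show ?thesis ..
    qed
    have "(1 + a) * ((\<Prod>k<N. 1 + a * Q ^ Suc k) * (\<Prod>k<N. 1 + Q ^ Suc k / a))
      = (\<Prod>k\<le>N. 1 + a * Q ^ k) * (\<Prod>k<N. 1 + Q ^ Suc k / a)"
      by (subst prod.atMost_shift) (simp add: mult_ac)
    also have "\<dots> = (\<Sum>n\<le>N. c n * (a ^ Suc n + (1 / a) ^ n))"
      by (subst finite_jtp[OF assms that(1)]) (simp add: c_def)
    also have "\<dots> = (1 + a) * (\<Sum>n\<le>N. c n * ((1 / a) ^ n * (\<Sum>i<2 * n + 1. (- a) ^ i)))"
      unfolding geo sum_distrib_left by (simp add: mult.left_commute)
    finally show ?thesis using nz by simp
  qed
  define L where "L a = (\<Prod>k<N. 1 + a * Q ^ Suc k) * (\<Prod>k<N. 1 + Q ^ Suc k / a)" for a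
  define R where "R a = (\<Sum>n\<le>N. c n * ((1 / a) ^ n * (\<Sum>i<2 * n + 1. (- a) ^ i)))" for a
  have L: "L \<midarrow>(- 1)\<rightarrow> L (- 1)" unfolding L_def by (intro tendsto_intros) auto
  have R: "R \<midarrow>(- 1)\<rightarrow> R (- 1)" unfolding R_def by (intro tendsto_intros) auto
  have "eventually (\<lambda>a. L a = R a) (at (- 1))"
  proof -
    have "eventually (\<lambda>a. a \<noteq> (0::complex)) (at (- 1))"
      by (intro eventually_neq_at_within)
    moreover have "eventually (\<lambda>a. a \<noteq> (- 1::complex)) (at (- 1))"
      by (intro eventually_neq_at_within)
    ultimately show ?thesis by eventually_elim (simp only: L_def R_def eq not_False_eq_True)
  qed
  then have "L (- 1) = R (- 1)"
    using L R tendsto_unique tendsto_cong trivial_limit_at by metis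
  moreover have "L (- 1) = qpoch Q Q N ^ 2"
    by (simp add: L_def qpoch_def power2_eq_square)
  moreover have "R (- 1) = (\<Sum>n\<le>N. c n * ((- 1) ^ n * (2 * of_nat n + 1)))"
    by (simp add: R_def add.commute)
  ultimately show ?thesis by (simp add: c_def)
qed

lemma summable_odd_tri:
  fixes Q :: complex
  assumes Q: "norm Q < 1"
  shows "summable (\<lambda>n. norm (Q ^ tri n * ((- 1) ^ n * (2 * of_nat n + 1))))"
proof (rule summable_comparison_test)
  show "summable (\<lambda>n. norm Q ^ tri n * 3 ^ n)"
    using Q by (intro summable_power_tri) auto
  have "2 * real n + 1 \<le> 3 ^ n" for n by (induction n) auto
  moreover have "norm (2 * of_nat n + 1 :: complex) = 2 * real n + 1" for n
  proof -
    have eq: "(2 * of_nat n + 1 :: complex) = of_nat (2 * n + 1)" by simp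
    show ?thesis by (subst eq, subst norm_of_nat) simp
  qed
  ultimately show "\<exists>N. \<forall>n\<ge>N. norm (norm (Q ^ tri n * ((- 1) ^ n * (2 * of_nat n + 1)))) \<le> norm Q ^ tri n * 3 ^ n"
    by (simp add: norm_mult norm_power mult_left_mono)
qed

lemma jacobi_cube:
  assumes Q: "norm Q < 1"
  shows "qinf Q Q ^ 3 = (\<Sum>n. Q ^ tri n * ((- 1) ^ n * (2 * of_nat n + 1)))"
proof -
  have s: "summable (\<lambda>n. norm (Q ^ tri n * ((- 1) ^ n * (2 * of_nat n + 1))))"
      by (rule summable_odd_tri[OF Q])
  have "(\<lambda>N. qpoch Q Q N ^ 2) \<longlonglongrightarrow> qinf Q Q ^ 2"
    by (intro tendsto_power qpoch_tendsto Q)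
  then have "qinf Q Q ^ 2 = (\<Sum>n. Q ^ tri n * ((- 1) ^ n * (2 * of_nat n + 1))) / qinf Q Q"
    using theta_limit[OF Q s] unfolding finite_jacobi_cube[OF Q] using LIMSEQ_unique by blast
  then show ?thesis using qinf_nonzero'[OF Q Q] by (simp add: power3_eq_cube power2_eq_square)
qed

section \<open>Absolutely convergent sums over the integers\<close>

abbreviation norm_summable_on :: "('a \<Rightarrow> 'b :: real_normed_vector) \<Rightarrow> 'a set \<Rightarrow> bool"
    (infixr "norm'_summable'_on" 46) where
  "f norm_summable_on A \<equiv> (\<lambda>x. norm (f x)) summable_on A"

lemma abs_summable_prod:
  fixes f :: "'a \<Rightarrow> complex" and g :: "'b \<Rightarrow> complex"
  assumes "f norm_summable_on A" "g norm_summable_on B"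
  shows "(\<lambda>(x, y). f x * g y) norm_summable_on A \<times> B"
proof -
  have "(\<lambda>y. norm (f x * g y)) summable_on B" for x
    using summable_on_cmult_right[OF assms(2), of "norm (f x)"] by (simp add: norm_mult)
  moreover have "(\<lambda>x. infsum (\<lambda>y. norm (f x * g y)) B) summable_on A"
    using summable_on_cmult_left[OF assms(1), of "infsum (\<lambda>y. norm (g y)) B"]
    by (simp add: norm_mult infsum_cmult_right')
  ultimately show ?thesis
    by (intro iffD2[OF Infinite_Sum.abs_summable_on_Sigma_iff] conjI ballI)
      (simp_all flip: summable_on_iff_abs_summable_on_real del: real_norm_def)
qed

lemma infsum_prod:
  fixes f :: "'a \<Rightarrow> complex" and g :: "'b \<Rightarrow> complex"
  assumes "f norm_summable_on A" "g norm_summable_on B"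
  shows "infsum (\<lambda>(x, y). f x * g y) (A \<times> B) = infsum f A * infsum g B"
proof -
  have "infsum (\<lambda>(x, y). f x * g y) (A \<times> B) = infsum (\<lambda>x. infsum (\<lambda>y. f x * g y) B) A"
    using abs_summable_summable[OF abs_summable_prod[OF assms]] by (subst infsum_Sigma'_banach) auto
  then show ?thesis by (simp add: infsum_cmult_right' infsum_cmult_left')
qed

lemma summable_norm_imp_summable_on:
  fixes f :: "nat \<Rightarrow> 'a :: banach"
  assumes "summable (\<lambda>n. norm (f n))"
  shows "f norm_summable_on UNIV"
  using assms by (intro summable_nonneg_imp_summable_on) auto

lemma infsum_nat:
  fixes f :: "nat \<Rightarrow> 'a :: banach"
  assumes "summable (\<lambda>n. norm (f n))"
  shows "infsum f UNIV = suminf f"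
  using norm_summable_imp_has_sum[OF assms summable_sums[OF summable_norm_cancel[OF assms]]]
  by (rule infsumI)

text \<open>The folding of the integers used in \<open>jacobi_triple\<close>.\<close>

lemma int_UNIV_split: "UNIV = range (\<lambda>n. int n + 1) \<union> range (\<lambda>n. - int n)"
proof (intro equalityI subsetI)
  fix x :: int
  show "x \<in> range (\<lambda>n. int n + 1) \<union> range (\<lambda>n. - int n)"
  proof (cases "x > 0")
    case True
    then have "x = int (nat (x - 1)) + 1" by simp
    then show ?thesis by blast
  next
    case False
    then have "x = - int (nat (- x))" by simp
    then show ?thesis by blast
  qed
qed auto

lemma int_abs_summable_iff:
  fixes f :: "int \<Rightarrow> complex"
  shows "f norm_summable_on UNIV \<longleftrightarrow>
    summable (\<lambda>n. norm (f (int n + 1))) \<and> summable (\<lambda>n. norm (f (- int n)))"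
proof -
  have 1: "f norm_summable_on range (\<lambda>n. int n + 1) \<longleftrightarrow> summable (\<lambda>n. norm (f (int n + 1)))"
    by (subst summable_on_reindex) (auto simp: inj_on_def o_def summable_on_UNIV_nonneg_real_iff)
  have 2: "f norm_summable_on range (\<lambda>n. - int n) \<longleftrightarrow> summable (\<lambda>n. norm (f (- int n)))"
    by (subst summable_on_reindex) (auto simp: inj_on_def o_def summable_on_UNIV_nonneg_real_iff)
  show ?thesis
    unfolding 1 [symmetric] 2 [symmetric]
    by (subst int_UNIV_split) (auto intro!: summable_on_union intro: summable_on_subset_banach)
qed

lemma infsum_int:
  fixes f :: "int \<Rightarrow> complex"
  assumes "f norm_summable_on UNIV"
  shows "infsum f UNIV = (\<Sum>n. f (int n + 1) + f (- int n))"
proof -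
  have s: "summable (\<lambda>n. norm (f (int n + 1)))" "summable (\<lambda>n. norm (f (- int n)))"
    using assms by (simp_all add: int_abs_summable_iff)
  have i: "inj (\<lambda>n. int n + 1)" "inj (\<lambda>n. - int n)" by (auto simp: inj_on_def)
  have "infsum f UNIV = infsum f (range (\<lambda>n. int n + 1)) + infsum f (range (\<lambda>n. - int n))"
    by (subst int_UNIV_split, rule infsum_Un_disjoint)
      (auto intro!: summable_on_subset_banach[OF abs_summable_summable[OF assms]])
  also have "\<dots> = infsum (\<lambda>n. f (int n + 1)) UNIV + infsum (\<lambda>n. f (- int n)) UNIV"
    by (simp add: infsum_reindex[OF i(1)] infsum_reindex[OF i(2)] o_def)
  also have "\<dots> = (\<Sum>n. f (int n + 1)) + (\<Sum>n. f (- int n))"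
    using s by (simp add: infsum_nat)
  finally show ?thesis
    using s by (simp add: suminf_add summable_norm_cancel)
qed

lemma infsum_triangle:
  fixes g :: "nat \<times> nat \<Rightarrow> complex"
  assumes "g norm_summable_on UNIV"
  shows "infsum (\<lambda>r. infsum (\<lambda>i. g (r, i)) UNIV) UNIV = infsum (\<lambda>n. \<Sum>j\<le>n. g (n - j, j)) UNIV"
proof -
  have g: "g summable_on UNIV" using assms by (rule abs_summable_summable)
  have b: "bij_betw (\<lambda>(n, j). (n - j, j)) (Sigma UNIV (\<lambda>n. {..n})) (UNIV :: (nat \<times> nat) set)"
    by (rule bij_betwI[where g = "\<lambda>(r, i). (r + i, i)"]) auto
  have "infsum (\<lambda>r. infsum (\<lambda>i. g (r, i)) UNIV) UNIV = infsum g UNIV"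
    using infsum_Sigma_banach[of g UNIV "\<lambda>_. UNIV"] g by simp
  also have "\<dots> = infsum (\<lambda>(n, j). g (n - j, j)) (Sigma UNIV (\<lambda>n. {..n}))"
    using infsum_reindex_bij_betw[OF b, of g] by (simp add: case_prod_unfold)
  also have "\<dots> = infsum (\<lambda>n. infsum (\<lambda>j. g (n - j, j)) {..n}) UNIV"
    using summable_on_reindex_bij_betw[OF b, of g] g
    by (subst infsum_Sigma'_banach) (auto simp: case_prod_unfold)
  finally show ?thesis by simp
qed

lemma abs_summable_reindex:
  fixes f :: "'b \<Rightarrow> complex"
  assumes "bij_betw h A B" "f norm_summable_on B"
  shows "(\<lambda>x. f (h x)) norm_summable_on A"
  using summable_on_reindex_bij_betw[OF assms(1), of "\<lambda>x. norm (f x)"] assms(2) by simp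

section \<open>Signs and convergence of bilateral theta series\<close>

definition sg :: "int \<Rightarrow> complex" where "sg n = (if even n then 1 else - 1)"

lemma sg_simps [simp]: "sg 0 = 1" "sg (- n) = sg n" "norm (sg n) = 1" "sg n * sg n = 1"
    "sg n * (sg n * x) = x"
  by (auto simp: sg_def)

lemma sg_add: "sg (m + n) = sg m * sg n" and sg_diff: "sg (m - n) = sg m * sg n"
  by (auto simp: sg_def)

lemma sg_1 [simp]: "sg 1 = - 1" by (simp add: sg_def)

lemma sg_of_nat: "sg (int n) = (- 1) ^ n"
  by (simp add: sg_def minus_one_power_iff)

text \<open>Since \<open>tri |k| <= k^2\<close>, quadratic decay can be measured by
  \<open>tri\<close>; the linear term costs only a geometric factor, and
  \<open>summable_power_tri\<close> then serves as the convergence test.\<close>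

lemma norm_powi_le:
  fixes q :: complex
  assumes "0 < norm q" "norm q < 1"
  shows "norm (q powi (k^2 + b * k)) \<le> norm q ^ tri (nat \<bar>k\<bar>) * (1 / norm q) ^ (nat \<bar>b\<bar> * nat \<bar>k\<bar>)"
proof -
  define r where "r = norm q"
  have r: "0 < r" "r < 1" using assms by (auto simp: r_def)
  have "norm (q powi (k^2 + b * k)) = r powi (k^2 + b * k)"
    by (simp add: norm_power_int r_def)
  also have "\<dots> = r powi (k^2) * r powi (b * k)" using r by (subst power_int_add) auto
  also have "\<dots> \<le> r powi int (tri (nat \<bar>k\<bar>)) * r powi (- int (nat \<bar>b\<bar> * nat \<bar>k\<bar>))"
  proof (intro mult_mono power_int_decreasing)
    define n where "n = nat \<bar>k\<bar>"
    have k: "k^2 = int (n * n)" by (simp add: n_def power2_eq_square flip: abs_mult)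
    have "2 * tri n \<le> 2 * (n * n)" unfolding two_tri by (cases n) auto
    then have "tri n \<le> n * n" by simp
    then have "int (tri n) \<le> int (n * n)" by (simp only: of_nat_le_iff)
    then show "int (tri (nat \<bar>k\<bar>)) \<le> k^2" by (simp only: k n_def)
    have "- \<bar>b * k\<bar> \<le> b * k" by arith
    then show "- int (nat \<bar>b\<bar> * nat \<bar>k\<bar>) \<le> b * k" by (simp add: abs_mult)
  qed (use r in auto)
  also have "r powi (- int (nat \<bar>b\<bar> * nat \<bar>k\<bar>)) = (1 / r) ^ (nat \<bar>b\<bar> * nat \<bar>k\<bar>)"
    by (simp only: power_int_minus power_int_of_nat power_inverse divide_inverse mult_1_left)
  finally show ?thesis by (simp add: r_def)
qed

lemma gauss_abs_summable:
  fixes q :: complex and g :: "int \<Rightarrow> complex"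
  assumes q: "0 < norm q" "norm q < 1" and g: "\<And>k. norm (g k) \<le> B * D ^ nat \<bar>k\<bar>" and "B \<ge> 0" "D \<ge> 0"
  shows "(\<lambda>k. g k * q powi (k^2 + b * k)) norm_summable_on UNIV"
proof -
  define M where "M = (1 / norm q) ^ nat \<bar>b\<bar>"
  have M: "M > 0" using q by (simp add: M_def)
  define u where "u n = B * (norm q ^ tri n * (D * M) ^ n)" for n
  have u: "summable u" unfolding u_def
    using q M \<open>D \<ge> 0\<close> by (intro summable_mult summable_power_tri) auto
  have le: "norm (g k * q powi (k^2 + b * k)) \<le> u (nat \<bar>k\<bar>)" for k
  proof -
    have "norm (g k * q powi (k^2 + b * k)) \<le> (B * D ^ nat \<bar>k\<bar>) * (norm q ^ tri (nat \<bar>k\<bar>) * (1 / norm q) ^ (nat \<bar>b\<bar> * nat \<bar>k\<bar>))"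
      unfolding norm_mult using assms norm_powi_le[OF q] by (intro mult_mono) auto
    also have "\<dots> = u (nat \<bar>k\<bar>)" by (simp add: u_def M_def power_mult power_mult_distrib)
    finally show ?thesis .
  qed
  have "summable (\<lambda>n. norm (g (int n + 1) * q powi ((int n + 1)^2 + b * (int n + 1))))"
  proof (rule summable_comparison_test)
    show "summable (\<lambda>n. u (Suc n))" using u by (subst summable_Suc_iff)
    have "nat \<bar>int n + 1\<bar> = Suc n" for n by auto
    then show "\<exists>N. \<forall>n\<ge>N. norm (norm (g (int n + 1) * q powi ((int n + 1)^2 + b * (int n + 1)))) \<le> u (Suc n)"
      using le[of "int _ + 1"] by (auto intro!: exI[of _ 0])
  qed
  moreover have "summable (\<lambda>n. norm (g (- int n) * q powi ((- int n)^2 + b * (- int n))))"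
  proof (rule summable_comparison_test[OF _ u])
    show "\<exists>N. \<forall>n\<ge>N. norm (norm (g (- int n) * q powi ((- int n)^2 + b * (- int n)))) \<le> u n"
      using le[of "- int _"] by (auto intro!: exI[of _ 0])
  qed
  ultimately show ?thesis unfolding int_abs_summable_iff by simp
qed

lemma of_int_norm_le: "norm (of_int k :: complex) \<le> 1 * 2 ^ nat \<bar>k\<bar>"
proof -
  have "real n \<le> 2 ^ n" for n by (rule order.strict_implies_order) (rule of_nat_less_two_power)
  from this[of "nat \<bar>k\<bar>"] show ?thesis by simp
qed

lemma of_int_sq_norm_le: "norm (of_int (k^2) :: complex) \<le> 1 * 4 ^ nat \<bar>k\<bar>"
proof -
  have "norm (of_int (k^2) :: complex) = norm (of_int k :: complex) ^ 2"
    by (simp add: norm_power)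
  also have "\<dots> \<le> (2 ^ nat \<bar>k\<bar>) ^ 2" using of_int_norm_le[of k] by (intro power_mono) auto
  also have "\<dots> = 1 * 4 ^ nat \<bar>k\<bar>" by (simp add: power2_eq_square flip: power_mult_distrib)
  finally show ?thesis .
qed

lemma theta_abs_summable:
  assumes "0 < norm q" "norm q < 1"
  shows "(\<lambda>k. sg k * q powi (k^2 + b * k)) norm_summable_on UNIV"
    and "(\<lambda>k. q powi (k^2 + b * k)) norm_summable_on UNIV"
    and "(\<lambda>k. sg k * of_int k * q powi (k^2 + b * k)) norm_summable_on UNIV"
    and "(\<lambda>k. sg k * of_int (k^2) * q powi (k^2 + b * k)) norm_summable_on UNIV"
  using gauss_abs_summable[OF assms, of sg 1 1 b] gauss_abs_summable[OF assms, of "\<lambda>_. 1" 1 1 b]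
    gauss_abs_summable[OF assms, of "\<lambda>k. sg k * of_int k" 1 2 b] of_int_norm_le
    gauss_abs_summable[OF assms, of "\<lambda>k. sg k * of_int (k^2)" 1 4 b] of_int_sq_norm_le
  by (simp_all add: norm_mult del: of_int_power)

section \<open>Theta functions and Lambert series\<close>

lemma
  fixes f g :: "'a \<Rightarrow> complex"
  assumes "f summable_on A" "g summable_on A"
  shows infsum_diff: "infsum (\<lambda>x. f x - g x) A = infsum f A - infsum g A"
    and summable_on_diff': "(\<lambda>x. f x - g x) summable_on A"
  using infsum_add[OF assms(1) iffD2[OF summable_on_uminus assms(2)]]
    summable_on_add[OF assms(1) iffD2[OF summable_on_uminus assms(2)]]
  by (simp_all add: infsum_uminus)

text \<open>At \<open>k = 0\<close> the denominator vanishes and division yields 0. This keeps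
  \<open>lam q\<close> odd in \<open>k\<close>, and it is the source of the missing term that drives
  \<open>gam_eq\<close>.\<close>

definition lam :: "complex \<Rightarrow> int \<Rightarrow> complex" where "lam q k = q powi k / (1 - q powi (2 * k))"

definition kap :: "complex \<Rightarrow> int \<Rightarrow> complex" where "kap q k = of_int k * lam q k"

definition jj :: "complex \<Rightarrow> int \<Rightarrow> complex" where "jj q n = sg n * q powi (n^2)"

text \<open>Up to the factor \<open>jj q N\<close>, the convolution of \<open>jj q\<close> with
  \<open>lam q\<close> at \<open>N\<close>; \<open>bet\<close> plays the same role for
  \<open>kap q\<close>. See \<open>jj_gam\<close> and \<open>jj_bet\<close>.\<close>

definition gam :: "complex \<Rightarrow> int \<Rightarrow> complex" where
  "gam q N = (\<Sum>\<^sub>\<infinity>k. sg k * q powi (k^2 - 2 * N * k) * lam q k)"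

definition bet :: "complex \<Rightarrow> int \<Rightarrow> complex" where
  "bet q N = (\<Sum>\<^sub>\<infinity>k. sg k * q powi (k^2 - 2 * N * k) * kap q k)"

text \<open>A bilateral form of Jacobi's series for the cube of \<open>eu (q^2)\<close>; see
  \<open>J2_eq_eu\<close>.\<close>

definition J2 :: "complex \<Rightarrow> complex" where
  "J2 q = - (\<Sum>\<^sub>\<infinity>k. sg k * of_int k * q powi (k^2 - k))"

definition lambert_sum :: "complex \<Rightarrow> complex" where
  "lambert_sum q = (\<Sum>n. (- 1) ^ n * q ^ ((n + 1)^2) / (1 - q ^ (2 * n + 1)))"

context
  fixes q :: complex
  assumes q: "0 < norm q" "norm q < 1"
begin

lemma q_nz: "q \<noteq> 0" using q by auto

lemma powi_add: "q powi (a + b) = q powi a * q powi b"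
  using q_nz by (simp add: power_int_add)

lemma powi_neq_1: "k \<noteq> 0 \<Longrightarrow> q powi k \<noteq> 1"
proof
  assume k: "k \<noteq> 0" and "q powi k = 1"
  then have "norm q powi k = 1" by (metis norm_one norm_power_int)
  then have "norm q ^ nat \<bar>k\<bar> = 1"
    using k by (cases "k > 0") (auto simp: power_int_def abs_if power_inverse)
  with k q show False using power_less_one_iff[of "norm q" "nat \<bar>k\<bar>"] by auto
qed

lemma powi_sq: "(q powi k)^2 = q powi (2 * k)"
  by (simp add: power_int_power' mult.commute)

lemma lam_0 [simp]: "lam q 0 = 0" by (simp add: lam_def)

lemma lam_minus: "lam q (- k) = - lam q k"
proof (cases "k = 0")
  case False
  define x where "x = q powi k"
  have "x \<noteq> 0" using q_nz by (simp add: x_def)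
  moreover have "x^2 \<noteq> 1" using powi_neq_1[of "2 * k"] False
    by (simp add: x_def powi_sq)
  ultimately show ?thesis
    by (simp add: lam_def power_int_minus flip: powi_sq x_def)
      (simp add: divide_simps, simp add: algebra_simps power2_eq_square)
qed simp

lemma norm_lam_le: "norm (lam q k) \<le> norm q ^ nat \<bar>k\<bar> / (1 - norm q)"
proof -
  have pos: "norm (lam q (int n)) \<le> norm q ^ n / (1 - norm q)" if "n > 0" for n
  proof -
    have "norm q ^ (2 * n) \<le> norm q ^ 1" using q that by (intro power_decreasing) auto
    moreover have "1 - norm (q ^ (2 * n)) \<le> norm (1 - q ^ (2 * n))"
      using norm_triangle_ineq2[of 1 "q ^ (2 * n)"] by simp
    ultimately have "1 - norm q \<le> norm (1 - q ^ (2 * n))" by (simp add: norm_power)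
    moreover have "lam q (int n) = q ^ n / (1 - q ^ (2 * n))"
      by (simp add: lam_def power_mult flip: powi_sq) (simp flip: power_mult add: mult.commute)
    ultimately show ?thesis using q by (auto simp: norm_divide norm_power intro!: divide_left_mono mult_pos_pos)
  qed
  consider "k = 0" | "k > 0" | "k < 0" by linarith
  then show ?thesis
  proof cases
    case 2 then show ?thesis using pos[of "nat k"] by simp
  next
    case 3 then show ?thesis using pos[of "nat (- k)"] lam_minus[of k] by simp
  qed (use q in simp)
qed

lemma norm_lam_le': "norm (lam q k) \<le> 1 / (1 - norm q) * 1 ^ nat \<bar>k\<bar>"
proof -
  have "norm q ^ nat \<bar>k\<bar> \<le> 1" using q by (intro power_le_one) auto
  then show ?thesis using norm_lam_le[of k] q by (auto simp: divide_simps split: if_splits)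
qed

lemma kap_minus: "kap q (- k) = kap q k" by (simp add: kap_def lam_minus)

lemma norm_kap_le: "norm (kap q k) \<le> 1 / (1 - norm q) * 2 ^ nat \<bar>k\<bar>"
proof -
  have "norm (kap q k) \<le> (1 * 2 ^ nat \<bar>k\<bar>) * (1 / (1 - norm q) * 1 ^ nat \<bar>k\<bar>)"
    unfolding kap_def norm_mult using of_int_norm_le[of k] norm_lam_le'[of k] by (intro mult_mono) auto
  then show ?thesis by simp
qed

lemma int_abs_summable_even:
  fixes f :: "int \<Rightarrow> complex"
  assumes "\<And>k. norm (f k) \<le> u (nat \<bar>k\<bar>)" "summable u"
  shows "f norm_summable_on UNIV"
proof -
  have "summable (\<lambda>n. norm (f (int n + 1)))"
  proof (rule summable_comparison_test)
    show "summable (\<lambda>n. u (Suc n))" using assms(2) by (subst summable_Suc_iff)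
    have "nat \<bar>int n + 1\<bar> = Suc n" for n by auto
    then show "\<exists>N. \<forall>n\<ge>N. norm (norm (f (int n + 1))) \<le> u (Suc n)"
      using assms(1)[of "int _ + 1"] by (auto intro!: exI[of _ 0])
  qed
  moreover have "summable (\<lambda>n. norm (f (- int n)))"
    by (rule summable_comparison_test[OF _ assms(2)]) (use assms(1)[of "- int _"] in \<open>auto intro!: exI[of _ 0]\<close>)
  ultimately show ?thesis unfolding int_abs_summable_iff by simp
qed

lemma lam_summable: "(lam q) norm_summable_on UNIV"
  using q by (intro int_abs_summable_even[where u = "\<lambda>n. norm q ^ n / (1 - norm q)"] norm_lam_le summable_divide summable_geometric) auto

lemma kap_summable: "(kap q) norm_summable_on UNIV"
proof (rule int_abs_summable_even[where u = "\<lambda>n. real (Suc n) * norm q ^ n / (1 - norm q)"])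
  show "norm (kap q k) \<le> real (Suc (nat \<bar>k\<bar>)) * norm q ^ nat \<bar>k\<bar> / (1 - norm q)" for k
  proof -
    have "norm (kap q k) \<le> real (Suc (nat \<bar>k\<bar>)) * (norm q ^ nat \<bar>k\<bar> / (1 - norm q))"
      unfolding kap_def norm_mult using norm_lam_le[of k] by (intro mult_mono) auto
    then show ?thesis by simp
  qed
  show "summable (\<lambda>n. real (Suc n) * norm q ^ n / (1 - norm q))"
    using geometric_deriv_sums[of "norm q"] q by (intro summable_divide sums_summable) auto
qed

lemma jj_summable: "(jj q) norm_summable_on UNIV"
    "(\<lambda>n. of_int n * jj q n) norm_summable_on UNIV" "(\<lambda>n. of_int (n^2) * jj q n) norm_summable_on UNIV"
  by (rule iffD1[OF summable_on_cong theta_abs_summable(1)[OF q, of 0]], simp add: jj_def)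
    (rule iffD1[OF summable_on_cong theta_abs_summable(3)[OF q, of 0]], simp add: jj_def norm_mult,
     rule iffD1[OF summable_on_cong theta_abs_summable(4)[OF q, of 0]], simp add: jj_def norm_mult)

text \<open>The reflection \<open>k -> 2 N + 1 - k\<close> keeps the exponent and flips the
  sign.\<close>

lemma theta_odd_zero: "(\<Sum>\<^sub>\<infinity>k. sg k * q powi (k^2 - (2 * N + 1) * k)) = 0"
proof -
  have b: "bij (\<lambda>k::int. 2 * N + 1 - k)"
    by (rule bij_betwI[where g = "\<lambda>k. 2 * N + 1 - k"]) auto
  have "(\<Sum>\<^sub>\<infinity>k. sg k * q powi (k^2 - (2 * N + 1) * k))
      = (\<Sum>\<^sub>\<infinity>k. sg (2 * N + 1 - k) * q powi ((2 * N + 1 - k)^2 - (2 * N + 1) * (2 * N + 1 - k)))"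
    by (rule infsum_reindex_bij_betw[OF b, of "\<lambda>k. sg k * q powi (k^2 - (2 * N + 1) * k)", symmetric])
  also have "\<dots> = (\<Sum>\<^sub>\<infinity>k. - (sg k * q powi (k^2 - (2 * N + 1) * k)))"
  proof (rule infsum_cong)
    fix k
    have "(2 * N + 1 - k)^2 - (2 * N + 1) * (2 * N + 1 - k) = k^2 - (2 * N + 1) * k"
      by (simp add: power2_eq_square algebra_simps)
    moreover have "sg (2 * N + 1 - k) = - sg k" by (simp add: sg_def)
    ultimately show "sg (2 * N + 1 - k) * q powi ((2 * N + 1 - k)^2 - (2 * N + 1) * (2 * N + 1 - k))
        = - (sg k * q powi (k^2 - (2 * N + 1) * k))" by (simp only: mult_minus_left)
  qed
  finally have "2 * (\<Sum>\<^sub>\<infinity>k. sg k * q powi (k^2 - (2 * N + 1) * k)) = 0"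
    by (simp only: infsum_uminus mult_2 eq_neg_iff_add_eq_0)
  then show ?thesis by simp
qed

lemma gam_summable: "(\<lambda>k. sg k * q powi (k^2 - 2 * N * k) * lam q k) summable_on UNIV"
proof (rule abs_summable_summable)
  have "(\<lambda>k. sg k * lam q k * q powi (k^2 + (- 2 * N) * k)) norm_summable_on UNIV"
    using norm_lam_le' q by (intro gauss_abs_summable[where B = "1 / (1 - norm q)" and D = 1]) (auto simp: norm_mult)
  then show "(\<lambda>k. sg k * q powi (k^2 - 2 * N * k) * lam q k) norm_summable_on UNIV"
    by (rule iffD1[OF summable_on_cong, rotated]) (simp add: norm_mult)
qed

lemma bet_summable: "(\<lambda>k. sg k * q powi (k^2 - 2 * N * k) * kap q k) summable_on UNIV"
proof (rule abs_summable_summable)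
  have "(\<lambda>k. sg k * kap q k * q powi (k^2 + (- 2 * N) * k)) norm_summable_on UNIV"
    using norm_kap_le q by (intro gauss_abs_summable[where B = "1 / (1 - norm q)" and D = 2]) (auto simp: norm_mult)
  then show "(\<lambda>k. sg k * q powi (k^2 - 2 * N * k) * kap q k) norm_summable_on UNIV"
    by (rule iffD1[OF summable_on_cong, rotated]) (simp add: norm_mult)
qed

text \<open>Raising \<open>N\<close> by 1 multiplies the term by \<open>q^(- 2 k)\<close>, and the
  difference cancels the denominator of \<open>lam\<close>. At \<open>k = 0\<close> it is 0, where
  the theta series would have the term 1.\<close>

lemma lam_shift: "q powi (k^2 - 2 * (N + 1) * k) * lam q k - q powi (k^2 - 2 * N * k) * lam q k
    = (if k = 0 then 0 else q powi (k^2 - (2 * N + 1) * k))"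
proof (cases "k = 0")
  case False
  define x where "x = q powi k"
  have x: "x \<noteq> 0" using q_nz by (simp add: x_def)
  have x2: "x^2 \<noteq> 1" using powi_neq_1[of "2 * k"] False
    by (simp add: x_def powi_sq)
  have "k^2 - 2 * N * k = (k^2 - 2 * (N + 1) * k) + (k + k)"
     "k^2 - (2 * N + 1) * k = (k^2 - 2 * (N + 1) * k) + k" by (simp_all add: algebra_simps)
  then have e: "q powi (k^2 - 2 * N * k) = q powi (k^2 - 2 * (N + 1) * k) * x^2"
     "q powi (k^2 - (2 * N + 1) * k) = q powi (k^2 - 2 * (N + 1) * k) * x"
    by (simp_all only: powi_add x_def power2_eq_square)
  have "lam q k = x / (1 - x^2)" by (simp add: lam_def x_def powi_sq)
  then have "lam q k * (1 - x^2) = x" using x2 by simp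
  moreover have "E * lam q k - E * x^2 * lam q k = E * (lam q k * (1 - x^2))" for E
    by (simp add: algebra_simps)
  ultimately show ?thesis using False unfolding e by simp
qed simp

text \<open>By \<open>lam_shift\<close>, consecutive values differ by the vanishing series of
  \<open>theta_odd_zero\<close> without its term 1 at \<open>k = 0\<close>, hence by
  \<open>- 1\<close>. The value at \<open>N = 0\<close> is 0 because \<open>lam\<close> is
  odd.\<close>

lemma gam_eq: "gam q N = - of_int N"
proof -
  have step: "gam q (N + 1) = gam q N - 1" for N
  proof -
    have s: "(\<lambda>k. sg k * q powi (k^2 - (2 * N + 1) * k)) summable_on UNIV"
      using abs_summable_summable[OF theta_abs_summable(1)[OF q, of "- (2 * N + 1)"]]
      by (simp add: algebra_simps)
    have "gam q (N + 1) - gam q N = (\<Sum>\<^sub>\<infinity>k. sg k * q powi (k^2 - 2 * (N + 1) * k) * lam q k - sg k * q powi (k^2 - 2 * N * k) * lam q k)"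
      unfolding gam_def by (intro infsum_diff [symmetric] gam_summable)
    also have "\<dots> = (\<Sum>\<^sub>\<infinity>k. sg k * (if k = 0 then 0 else q powi (k^2 - (2 * N + 1) * k)))"
      unfolding lam_shift [symmetric] by (simp add: algebra_simps)
    also have "\<dots> = (\<Sum>\<^sub>\<infinity>k\<in>UNIV - {0}. sg k * q powi (k^2 - (2 * N + 1) * k))"
      by (rule infsum_cong_neutral) auto
    also have "\<dots> = - 1"
    proof -
      have "(\<Sum>\<^sub>\<infinity>k\<in>insert 0 (UNIV - {0}). sg k * q powi (k^2 - (2 * N + 1) * k))
         = sg 0 * q powi (0^2 - (2 * N + 1) * 0) + (\<Sum>\<^sub>\<infinity>k\<in>UNIV - {0}. sg k * q powi (k^2 - (2 * N + 1) * k))"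
        by (rule infsum_insert) (auto intro: summable_on_subset_banach[OF s])
      moreover have "insert 0 (UNIV - {0}) = (UNIV :: int set)" by auto
      ultimately show ?thesis using theta_odd_zero[of N] by (simp add: add_eq_0_iff)
    qed
    finally show ?thesis by (simp add: algebra_simps)
  qed
  have 0: "gam q 0 = 0"
  proof -
    have "gam q 0 = (\<Sum>\<^sub>\<infinity>k. sg (- k) * q powi ((- k)^2) * lam q (- k))"
      unfolding gam_def using infsum_reindex_bij_betw[OF bij_uminus, of "\<lambda>k. sg k * q powi (k^2) * lam q k"] by simp
    also have "\<dots> = - gam q 0" by (simp add: gam_def lam_minus infsum_uminus)
    finally show ?thesis by simp
  qed
  show ?thesis
  proof (induction N rule: int_induct[where k = 0])
    case (step1 i) then show ?case by (simp add: step)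
  next
    case (step2 i) then show ?case using step[of "i - 1"] by (simp add: algebra_simps)
  qed (simp add: 0)
qed

text \<open>As for \<open>gam\<close>, but the extra factor \<open>k\<close> makes the exception at
  \<open>k = 0\<close> harmless. The shift \<open>k = i + M\<close> completes the square and leaves
  \<open>J2\<close> and a multiple of a vanishing theta series.\<close>

lemma bet_step: "bet q (M + 1) = bet q M - sg M * q powi (- (M^2 + M)) * J2 q"
proof -
  have s: "(\<lambda>k. sg k * of_int k * q powi (k^2 - k)) summable_on UNIV"
      "(\<lambda>k. sg k * q powi (k^2 - k)) summable_on UNIV"
    using abs_summable_summable[OF theta_abs_summable(3)[OF q, of "- 1"]]
      abs_summable_summable[OF theta_abs_summable(1)[OF q, of "- 1"]] by simp_all
  have "bet q (M + 1) - bet q M = (\<Sum>\<^sub>\<infinity>k. sg k * q powi (k^2 - 2 * (M + 1) * k) * kap q k - sg k * q powi (k^2 - 2 * M * k) * kap q k)"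
    unfolding bet_def by (intro infsum_diff [symmetric] bet_summable)
  also have "\<dots> = (\<Sum>\<^sub>\<infinity>k. sg k * of_int k * q powi (k^2 - (2 * M + 1) * k))"
  proof (rule infsum_cong)
    fix k
    have "sg k * q powi (k^2 - 2 * (M + 1) * k) * kap q k - sg k * q powi (k^2 - 2 * M * k) * kap q k
        = sg k * of_int k * (q powi (k^2 - 2 * (M + 1) * k) * lam q k - q powi (k^2 - 2 * M * k) * lam q k)"
      by (simp add: kap_def algebra_simps)
    then show "sg k * q powi (k^2 - 2 * (M + 1) * k) * kap q k - sg k * q powi (k^2 - 2 * M * k) * kap q k
       = sg k * of_int k * q powi (k^2 - (2 * M + 1) * k)"
      unfolding lam_shift by simp
  qed
  also have "\<dots> = (\<Sum>\<^sub>\<infinity>i. sg (i + M) * of_int (i + M) * q powi ((i + M)^2 - (2 * M + 1) * (i + M)))"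
    using infsum_reindex_bij_betw[of "\<lambda>i. i + M" UNIV UNIV "\<lambda>k. sg k * of_int k * q powi (k^2 - (2 * M + 1) * k)"]
    by (simp add: bij_betw_def surj_def)
  also have "\<dots> = (\<Sum>\<^sub>\<infinity>i. sg M * q powi (- (M^2 + M)) * (sg i * of_int i * q powi (i^2 - i) + of_int M * (sg i * q powi (i^2 - i))))"
  proof (rule infsum_cong)
    fix i
    have "(i + M)^2 - (2 * M + 1) * (i + M) = (i^2 - i) + (- (M^2 + M))"
      by (simp add: power2_eq_square algebra_simps)
    then have "q powi ((i + M)^2 - (2 * M + 1) * (i + M)) = q powi (i^2 - i) * q powi (- (M^2 + M))"
      by (simp only: powi_add)
    then show "sg (i + M) * of_int (i + M) * q powi ((i + M)^2 - (2 * M + 1) * (i + M))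
       = sg M * q powi (- (M^2 + M)) * (sg i * of_int i * q powi (i^2 - i) + of_int M * (sg i * q powi (i^2 - i)))"
      by (simp add: sg_add algebra_simps)
  qed
  also have "\<dots> = sg M * q powi (- (M^2 + M)) * (- J2 q + of_int M * 0)"
    using theta_odd_zero[of 0] s unfolding J2_def
    by (simp add: infsum_cmult_right' infsum_add summable_on_cmult_right)
  finally show ?thesis by (simp add: algebra_simps)
qed

lemma bet_minus: "bet q (- M) = bet q M"
proof -
  have "bet q M = (\<Sum>\<^sub>\<infinity>k. sg (- k) * q powi ((- k)^2 - 2 * M * (- k)) * kap q (- k))"
    unfolding bet_def using infsum_reindex_bij_betw[OF bij_uminus, of "\<lambda>k. sg k * q powi (k^2 - 2 * M * k) * kap q k"] by simp
  then show ?thesis by (simp add: bet_def kap_minus)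
qed

lemma bet_nat: "bet q (int M) = bet q 0 - J2 q * (\<Sum>j<M. sg (int j) * q powi (- ((int j)^2 + int j)))"
proof (induction M)
  case (Suc M)
  have "int (Suc M) = int M + 1" by simp
  then have "bet q (int (Suc M)) = bet q (int M) - sg (int M) * q powi (- ((int M)^2 + int M)) * J2 q"
    by (simp only: bet_step)
  also note Suc
  finally show ?case by (simp add: distrib_left mult_ac del: of_nat_Suc)
qed simp

text \<open>Expanding \<open>(n - k)^2\<close> pulls \<open>jj q n\<close> out of the
  convolution.\<close>

lemma jj_gam: "(\<Sum>\<^sub>\<infinity>k. jj q (n - k) * lam q k) = - of_int n * jj q n"
proof -
  have "jj q (n - k) * lam q k = jj q n * (sg k * q powi (k^2 - 2 * n * k) * lam q k)" for k
  proof -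
    have "(n - k)^2 = n^2 + (k^2 - 2 * n * k)" by (simp add: power2_eq_square algebra_simps)
    then show ?thesis by (simp only: jj_def powi_add sg_diff) (simp add: mult_ac)
  qed
  then have "(\<Sum>\<^sub>\<infinity>k. jj q (n - k) * lam q k) = jj q n * gam q n"
    by (simp only: gam_def infsum_cmult_right')
  then show ?thesis by (simp add: gam_eq)
qed

lemma jj_bet: "(\<Sum>\<^sub>\<infinity>k. jj q (n - k) * kap q k) = jj q n * bet q n"
proof -
  have "jj q (n - k) * kap q k = jj q n * (sg k * q powi (k^2 - 2 * n * k) * kap q k)" for k
  proof -
    have "(n - k)^2 = n^2 + (k^2 - 2 * n * k)" by (simp add: power2_eq_square algebra_simps)
    then show ?thesis by (simp only: jj_def powi_add sg_diff) (simp add: mult_ac)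
  qed
  then show ?thesis by (simp only: bet_def infsum_cmult_right')
qed

lemma infsum_convolution:
  fixes f g :: "int \<Rightarrow> complex"
  assumes "f norm_summable_on UNIV" "g norm_summable_on UNIV"
  shows "(\<Sum>\<^sub>\<infinity>n. \<Sum>\<^sub>\<infinity>k. f (n - k) * g k) = infsum f UNIV * infsum g UNIV"
    and "(\<lambda>n. \<Sum>\<^sub>\<infinity>k. f (n - k) * g k) summable_on UNIV"
proof -
  have b: "bij (\<lambda>(n, k). (n - k, k :: int))"
    by (rule bij_betwI[where g = "\<lambda>(n, k). (n + k, k)"]) auto
  have s: "(\<lambda>(n, k). f (n - k) * g k) summable_on UNIV \<times> UNIV"
    using abs_summable_summable[OF abs_summable_reindex[OF b, of "\<lambda>(n, k). f n * g k"]] abs_summable_prod[OF assms]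
    by (simp add: case_prod_unfold)
  show "(\<lambda>n. \<Sum>\<^sub>\<infinity>k. f (n - k) * g k) summable_on UNIV"
    by (rule summable_on_Sigma_banach[OF s])
  have "(\<Sum>\<^sub>\<infinity>n. \<Sum>\<^sub>\<infinity>k. f (n - k) * g k) = infsum (\<lambda>(n, k). f (n - k) * g k) (UNIV \<times> UNIV)"
    by (rule infsum_Sigma'_banach[OF s])
  also have "\<dots> = infsum (\<lambda>(n, k). f n * g k) (UNIV \<times> UNIV)"
    using infsum_reindex_bij_betw[OF b, of "\<lambda>(n, k). f n * g k"] by (simp add: case_prod_unfold)
  finally show "(\<Sum>\<^sub>\<infinity>n. \<Sum>\<^sub>\<infinity>k. f (n - k) * g k) = infsum f UNIV * infsum g UNIV"
    using infsum_prod[OF assms] by simp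
qed

text \<open>Multiply \<open>jj_gam\<close> by \<open>n = (n - k) + k\<close> and sum over
  \<open>n\<close>. The part with \<open>n - k\<close> factors through the sum of
  \<open>lam\<close>, which is 0 by oddness; the part with \<open>k\<close> is the convolution of
  \<open>jj\<close> with \<open>kap\<close>.\<close>

lemma P_kap: "infsum (jj q) UNIV * infsum (kap q) UNIV = - (\<Sum>\<^sub>\<infinity>n. of_int (n^2) * jj q n)"
proof -
  have lam0: "infsum (lam q) UNIV = 0"
  proof -
    have "infsum (lam q) UNIV = (\<Sum>\<^sub>\<infinity>k. lam q (- k))"
      using infsum_reindex_bij_betw[OF bij_uminus, of "lam q"] by simp
    then show ?thesis by (simp add: lam_minus infsum_uminus)
  qed
  note c1 = infsum_convolution[OF jj_summable(2) lam_summable]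
  note c2 = infsum_convolution[OF jj_summable(1) kap_summable]
  have "of_int (n^2) * jj q n = - ((\<Sum>\<^sub>\<infinity>k. of_int (n - k) * jj q (n - k) * lam q k) + (\<Sum>\<^sub>\<infinity>k. jj q (n - k) * kap q k))" for n
  proof -
    have b: "bij (\<lambda>k. n - k)" by (rule bij_betwI[where g = "\<lambda>k. n - k"]) auto
    have sk: "(\<lambda>k. jj q (n - k) * kap q k) summable_on UNIV"
    proof -
      have "(\<lambda>k. jj q (n - k) * kap q k) = (\<lambda>k. jj q n * (sg k * q powi (k^2 - 2 * n * k) * kap q k))"
      proof
        fix k
        have "(n - k)^2 = n^2 + (k^2 - 2 * n * k)" by (simp add: power2_eq_square algebra_simps)
        then show "jj q (n - k) * kap q k = jj q n * (sg k * q powi (k^2 - 2 * n * k) * kap q k)"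
          by (simp only: jj_def powi_add sg_diff) (simp add: mult_ac)
      qed
      then show ?thesis using summable_on_cmult_right[OF bet_summable] by simp
    qed
    have sl: "(\<lambda>k. jj q (n - k) * lam q k) summable_on UNIV"
    proof -
      have "(\<lambda>k. jj q (n - k) * lam q k) = (\<lambda>k. jj q n * (sg k * q powi (k^2 - 2 * n * k) * lam q k))"
      proof
        fix k
        have "(n - k)^2 = n^2 + (k^2 - 2 * n * k)" by (simp add: power2_eq_square algebra_simps)
        then show "jj q (n - k) * lam q k = jj q n * (sg k * q powi (k^2 - 2 * n * k) * lam q k)"
          by (simp only: jj_def powi_add sg_diff) (simp add: mult_ac)
      qed
      then show ?thesis using summable_on_cmult_right[OF gam_summable] by simp
    qed
    have "(\<Sum>\<^sub>\<infinity>k. of_int (n - k) * jj q (n - k) * lam q k)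
        = (\<Sum>\<^sub>\<infinity>k. of_int n * (jj q (n - k) * lam q k) - jj q (n - k) * kap q k)"
      by (rule infsum_cong) (simp add: kap_def algebra_simps)
    also have "\<dots> = of_int n * (\<Sum>\<^sub>\<infinity>k. jj q (n - k) * lam q k) - (\<Sum>\<^sub>\<infinity>k. jj q (n - k) * kap q k)"
      by (subst infsum_diff) (auto intro!: summable_on_cmult_right sl sk simp: infsum_cmult_right')
    finally show ?thesis by (simp add: jj_gam power2_eq_square)
  qed
  then have "(\<Sum>\<^sub>\<infinity>n. of_int (n^2) * jj q n) = - (infsum (\<lambda>n. of_int n * jj q n) UNIV * infsum (lam q) UNIV + infsum (jj q) UNIV * infsum (kap q) UNIV)"
    by (simp only: infsum_uminus infsum_add[OF c1(2) c2(2)] c1(1) c2(1))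
  then show ?thesis by (simp add: lam0)
qed

text \<open>Expand the denominators geometrically and collect the terms with
  \<open>r + i = n\<close>. With \<open>i = j\<close> the exponent becomes
  \<open>(n + 1)^2 - (j^2 + j)\<close>, and the inner sums over \<open>j\<close> are those of
  \<open>bet_nat\<close>.\<close>

lemma J2_mult_lambert_sum: "J2 q * lambert_sum q = (\<Sum>\<^sub>\<infinity>n. jj q (int (Suc n)) * (bet q (int (Suc n)) - bet q 0))"
proof -
  define g where "g = (\<lambda>(r, i). (- 1) ^ r * q ^ ((r + 1)^2 + i * (2 * r + 1)))"
  have g: "g norm_summable_on UNIV"
  proof (rule Infinite_Sum.abs_summable_on_comparison_test)
    show "(\<lambda>(r, i). (q ^ r) * (q ^ i)) norm_summable_on UNIV"
    proof -
      have "(\<lambda>r. q ^ r) norm_summable_on UNIV"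
        using q by (intro summable_norm_imp_summable_on) (simp add: norm_power summable_geometric)
      from abs_summable_prod[OF this this] show ?thesis by simp
    qed
    show "norm (g x) \<le> norm ((\<lambda>(r, i). (q ^ r) * (q ^ i)) x)" for x
    proof -
      obtain r i where x: "x = (r, i)" by force
      have "r + i \<le> (r + 1)^2 + i * (2 * r + 1)" by (simp add: power2_eq_square)
      then have "norm q ^ ((r + 1)^2 + i * (2 * r + 1)) \<le> norm q ^ (r + i)"
        using q by (intro power_decreasing) auto
      then show ?thesis by (simp add: x g_def norm_mult norm_power power_add)
    qed
  qed
  have inner: "infsum (\<lambda>i. g (r, i)) UNIV = (- 1) ^ r * q ^ ((r + 1)^2) / (1 - q ^ (2 * r + 1))" for r
  proof -
    have n: "norm (q ^ (2 * r + 1)) < 1" using q by (intro norm_power_less_1) auto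
    have eq: "g (r, i) = ((- 1) ^ r * q ^ ((r + 1)^2)) * (q ^ (2 * r + 1)) ^ i" for i
      by (simp only: g_def case_prod_conv power_add [of q "(r + 1)^2"] mult.commute[of i] power_mult [symmetric] mult.assoc)
    have "summable (\<lambda>i. norm ((q ^ (2 * r + 1)) ^ i))"
      using n by (simp only: norm_power) (intro summable_geometric, simp)
    then have "infsum (\<lambda>i. (q ^ (2 * r + 1)) ^ i) UNIV = 1 / (1 - q ^ (2 * r + 1))"
      using suminf_geometric[OF n] by (simp only: infsum_nat)
    then show ?thesis unfolding eq by (simp only: infsum_cmult_right') simp
  qed
  have "(\<lambda>r. infsum (\<lambda>i. g (r, i)) UNIV) summable_on UNIV"
    using summable_on_Sigma_banach[of "\<lambda>r i. g (r, i)" UNIV "\<lambda>_. UNIV"] abs_summable_summable[OF g] by simp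
  then have "summable (\<lambda>r. norm (infsum (\<lambda>i. g (r, i)) UNIV))"
    by (intro summable_on_imp_summable iffD1[OF summable_on_iff_abs_summable_on_complex])
  then have "lambert_sum q = infsum (\<lambda>r. infsum (\<lambda>i. g (r, i)) UNIV) UNIV"
    by (subst infsum_nat) (simp_all only: inner lambert_sum_def)
  also have "\<dots> = infsum (\<lambda>n. \<Sum>j\<le>n. g (n - j, j)) UNIV"
    by (rule infsum_triangle[OF g])
  also have "\<dots> = infsum (\<lambda>n. - (jj q (int (Suc n)) * (\<Sum>j\<le>n. sg (int j) * q powi (- ((int j)^2 + int j))))) UNIV"
  proof (rule infsum_cong)
    fix n
    have "g (n - j, j) = - (jj q (int (Suc n)) * (sg (int j) * q powi (- ((int j)^2 + int j))))" if jn: "j \<le> n" for j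
    proof -
      have "q ^ ((n - j + 1)^2 + j * (2 * (n - j) + 1)) = q powi int ((n - j + 1)^2 + j * (2 * (n - j) + 1))"
        by (simp only: power_int_of_nat)
      also have "int ((n - j + 1)^2 + j * (2 * (n - j) + 1)) = (int (Suc n))^2 + (- ((int j)^2 + int j))"
      proof -
        obtain d where "n = j + d" using le_Suc_ex[OF jn] by blast
        then show ?thesis by (simp add: power2_eq_square algebra_simps)
      qed
      also have "q powi \<dots> = q powi ((int (Suc n))^2) * q powi (- ((int j)^2 + int j))"
        by (rule powi_add)
      finally have "g (n - j, j) = (- 1) ^ (n - j) * (q powi ((int (Suc n))^2) * q powi (- ((int j)^2 + int j)))"
        by (simp only: g_def case_prod_conv)
      moreover have "(- 1) ^ (n - j) = - (sg (int (Suc n)) * sg (int j))"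
        using that by (auto simp: sg_def minus_one_power_iff)
      ultimately show ?thesis by (simp add: jj_def mult_ac)
    qed
    then show "(\<Sum>j\<le>n. g (n - j, j)) = - (jj q (int (Suc n)) * (\<Sum>j\<le>n. sg (int j) * q powi (- ((int j)^2 + int j))))"
      by (simp add: sum_distrib_left sum_negf del: of_nat_Suc)
  qed
  finally have *: "lambert_sum q = - (\<Sum>\<^sub>\<infinity>n. jj q (int (Suc n)) * (\<Sum>j\<le>n. sg (int j) * q powi (- ((int j)^2 + int j))))"
    by (simp add: infsum_uminus)
  show "J2 q * lambert_sum q = (\<Sum>\<^sub>\<infinity>n. jj q (int (Suc n)) * (bet q (int (Suc n)) - bet q 0))"
  proof -
    have "J2 q * lambert_sum q = (\<Sum>\<^sub>\<infinity>n. - J2 q * (jj q (int (Suc n)) * (\<Sum>j\<le>n. sg (int j) * q powi (- ((int j)^2 + int j)))))"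
      by (simp only: * infsum_cmult_right' infsum_uminus mult_minus_left mult_minus_right)
    also have "\<dots> = (\<Sum>\<^sub>\<infinity>n. jj q (int (Suc n)) * (bet q (int (Suc n)) - bet q 0))"
      by (rule infsum_cong) (simp only: bet_nat lessThan_Suc_atMost, simp del: of_nat_Suc)
    finally show ?thesis .
  qed
qed

text \<open>The summand \<open>jj q M * (bet q M - bet q 0)\<close> is even in \<open>M\<close> and
  vanishes at 0, so the one-sided series of \<open>J2_mult_lambert_sum\<close> is half of a
  bilateral one. Its first part is a convolution, evaluated by \<open>P_kap\<close>.\<close>

lemma two_J2_lambert_sum: "2 * J2 q * lambert_sum q = - (\<Sum>\<^sub>\<infinity>n. of_int (n^2) * jj q n) - bet q 0 * infsum (jj q) UNIV"
proof -
  define f where "f M = jj q M * (bet q M - bet q 0)" for M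
  have f_eq: "f = (\<lambda>M. jj q M * bet q M - bet q 0 * jj q M)"
    by (simp add: f_def fun_eq_iff right_diff_distrib)
  have even: "f (- M) = f M" for M by (simp add: f_def jj_def bet_minus)
  have "(\<lambda>M. jj q M * bet q M) summable_on UNIV"
    using infsum_convolution(2)[OF jj_summable(1) kap_summable] by (simp only: jj_bet)
  have s0: "(\<lambda>M. bet q 0 * jj q M) summable_on UNIV"
    by (rule summable_on_cmult_right[OF abs_summable_summable[OF jj_summable(1)]])
  have fs: "f summable_on UNIV"
    using summable_on_diff'[OF \<open>(\<lambda>M. jj q M * bet q M) summable_on UNIV\<close> s0]
    by (simp only: f_eq)
  then have fa: "f norm_summable_on UNIV" by (rule iffD1[OF summable_on_iff_abs_summable_on_complex])
  have "infsum f UNIV = 2 * (J2 q * lambert_sum q)"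
  proof -
    have n: "summable (\<lambda>n. norm (f (int n + 1)))" "summable (\<lambda>n. norm (f (- int n)))"
      using fa by (simp_all add: int_abs_summable_iff)
    have "infsum f UNIV = (\<Sum>n. f (int n + 1)) + (\<Sum>n. f (int n))"
      using n by (simp add: infsum_int[OF fa] suminf_add summable_norm_cancel even)
    also have "(\<Sum>n. f (int n)) = f (int 0) + (\<Sum>n. f (int (Suc n)))"
      using suminf_split_head[of "\<lambda>n. f (int n)"] n by (simp add: even summable_norm_cancel del: of_nat_Suc)
    also have "f (int 0) = 0" by (simp add: f_def)
    also have "(\<Sum>n. f (int (Suc n))) = infsum (\<lambda>n. f (int (Suc n))) UNIV"
      using n by (simp add: infsum_nat add.commute)
    also have "\<dots> = J2 q * lambert_sum q" by (simp only: J2_mult_lambert_sum f_def)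
    also have "(\<Sum>n. f (int n + 1)) = infsum (\<lambda>n. f (int (Suc n))) UNIV"
      using n by (simp add: infsum_nat add.commute)
    also have "\<dots> = J2 q * lambert_sum q" by (simp only: J2_mult_lambert_sum f_def)
    finally show ?thesis by simp
  qed
  moreover have "infsum f UNIV = infsum (\<lambda>M. jj q M * bet q M) UNIV - infsum (\<lambda>M. bet q 0 * jj q M) UNIV"
    using infsum_diff[OF \<open>(\<lambda>M. jj q M * bet q M) summable_on UNIV\<close> s0]
    by (simp only: f_eq)
  moreover have "infsum (\<lambda>M. jj q M * bet q M) UNIV = infsum (jj q) UNIV * infsum (kap q) UNIV"
    using infsum_convolution(1)[OF jj_summable(1) kap_summable] by (simp only: jj_bet)
  ultimately have "2 * (J2 q * lambert_sum q) = - (\<Sum>\<^sub>\<infinity>n. of_int (n^2) * jj q n) - bet q 0 * infsum (jj q) UNIV"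
    by (simp only: P_kap infsum_cmult_right')
  then show ?thesis by (simp only: mult.assoc)
qed

end

section \<open>The odd part of the Lambert series\<close>

lemma minus_powi: "(- q :: complex) powi n = sg n * q powi n"
  by (simp add: sg_def power_int_minus_left)

lemma sg_sq [simp]: "sg (n^2) = sg n" "sg (n * n) = sg n"
  by (simp_all add: sg_def power2_eq_square)

lemma powi_square: "(q ^ 2 :: complex) powi n = q powi (2 * n)"
  by (simp add: power_int_power)

definition theta4 :: "complex \<Rightarrow> complex" where "theta4 q = infsum (jj q) UNIV"

lemma jj_minus: "jj (- q) n = q powi (n^2)"
  by (simp add: jj_def minus_powi)

text \<open>The two sums run over the pairs with even and with odd coordinate sum. The substitution
  keeps the form \<open>x^2 + y^2\<close> diagonal while splitting \<open>x^2 - y^2\<close> into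
  linear factors.\<close>

lemma infsum_rotate:
  fixes G :: "int \<times> int \<Rightarrow> complex"
  assumes "G norm_summable_on UNIV"
  shows "infsum G UNIV = (\<Sum>\<^sub>\<infinity>(a, b). G (a + b, a - b)) + (\<Sum>\<^sub>\<infinity>(a, b). G (a + b + 1, a - b))"
proof -
  define E where "E = {(x :: int, y :: int). even (x + y)}"
  have U: "UNIV = E \<union> - E" by auto
  have "infsum G UNIV = infsum G E + infsum G (- E)"
    by (subst U, rule infsum_Un_disjoint)
      (auto intro!: summable_on_subset_banach[OF abs_summable_summable[OF assms]])
  also have "infsum G E = (\<Sum>\<^sub>\<infinity>(a, b). G (a + b, a - b))"
  proof -
    have "bij_betw (\<lambda>(a, b). (a + b, a - b)) UNIV E"
    proof (rule bij_betwI[where g = "\<lambda>(x, y). ((x + y) div 2, (x - y) div 2)"])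
      show "(\<lambda>(a, b). (a + b, a - b)) ((\<lambda>(x, y). ((x + y) div 2, (x - y) div 2)) p) = p" if "p \<in> E" for p
      proof -
        obtain x y where p: "p = (x, y)" by force
        with that have "even (x + y)" by (simp add: E_def)
        then obtain k where k: "x + y = 2 * k" by (rule evenE)
        then have "x = 2 * k - y" by simp
        then show ?thesis by (simp add: p)
      qed
    qed (auto simp: E_def)
    from infsum_reindex_bij_betw[OF this, of G] show ?thesis by (simp add: case_prod_unfold)
  qed
  also have "infsum G (- E) = (\<Sum>\<^sub>\<infinity>(a, b). G (a + b + 1, a - b))"
  proof -
    have "bij_betw (\<lambda>(a, b). (a + b + 1, a - b)) UNIV (- E)"
    proof (rule bij_betwI[where g = "\<lambda>(x, y). ((x + y) div 2, (x - y) div 2)"])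
      show "(\<lambda>(a, b). (a + b + 1, a - b)) ((\<lambda>(x, y). ((x + y) div 2, (x - y) div 2)) p) = p" if "p \<in> - E" for p
      proof -
        obtain x y where p: "p = (x, y)" by force
        with that have "odd (x + y)" by (simp add: E_def)
        then obtain k where k: "x + y = 2 * k + 1" by (rule oddE)
        then have "x = 2 * k + 1 - y" by simp
        moreover have "(2 * k + 1 - 2 * y) div 2 = k - y" by presburger
        ultimately show ?thesis by (simp add: p)
      qed
    qed (auto simp: E_def)
    from infsum_reindex_bij_betw[OF this, of G] show ?thesis by (simp add: case_prod_unfold)
  qed
  finally show ?thesis .
qed

context
  fixes q :: complex
  assumes q: "0 < norm q" "norm q < 1"
begin

lemma q2: "0 < norm (q^2)" "norm (q^2) < 1"
  using q by (auto simp: norm_power power_less_one_iff)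

lemma mq: "0 < norm (- q)" "norm (- q) < 1"
  using q by auto

lemma J2_minus: "J2 (- q) = J2 q"
proof -
  have "sg (k^2 - k) = 1" for k by (simp add: sg_diff)
  then show ?thesis by (simp add: J2_def minus_powi)
qed

lemma bet_minus_q: "bet (- q) 0 = bet q 0"
proof -
  have "kap (- q) k = sg k * kap q k" for k
    by (simp add: kap_def lam_def minus_powi sg_def)
  then show ?thesis by (simp add: bet_def minus_powi mult_ac)
qed

lemma theta_odd_zero': "(\<Sum>\<^sub>\<infinity>k. sg k * q powi (k^2 + k)) = 0"
  using theta_odd_zero[OF q, of "- 1"] by simp

lemma J2_eq: "(\<Sum>\<^sub>\<infinity>k. sg k * of_int (2 * k + 1) * q powi (k^2 + k)) = 2 * J2 q"
proof -
  have s: "(\<lambda>k. sg k * of_int k * q powi (k^2 + k)) summable_on UNIV" "(\<lambda>k. sg k * q powi (k^2 + k)) summable_on UNIV"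
    using abs_summable_summable[OF theta_abs_summable(3)[OF q, of 1]]
      abs_summable_summable[OF theta_abs_summable(1)[OF q, of 1]] by simp_all
  have b: "bij (\<lambda>i::int. i + 1)" by (rule bij_betwI[where g = "\<lambda>i. i - 1"]) auto
  have "J2 q = - (\<Sum>\<^sub>\<infinity>k. sg (k + 1) * of_int (k + 1) * q powi ((k + 1)^2 - (k + 1)))"
    unfolding J2_def by (simp only: infsum_reindex_bij_betw[OF b, of "\<lambda>k. sg k * of_int k * q powi (k^2 - k)"])
  also have "\<dots> = (\<Sum>\<^sub>\<infinity>k. sg k * of_int k * q powi (k^2 + k) + sg k * q powi (k^2 + k))"
    unfolding infsum_uminus [symmetric]
    by (rule infsum_cong) (simp add: sg_add power2_eq_square algebra_simps)
  also have "\<dots> = (\<Sum>\<^sub>\<infinity>k. sg k * of_int k * q powi (k^2 + k))"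
    by (simp only: infsum_add[OF s] theta_odd_zero' add_0_right)
  finally have 1: "J2 q = (\<Sum>\<^sub>\<infinity>k. sg k * of_int k * q powi (k^2 + k))" .
  have "(\<Sum>\<^sub>\<infinity>k. sg k * of_int (2 * k + 1) * q powi (k^2 + k))
      = (\<Sum>\<^sub>\<infinity>k. 2 * (sg k * of_int k * q powi (k^2 + k)) + sg k * q powi (k^2 + k))"
    by (rule infsum_cong) (simp add: algebra_simps)
  also have "\<dots> = 2 * J2 q"
    by (simp only: infsum_add[OF summable_on_cmult_right[OF s(1)] s(2)] infsum_cmult_right' theta_odd_zero' 1 add_0_right)
  finally show ?thesis .
qed

lemma J2_series: "J2 q = (\<Sum>n. (q^2) ^ tri n * ((- 1) ^ n * (2 * of_nat n + 1)))"
proof -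
  have "(\<lambda>k. sg k * of_int k * q powi (k^2 + (- 1) * k)) norm_summable_on UNIV"
    by (rule theta_abs_summable(3)[OF q])
  then have s: "(\<lambda>k. sg k * of_int k * q powi (k^2 - k)) norm_summable_on UNIV" by simp
  have e: "sg (int n + 1) * of_int (int n + 1) * q powi ((int n + 1)^2 - (int n + 1))
      + sg (- int n) * of_int (- int n) * q powi ((- int n)^2 - (- int n))
      = - ((q^2) ^ tri n * ((- 1) ^ n * (2 * of_nat n + 1)))" for n
  proof -
    have "(int n + 1)^2 - (int n + 1) = int (2 * tri n)" "(- int n)^2 - (- int n) = int (2 * tri n)"
      by (simp_all only: two_tri) (simp_all add: power2_eq_square algebra_simps)
    then show ?thesis
      by (simp only: power_int_of_nat power_mult sg_add sg_simps sg_of_nat) (simp add: algebra_simps)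
  qed
  have "summable (\<lambda>n. sg (int n + 1) * of_int (int n + 1) * q powi ((int n + 1)^2 - (int n + 1))
      + sg (- int n) * of_int (- int n) * q powi ((- int n)^2 - (- int n)))"
    using s unfolding int_abs_summable_iff by (intro summable_add) (auto intro: summable_norm_cancel)
  then have "summable (\<lambda>n. (q^2) ^ tri n * ((- 1) ^ n * (2 * of_nat n + 1)))"
    unfolding e by (simp only: summable_minus_iff)
  from suminf_minus[OF this] show ?thesis
    unfolding J2_def infsum_int[OF s] e by simp
qed

end

context
  fixes q :: complex
  assumes q: "0 < norm q" "norm q < 1"
begin

text \<open>A Wronskian of \<open>theta4 q\<close> and \<open>theta4 (- q)\<close>, written as a
  double series with weight \<open>x^2 - y^2\<close>. After \<open>infsum_rotate\<close> the even
  class has weight \<open>4 a b\<close>, is odd under \<open>b -> - b\<close> and vanishes; the odd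
  class has weight \<open>(2 a + 1) (2 b + 1)\<close> and factors into two copies of the series in
  \<open>J2_eq\<close>.\<close>

lemma theta_derivative_product:
  "theta4 q * (\<Sum>\<^sub>\<infinity>n. of_int (n^2) * jj (- q) n) - theta4 (- q) * (\<Sum>\<^sub>\<infinity>n. of_int (n^2) * jj q n) = 4 * q * J2 (q^2) ^ 2"
proof -
  note s1 = jj_summable(1)[OF q] and s1' = jj_summable(1)[OF mq[OF q]]
  note s3 = jj_summable(3)[OF q] and s3' = jj_summable(3)[OF mq[OF q]]
  define G1 where "G1 = (\<lambda>(x, y). of_int (x^2) * jj (- q) x * jj q y)"
  define G2 where "G2 = (\<lambda>(x, y). jj (- q) x * (of_int (y^2) * jj q y))"
  define G where "G = (\<lambda>p. G1 p - G2 p)"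
  have G1: "G1 norm_summable_on UNIV" using abs_summable_prod[OF s3' s1] by (simp add: G1_def)
  have G2: "G2 norm_summable_on UNIV" using abs_summable_prod[OF s1' s3] by (simp add: G2_def)
  have G: "G norm_summable_on UNIV" unfolding G_def
    by (rule iffD1[OF summable_on_iff_abs_summable_on_complex])
      (rule summable_on_diff'[OF abs_summable_summable[OF G1] abs_summable_summable[OF G2]])
  have G_eq: "G (x, y) = of_int ((x + y) * (x - y)) * sg y * (q powi (x^2) * q powi (y^2))" for x y
    by (simp add: G_def G1_def G2_def jj_minus) (simp add: jj_def power2_eq_square algebra_simps)
  have "theta4 q * (\<Sum>\<^sub>\<infinity>n. of_int (n^2) * jj (- q) n) - theta4 (- q) * (\<Sum>\<^sub>\<infinity>n. of_int (n^2) * jj q n) = infsum G UNIV"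
  proof -
    have "infsum G1 UNIV = (\<Sum>\<^sub>\<infinity>n. of_int (n^2) * jj (- q) n) * theta4 q"
      using infsum_prod[OF s3' s1] by (simp add: G1_def theta4_def)
    moreover have "infsum G2 UNIV = theta4 (- q) * (\<Sum>\<^sub>\<infinity>n. of_int (n^2) * jj q n)"
      using infsum_prod[OF s1' s3] by (simp add: G2_def theta4_def)
    ultimately show ?thesis
      using infsum_diff[OF abs_summable_summable[OF G1] abs_summable_summable[OF G2]] by (simp add: G_def mult.commute)
  qed
  also have "\<dots> = (\<Sum>\<^sub>\<infinity>(a, b). G (a + b, a - b)) + (\<Sum>\<^sub>\<infinity>(a, b). G (a + b + 1, a - b))"
    by (rule infsum_rotate[OF G])
  also have "(\<Sum>\<^sub>\<infinity>(a, b). G (a + b, a - b)) = 0"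
  proof -
    have b: "bij (\<lambda>(a, b :: int). (a :: int, - b))"
      by (rule bij_betwI[where g = "\<lambda>(a, b). (a, - b)"]) auto
    have "(\<Sum>\<^sub>\<infinity>(a, b). G (a + b, a - b)) = (\<Sum>\<^sub>\<infinity>(a, b). G (a - b, a + b))"
      using infsum_reindex_bij_betw[OF b, of "\<lambda>(a, b). G (a + b, a - b)"] by (simp add: case_prod_unfold)
    also have "\<dots> = (\<Sum>\<^sub>\<infinity>p. - (case p of (a, b) \<Rightarrow> G (a + b, a - b)))"
      by (rule infsum_cong) (auto simp: G_eq sg_add sg_diff mult_ac)
    finally have "2 * (\<Sum>\<^sub>\<infinity>(a, b). G (a + b, a - b)) = 0"
      by (simp only: infsum_uminus mult_2 eq_neg_iff_add_eq_0)
    then show ?thesis by simp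
  qed
  also have "(\<Sum>\<^sub>\<infinity>(a, b). G (a + b + 1, a - b))
      = (\<Sum>\<^sub>\<infinity>(a, b). (sg a * of_int (2 * a + 1) * (q^2) powi (a^2 + a)) * (q * (sg b * of_int (2 * b + 1) * (q^2) powi (b^2 + b))))"
  proof (rule infsum_cong)
    fix p :: "int \<times> int"
    obtain a b where p: "p = (a, b)" by force
    have "(a + b + 1)^2 + (a - b)^2 = 2 * (a^2 + a) + 1 + 2 * (b^2 + b)" by (simp add: power2_eq_square algebra_simps)
    then have "q powi ((a + b + 1)^2) * q powi ((a - b)^2) = q powi (2 * (a^2 + a)) * q powi 1 * q powi (2 * (b^2 + b))"
      by (simp only: powi_add[OF q, symmetric])
    moreover have "(a + b + 1 + (a - b)) * (a + b + 1 - (a - b)) = (2 * a + 1) * (2 * b + 1)"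
      by (simp add: algebra_simps)
    ultimately have "G (a + b + 1, a - b) = of_int ((2 * a + 1) * (2 * b + 1)) * sg (a - b)
        * (q powi (2 * (a^2 + a)) * q powi 1 * q powi (2 * (b^2 + b)))"
      by (simp only: G_eq)
    then show "(case p of (a, b) \<Rightarrow> G (a + b + 1, a - b))
        = (case p of (a, b) \<Rightarrow> (sg a * of_int (2 * a + 1) * (q^2) powi (a^2 + a)) * (q * (sg b * of_int (2 * b + 1) * (q^2) powi (b^2 + b))))"
      by (simp only: p case_prod_conv of_int_mult powi_square sg_diff power_int_1_right mult_ac)
  qed
  also have "\<dots> = 4 * q * J2 (q^2) ^ 2"
  proof -
    have s: "(\<lambda>a. sg a * of_int (2 * a + 1) * (q^2) powi (a^2 + a)) norm_summable_on UNIV"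
    proof (rule iffD1[OF summable_on_iff_abs_summable_on_complex])
      have "(\<lambda>a. 2 * (sg a * of_int a * (q^2) powi (a^2 + 1 * a)) + sg a * (q^2) powi (a^2 + 1 * a)) summable_on UNIV"
        by (intro summable_on_add summable_on_cmult_right
          abs_summable_summable[OF theta_abs_summable(3)[OF q2[OF q]]] abs_summable_summable[OF theta_abs_summable(1)[OF q2[OF q]]])
      then show "(\<lambda>a. sg a * of_int (2 * a + 1) * (q^2) powi (a^2 + a)) summable_on UNIV"
        by (rule iffD1[OF summable_on_cong, rotated]) (simp add: algebra_simps)
    qed
    have s': "(\<lambda>a. q * (sg a * of_int (2 * a + 1) * (q^2) powi (a^2 + a))) norm_summable_on UNIV"
      using summable_on_cmult_right[OF s, of "norm q"] by (simp add: norm_mult mult.assoc)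
    have "(\<Sum>\<^sub>\<infinity>a. sg a * of_int (2 * a + 1) * (q^2) powi (a^2 + a)) = 2 * J2 (q^2)"
      by (rule J2_eq[OF q2[OF q]])
    then show ?thesis using infsum_prod[OF s s'] by (simp only: infsum_cmult_right' UNIV_Times_UNIV) (simp add: power2_eq_square)
  qed
  finally show ?thesis by simp
qed

text \<open>
  The term \<open>bet q 0\<close> in \<open>two_J2_lambert_sum\<close> is even in \<open>q\<close> and therefore cancels here.
\<close>

lemma lambert_sum_product: "J2 q * (lambert_sum q * theta4 (- q) - lambert_sum (- q) * theta4 q) = 2 * q * J2 (q^2) ^ 2"
proof -
  have "2 * J2 q * lambert_sum q = - (\<Sum>\<^sub>\<infinity>n. of_int (n^2) * jj q n) - bet q 0 * theta4 q"
    unfolding theta4_def by (rule two_J2_lambert_sum[OF q])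
  moreover have "2 * J2 q * lambert_sum (- q) = - (\<Sum>\<^sub>\<infinity>n. of_int (n^2) * jj (- q) n) - bet q 0 * theta4 (- q)"
    using two_J2_lambert_sum[OF mq[OF q]] unfolding theta4_def J2_minus[OF q] bet_minus_q[OF q] .
  ultimately have "2 * (J2 q * (lambert_sum q * theta4 (- q) - lambert_sum (- q) * theta4 q)) = 2 * (2 * q * J2 (q^2) ^ 2)"
    using theta_derivative_product by algebra
  then show ?thesis by simp
qed

end

section \<open>The product of \<open>phi\<close> and a theta function\<close>

lemma norm_qpoch_le:
  assumes "norm a \<le> A"
  shows "norm (qpoch a q n) \<le> norm (qpoch (- of_real A) (of_real (norm q)) n)"
proof -
  have A: "A \<ge> 0" using assms norm_ge_zero order_trans by blast
  show ?thesis unfolding qpoch_def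
  proof (simp only: prod_norm [symmetric], rule prod_mono, intro conjI)
    fix k
    have "norm (1 - a * q ^ k) \<le> norm (1 :: complex) + norm (a * q ^ k)" by (rule norm_triangle_ineq4)
    also have "\<dots> \<le> 1 + A * norm q ^ k"
      using assms by (simp add: norm_mult norm_power mult_right_mono)
    also have "\<dots> = norm (of_real (1 + A * norm q ^ k) :: complex)"
      using A by (subst norm_of_real) simp
    finally show "norm (1 - a * q ^ k) \<le> norm (1 - - complex_of_real A * complex_of_real (norm q) ^ k)"
      by simp
  qed simp
qed

lemma norm_qpoch_ge:
  assumes "norm a \<le> A" "A \<le> 1" "norm q \<le> 1"
  shows "norm (qpoch (of_real A) (of_real (norm q)) n) \<le> norm (qpoch a q n)"
proof -
  have A: "A \<ge> 0" using assms(1) norm_ge_zero order_trans by blast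
  show ?thesis unfolding qpoch_def
  proof (simp only: prod_norm [symmetric], rule prod_mono, intro conjI)
    fix k
    have p: "norm q ^ k \<le> 1" using assms by (intro power_le_one) auto
    have "A * norm q ^ k \<le> 1" using mult_mono[OF assms(2) p] A by simp
    then have "norm (of_real (1 - A * norm q ^ k) :: complex) = 1 - A * norm q ^ k"
      by (subst norm_of_real) simp
    also have "\<dots> \<le> 1 - norm (a * q ^ k)"
      using assms(1) by (simp add: norm_mult norm_power mult_right_mono)
    also have "\<dots> \<le> norm (1 - a * q ^ k)"
      using norm_triangle_ineq2[of 1 "a * q ^ k"] by simp
    finally show "norm (1 - complex_of_real A * complex_of_real (norm q) ^ k) \<le> norm (1 - a * q ^ k)"
      by simp
  qed simp
qed

text \<open>Comparison with products at the real point \<open>norm q\<close> makes the bounds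
  independent of \<open>a\<close>; in \<open>gauss_sum_eq\<close> the parameter \<open>a\<close>
  itself runs to a limit.\<close>

lemma qpoch_uniform_bounds:
  assumes "norm q < 1"
  obtains B where "B > 0" "\<And>a n. norm a \<le> 1 \<Longrightarrow> norm (qpoch a q n) \<le> B"
    "\<And>a n. norm a \<le> norm q \<Longrightarrow> norm (1 / qpoch a q n) \<le> B"
proof -
  define r where "r = complex_of_real (norm q)"
  have r: "norm r < 1" "norm r = norm q" using assms by (simp_all add: r_def)
  obtain C where C: "C > 0" "\<And>n. norm (qpoch (- of_real 1) r n) \<le> C" using qpoch_bound[OF r(1)] by blast
  obtain D where D: "D > 0" "\<And>n. norm (1 / qpoch r r n) \<le> D" using qpoch_inverse_bound[OF r(1) r(1)] by blast
  show ?thesis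
  proof (rule that[of "max C D"])
    show "norm (qpoch a q n) \<le> max C D" if "norm a \<le> 1" for a n
      using norm_qpoch_le[OF that, of q n] C(2)[of n] by (simp add: r_def)
    show "norm (1 / qpoch a q n) \<le> max C D" if "norm a \<le> norm q" for a n
    proof -
      have "norm (qpoch r r n) \<le> norm (qpoch a q n)"
        using norm_qpoch_ge[OF that, of q n] assms by (simp add: r_def)
      moreover have "norm (qpoch r r n) > 0" using qpoch_nonzero[OF r(1) r(1)] by simp
      ultimately have "norm (1 / qpoch a q n) \<le> norm (1 / qpoch r r n)"
        unfolding norm_divide norm_one by (intro divide_left_mono mult_pos_pos) linarith+
      then show ?thesis using D(2)[of n] by simp
    qed
  qed (use C in simp)
qed

lemma geometric_tannery:
  fixes u :: "nat \<Rightarrow> nat \<Rightarrow> complex"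
  assumes q: "norm q < 1" and lim: "\<And>m. (\<lambda>k. u m k) \<longlonglongrightarrow> v m" and bd: "\<And>m k. norm (u m k) \<le> C"
  shows "(\<lambda>k. \<Sum>m. q ^ m * u m k) \<longlonglongrightarrow> (\<Sum>m. q ^ m * v m)"
proof (rule tannerys_theorem[THEN conjunct2, THEN conjunct2])
  show "(\<lambda>k. q ^ m * u m k) \<longlonglongrightarrow> q ^ m * v m" for m by (intro tendsto_mult lim tendsto_const)
  show "\<forall>\<^sub>F (m, k) in at_top \<times>\<^sub>F sequentially. norm (q ^ m * u m k) \<le> norm q ^ m * C"
    using bd by (intro always_eventually) (auto simp: norm_mult norm_power intro!: mult_left_mono)
  show "summable (\<lambda>m. norm q ^ m * C)" using q by (intro summable_mult2 summable_geometric) auto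
qed simp

context
  fixes q :: complex
  assumes q: "0 < norm q" "norm q < 1"
begin

lemma nQ: "norm (q^2) < 1" using q2[OF q] by simp

section \<open>A Bailey pair for the squared denominators\<close>

abbreviation "qp \<equiv> qpoch (q^2) (q^2)"

lemma qp_nz [simp]: "qp n \<noteq> 0" by (rule qpoch_nonzero[OF nQ nQ])

lemma qp_Suc: "qp (Suc n) = qp n * (1 - q ^ (2 * n + 2))"
  by (simp add: qpoch_Suc power_mult [symmetric] power_add [symmetric] del: power_Suc)

lemma pow_neq_1: "n > 0 \<Longrightarrow> q ^ n \<noteq> 1"
  using powi_neq_1[OF q, of "int n"] by simp

lemma pow_neq_m1: "n > 0 \<Longrightarrow> q ^ n \<noteq> - 1"
proof
  assume "n > 0" "q ^ n = - 1"
  then have "q ^ (n + n) = 1" by (simp add: power_add)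
  then show False using pow_neq_1[of "n + n"] \<open>n > 0\<close> by simp
qed

text \<open>The summands telescope: \<open>- G\<close> is their partial sum. The induction stops at
  \<open>R = N\<close>, because \<open>N - r\<close> cannot decrease further, and the last summand
  is added separately.\<close>

lemma telescoped_zero:
  assumes "N > 0"
  shows "(\<Sum>r\<le>N. (- 1) ^ r * (q^2) ^ tri (r - 1) * (1 - q ^ (4 * r + 2)) / (qp (N - r) * qp (N + r + 1))) = 0"
proof -
  define t where "t r = (- 1) ^ r * (q^2) ^ tri (r - 1) * (1 - q ^ (4 * r + 2)) / (qp (N - r) * qp (N + r + 1))" for r
  define G where "G r = (- 1) ^ r * (q^2) ^ tri (r - 1) * (1 - q ^ (2 * r)) / ((1 - q ^ (2 * N)) * qp (N - r) * qp (N + r))" for r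
  have N1: "1 - q ^ (2 * N) \<noteq> 0" using pow_neq_1[of "2 * N"] assms by simp
  have partial: "(\<Sum>r<R. t r) = - G R" if "R \<le> N" for R
    using that
  proof (induction R)
    case (Suc R)
    then obtain d where d: "N = R + Suc d" using less_imp_Suc_add[of R N] by auto
    have nz: "1 - q ^ (2 * d + 2) \<noteq> 0" "1 - q ^ (2 * (N + R) + 2) \<noteq> 0"
      using pow_neq_1[of "2 * d + 2"] pow_neq_1[of "2 * (N + R) + 2"] by simp_all
    define K where "K = (- 1) ^ R * (q^2) ^ tri (R - 1) / (qp d * qp (N + R))"
    define x where "x = q ^ (2 * R)"
    define z where "z = q ^ (2 * d + 2)"
    have xz: "q ^ (2 * N) = x * z" by (simp add: x_def z_def d algebra_simps flip: power_add)
    have e: "q ^ (2 * (N + R) + 2) = x * x * z * q^2" "q ^ (4 * R + 2) = x * x * q^2" "q ^ (2 * Suc R) = x * q^2"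
      by (simp_all add: x_def z_def d algebra_simps flip: power_add)
    have i: "N - R = Suc d" "N - Suc R = d" "N + R + 1 = Suc (N + R)" "N + Suc R = Suc (N + R)" using d by auto
    have t: "t R = K * ((1 - x * x * q^2) / ((1 - z) * (1 - x * x * z * q^2)))"
      unfolding t_def i qp_Suc e K_def z_def by simp
    have GR: "G R = K * ((1 - x) / ((1 - x * z) * (1 - z)))"
      unfolding G_def i qp_Suc e xz K_def x_def [symmetric] z_def [symmetric] by simp
    have "(q^2) ^ tri (Suc R - 1) = (q^2) ^ tri (R - 1) * x"
      by (cases R) (simp_all add: x_def power_mult power_add flip: power2_eq_square)
    then have GS: "G (Suc R) = - (K * (x * (1 - x * q^2) / ((1 - x * z) * (1 - x * x * z * q^2))))"
      unfolding G_def i qp_Suc e xz K_def by (simp add: mult_ac)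
    have "(\<Sum>r<Suc R. t r) = - G R + t R" using Suc by simp
    also have "\<dots> = - G (Suc R)"
    proof -
      have nzs: "1 - x * z \<noteq> 0" "1 - z \<noteq> 0" "1 - x * x * z * q^2 \<noteq> 0"
        using N1 nz unfolding xz e z_def by auto
      have "(1 - x * x * q^2) * (1 - x * z) - (1 - x) * (1 - x * x * z * q^2) = x * (1 - x * q^2) * (1 - z)"
        by algebra
      then have eq: "- ((1 - x) / ((1 - x * z) * (1 - z))) + (1 - x * x * q^2) / ((1 - z) * (1 - x * x * z * q^2))
          = x * (1 - x * q^2) / ((1 - x * z) * (1 - x * x * z * q^2))"
        using nzs by (simp add: divide_simps)
      show ?thesis
        unfolding t GR GS by (simp only: minus_minus distrib_left [symmetric] mult_minus_right [symmetric] eq)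
    qed
    finally show ?case .
  qed (simp add: G_def)
  have "(\<Sum>r\<le>N. t r) = - G N + t N"
    using partial[of N] by (simp add: lessThan_Suc_atMost [symmetric])
  also have "t N = G N"
  proof -
    have "1 - q ^ (4 * N + 2) \<noteq> 0" using pow_neq_1[of "4 * N + 2"] by simp
    moreover have "qp (N + N + 1) = qp (N + N) * (1 - q ^ (4 * N + 2))"
      using qp_Suc[of "N + N"] by (simp add: algebra_simps)
    ultimately show ?thesis using N1 by (simp add: t_def G_def)
  qed
  finally show ?thesis by (simp add: t_def)
qed

text \<open>The alpha side of a Bailey pair relative to \<open>q^2\<close> in base
  \<open>q^2\<close>; up to the constant \<open>1 - q^2\<close>, the beta side is the left side of
  \<open>inverse_square_expansion\<close>.\<close>

definition alpha :: "nat \<Rightarrow> complex" where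
  "alpha r = (- 1) ^ r * q ^ (r^2 + r) * (1 + q ^ (2 * r + 1)) / (1 - q ^ (2 * r + 1))"

text \<open>With \<open>b = q^(2 n + 3)\<close> and \<open>N = n + 1\<close>, the sum for
  \<open>N\<close> times \<open>(1 - b)^2\<close> must equal the sum for \<open>n\<close>. Over the
  common denominators of \<open>N\<close>, the difference is \<open>q^(2 N)\<close> times the sum of
  \<open>telescoped_zero\<close>.\<close>

lemma inverse_square_expansion:
  "1 / (qpoch q (q^2) (n + 1))^2 = (\<Sum>r\<le>n. alpha r / (qp (n - r) * qp (n + r + 1)))"
proof (induction n)
  case 0
  have "1 - q \<noteq> 0" "1 + q \<noteq> 0" using pow_neq_1[of 1] pow_neq_m1[of 1] by (auto simp: add_eq_0_iff)
  moreover have "1 - q^2 = (1 - q) * (1 + q)" by algebra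
  ultimately show ?case
    by (simp add: alpha_def qpoch_def power2_eq_square divide_simps)
next
  case (Suc n)
  define N where "N = Suc n"
  define b where "b = q ^ (2 * n + 3)"
  have b: "1 - b \<noteq> 0" using pow_neq_1[of "2 * n + 3"] by (simp add: b_def)
  have H: "alpha r / (qp (n - r) * qp (n + r + 1)) = alpha r * ((1 - q ^ (2 * (N - r))) * (1 - q ^ (2 * (N + r + 1)))) / (qp (N - r) * qp (N + r + 1))"
    if "r \<le> n" for r
  proof -
    have "N - r = Suc (n - r)" "N + r + 1 = Suc (n + r + 1)" using that by (auto simp: N_def)
    moreover have "2 * (n - r) + 2 = 2 * Suc (n - r)" "2 * (n + r + 1) + 2 = 2 * Suc (n + r + 1)" by auto
    moreover have "1 - q ^ (2 * Suc (n - r)) \<noteq> 0" "1 - q ^ (2 * Suc (n + r + 1)) \<noteq> 0"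
      using pow_neq_1[of "2 * Suc (n - r)"] pow_neq_1[of "2 * Suc (n + r + 1)"] by simp_all
    ultimately show ?thesis by (simp only: qp_Suc) simp
  qed
  have B: "alpha r * ((1 - b)^2 - (1 - q ^ (2 * (N - r))) * (1 - q ^ (2 * (N + r + 1))))
      = q ^ (2 * N) * ((- 1) ^ r * (q^2) ^ tri (r - 1) * (1 - q ^ (4 * r + 2)))" if rN: "r \<le> N" for r
  proof -
    obtain d where d: "N = r + d" using le_Suc_ex[OF rN] by blast
    define x where "x = q ^ (2 * r + 1)"
    define z where "z = q ^ (2 * d)"
    have x: "1 - x \<noteq> 0" using pow_neq_1[of "2 * r + 1"] by (simp add: x_def)
    have "b = q ^ (2 * N + 1)" by (simp add: b_def N_def numeral_eq_Suc)
    then have bx: "b = x * z" by (simp add: d x_def z_def algebra_simps flip: power_add power_Suc)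
    have e: "q ^ (2 * (N - r)) = z" "q ^ (2 * (N + r + 1)) = x * x * z" "q ^ (4 * r + 2) = x * x"
      by (simp_all add: d x_def z_def algebra_simps flip: power_add power_Suc)
    have "(1 - b)^2 - (1 - z) * (1 - x * x * z) = z * (1 - x)^2" unfolding bx by algebra
    moreover have "q ^ (r^2 + r) * z = q ^ (2 * N) * (q^2) ^ tri (r - 1)"
    proof -
      have "r^2 + r + 2 * d = 2 * N + 2 * tri (r - 1)"
        by (cases r) (simp_all add: d two_tri power2_eq_square del: tri_simps)
      then show ?thesis by (simp add: z_def flip: power_add power_mult)
    qed
    moreover have "alpha r * (z * (1 - x)^2) = (- 1) ^ r * (q ^ (r^2 + r) * z) * (1 - x * x)"
      unfolding alpha_def x_def [symmetric] using x by (simp add: power2_eq_square field_simps)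
    ultimately show ?thesis unfolding e by (simp add: mult_ac)
  qed
  have "(\<Sum>r\<le>n. alpha r / (qp (n - r) * qp (n + r + 1)))
      = (\<Sum>r\<le>N. alpha r * ((1 - q ^ (2 * (N - r))) * (1 - q ^ (2 * (N + r + 1)))) / (qp (N - r) * qp (N + r + 1)))"
  proof -
    have "(\<Sum>r\<le>n. alpha r / (qp (n - r) * qp (n + r + 1)))
      = (\<Sum>r\<le>n. alpha r * ((1 - q ^ (2 * (N - r))) * (1 - q ^ (2 * (N + r + 1)))) / (qp (N - r) * qp (N + r + 1)))"
      by (intro sum.cong refl H) simp
    \<comment> \<open>The additional summand \<open>r = N\<close> is 0 because of the factor
      \<open>1 - q^(2 (N - r))\<close>.\<close>
    then show ?thesis by (simp add: N_def)
  qed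
  moreover have "(1 - b)^2 * (\<Sum>r\<le>N. alpha r / (qp (N - r) * qp (N + r + 1)))
      - (\<Sum>r\<le>N. alpha r * ((1 - q ^ (2 * (N - r))) * (1 - q ^ (2 * (N + r + 1)))) / (qp (N - r) * qp (N + r + 1)))
    = q ^ (2 * N) * (\<Sum>r\<le>N. (- 1) ^ r * (q^2) ^ tri (r - 1) * (1 - q ^ (4 * r + 2)) / (qp (N - r) * qp (N + r + 1)))"
    unfolding sum_distrib_left sum_subtractf [symmetric]
  proof (intro sum.cong refl)
    fix r assume "r \<in> {..N}"
    then have "alpha r * ((1 - b)^2 - (1 - q ^ (2 * (N - r))) * (1 - q ^ (2 * (N + r + 1)))) / (qp (N - r) * qp (N + r + 1))
      = q ^ (2 * N) * ((- 1) ^ r * (q^2) ^ tri (r - 1) * (1 - q ^ (4 * r + 2))) / (qp (N - r) * qp (N + r + 1))"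
      by (subst B) auto
    then show "(1 - b)^2 * (alpha r / (qp (N - r) * qp (N + r + 1)))
       - alpha r * ((1 - q ^ (2 * (N - r))) * (1 - q ^ (2 * (N + r + 1)))) / (qp (N - r) * qp (N + r + 1))
      = q ^ (2 * N) * ((- 1) ^ r * (q^2) ^ tri (r - 1) * (1 - q ^ (4 * r + 2)) / (qp (N - r) * qp (N + r + 1)))"
      by (simp only: right_diff_distrib diff_divide_distrib times_divide_eq_right mult_ac)
  qed
  ultimately have "(1 - b)^2 * (\<Sum>r\<le>N. alpha r / (qp (N - r) * qp (N + r + 1))) = 1 / (qpoch q (q^2) (n + 1))^2"
    using telescoped_zero[of N] Suc by (simp add: N_def)
  moreover have "qpoch q (q^2) (N + 1) = qpoch q (q^2) (n + 1) * (1 - b)"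
  proof -
    have "2 * n + 3 = Suc (2 * (n + 1))" by simp
    then have "b = q * (q^2) ^ (n + 1)" unfolding b_def by (simp only: power_Suc power_mult)
    then show ?thesis by (simp add: N_def qpoch_Suc)
  qed
  ultimately have "1 / (qpoch q (q^2) (N + 1))^2 = (1 - b)^2 * (\<Sum>r\<le>N. alpha r / (qp (N - r) * qp (N + r + 1))) / (1 - b)^2"
    by (simp only: power_mult_distrib) simp
  then show ?case using b unfolding N_def [symmetric] by simp
qed

text \<open>As \<open>(- a; q)_{2 m} = (- a; q^2)_m (- a q; q^2)_m\<close>, this is the summand of a
  basic hypergeometric series in base \<open>q^2\<close> with lower parameter
  \<open>a^2 q^2\<close>. Its \<open>q\<close>-Gauss argument is
  \<open>a^2 q^2 / (a^2 q) = q\<close>, the ratio used in \<open>gauss_sum\<close>.\<close>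

definition gauss_term :: "complex \<Rightarrow> nat \<Rightarrow> complex" where
  "gauss_term a m = qpoch (- a) q (2 * m) / (qp m * qpoch (a^2 * q^2) (q^2) m)"

lemma gauss_term_bound:
  obtains C where "\<And>a m. norm a \<le> 1 \<Longrightarrow> norm (gauss_term a m) \<le> C"
proof -
  obtain B where B: "B > 0" "\<And>a n. norm a \<le> 1 \<Longrightarrow> norm (qpoch a q n) \<le> B"
    using qpoch_uniform_bounds[OF q(2)] by metis
  obtain D where D: "D > 0" "\<And>a n. norm a \<le> norm (q^2) \<Longrightarrow> norm (1 / qpoch a (q^2) n) \<le> D"
    using qpoch_uniform_bounds[OF nQ] by metis
  show ?thesis
  proof (rule that[of "B * (D * D)"])
    fix a :: complex and m assume a: "norm a \<le> 1"
    have "norm (a^2 * q^2) \<le> norm (q^2)"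
      using a power_le_one[of "norm a" 2] by (simp add: norm_mult norm_power mult_left_le_one_le)
    then have "norm (qpoch (- a) q (2 * m)) * (norm (1 / qp m) * norm (1 / qpoch (a^2 * q^2) (q^2) m)) \<le> B * (D * D)"
      using B D a by (intro mult_mono) auto
    then show "norm (gauss_term a m) \<le> B * (D * D)"
      by (simp add: gauss_term_def norm_mult norm_divide)
  qed
qed

definition gauss_sum :: "complex \<Rightarrow> complex" where
  "gauss_sum a = (\<Sum>m. q ^ m * gauss_term a m)"

lemma gauss_summable: "norm a \<le> 1 \<Longrightarrow> summable (\<lambda>m. norm (q ^ m * gauss_term a m))"
proof -
  assume a: "norm a \<le> 1"
  obtain C where C: "\<And>a m. norm a \<le> 1 \<Longrightarrow> norm (gauss_term a m) \<le> C" using gauss_term_bound by metis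
  show ?thesis
  proof (rule summable_comparison_test)
    show "summable (\<lambda>m. norm q ^ m * C)" using q by (intro summable_mult2 summable_geometric) auto
    show "\<exists>N. \<forall>m\<ge>N. norm (norm (q ^ m * gauss_term a m)) \<le> norm q ^ m * C"
      using C[OF a] by (auto simp: norm_mult norm_power intro!: exI[of _ 0] mult_left_mono)
  qed
qed

text \<open>
  The sum is a case of the \<open>q\<close>-Gauss sum; iterating \<open>gauss_step\<close> moves \<open>a\<close> to 0, where it is
  a sum of Euler.
\<close>

lemma gauss_step:
  assumes a: "norm a < 1"
  shows "(1 - a * q) * gauss_sum a = gauss_sum (a * q)"
proof -
  \<comment> \<open>A telescoping certificate for the recurrence. The factor
    \<open>1 - q^(2 m)\<close> gives \<open>T 0 = 0\<close>, and in \<open>T (Suc m)\<close> it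
    cancels the new factor of \<open>qp (Suc m)\<close>.\<close>
  define T where "T m = - (a * (1 - a * q) / (1 + a)) * (q ^ m * gauss_term a m * (1 - q ^ (2 * m)))" for m
  have a1: "1 + a \<noteq> 0" using a by (metis add_eq_0_iff less_irrefl norm_minus_cancel norm_one)
  have aq: "norm (a * q) \<le> 1" using norm_mult_power_less_1[OF q(2) a, of 1] by simp
  have nz: "1 - a^2 * q^2 * (q^2) ^ m \<noteq> 0" for m
  proof -
    have "norm (a^2 * q^2) < 1" using norm_power_less_1[of "a * q" 2] norm_mult_power_less_1[OF q(2) a, of 1]
      by (simp add: power_mult_distrib)
    then show ?thesis using mult_power_neq_1[OF nQ] by fastforce
  qed
  have step: "(1 - a * q) * (q ^ m * gauss_term a m) - q ^ m * gauss_term (a * q) m = T (Suc m) - T m" for m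
  proof -
    define t where "t = q ^ m * gauss_term a m"
    define y where "y = q ^ (2 * m)"
    define w where "w = 1 - a^2 * q^2 * y"
    have y2: "(q^2) ^ m = y" by (simp add: y_def power_mult)
    have w: "w \<noteq> 0" using nz[of m] by (simp add: w_def y2)
    have u: "1 - y * q^2 \<noteq> 0" using pow_neq_1[of "2 * m + 2"] by (simp add: y_def power_add power2_eq_square mult_ac)
    have "qpoch (- a) q (2 * Suc m) = qpoch (- a) q (2 * m) * (1 + a * y) * (1 + a * y * q)"
      by (simp add: qpoch_Suc y_def mult_ac)
    moreover have "qp (Suc m) = qp m * (1 - y * q^2)" by (simp add: qpoch_Suc y2 mult.commute)
    moreover have "qpoch (a^2 * q^2) (q^2) (Suc m) = qpoch (a^2 * q^2) (q^2) m * w"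
      by (simp add: qpoch_Suc y2 w_def)
    ultimately have t1: "q ^ Suc m * gauss_term a (Suc m) = t * (q * (1 + a * y) * (1 + a * y * q) / ((1 - y * q^2) * w))"
      by (simp add: gauss_term_def t_def mult_ac)
    have "(1 + a) * qpoch (- (a * q)) q (2 * m) = qpoch (- a) q (2 * m) * (1 + a * y)"
      using qpoch_Suc'[of "- a" q "2 * m"] qpoch_Suc[of "- a" q "2 * m"] by (simp add: y_def)
    then have n1: "qpoch (- (a * q)) q (2 * m) = qpoch (- a) q (2 * m) * (1 + a * y) / (1 + a)"
      using a1 by (simp add: field_simps)
    have "(1 - a^2 * q^2) * qpoch (a^2 * q^2 * q^2) (q^2) m = qpoch (a^2 * q^2) (q^2) m * w"
      using qpoch_Suc'[of "a^2 * q^2" "q^2" m] qpoch_Suc[of "a^2 * q^2" "q^2" m] by (simp add: y2 w_def)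
    then have n2: "qpoch ((a * q)^2 * q^2) (q^2) m = qpoch (a^2 * q^2) (q^2) m * w / (1 - a^2 * q^2)"
      using nz[of 0] by (simp add: field_simps power_mult_distrib)
    have t2: "q ^ m * gauss_term (a * q) m = t * ((1 + a * y) * (1 - a^2 * q^2) / ((1 + a) * w))"
      unfolding gauss_term_def n1 n2 t_def by (simp add: mult_ac)
    have y3: "q ^ (2 * Suc m) = y * q^2" by (simp add: y_def power2_eq_square)
    have E: "(1 - a * q) - (1 + a * y) * (1 - a^2 * q^2) / ((1 + a) * w)
       = - (a * (1 - a * q) / (1 + a)) * (q * (1 + a * y) * (1 + a * y * q) / w - (1 - y))"
    proof -
      define c V U where "c = a * (1 - a * q) / (1 + a)"
        and "V = (1 + a * y) * (1 - a^2 * q^2) / ((1 + a) * w)" and "U = q * (1 + a * y) * (1 + a * y * q) / w"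
      have "c * (1 + a) = a * (1 - a * q)" "V * ((1 + a) * w) = (1 + a * y) * (1 - a^2 * q^2)"
        "U * w = q * (1 + a * y) * (1 + a * y * q)"
        using a1 w by (simp_all add: c_def V_def U_def)
      then have "((1 - a * q) - V + c * (U - (1 - y))) * ((1 + a) * w) = 0"
        unfolding w_def by algebra
      then have "(1 - a * q) - V + c * (U - (1 - y)) = 0" using a1 w by simp
      then show ?thesis unfolding c_def V_def U_def by (simp only: eq_neg_iff_add_eq_0 mult_minus_left)
    qed
    have gen: "A * t - t * V = - c * (t * U) - - c * (t * Y)" if "A - V = - c * (U - Y)" for A V c U Y :: complex
      using that by algebra
    have F: "t * (q * (1 + a * y) * (1 + a * y * q) / ((1 - y * q^2) * w)) * (1 - y * q^2)
        = t * (q * (1 + a * y) * (1 + a * y * q) / w)" using u by simp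
    have TS: "T (Suc m) = - (a * (1 - a * q) / (1 + a)) * (t * (q * (1 + a * y) * (1 + a * y * q) / w))"
      by (simp only: T_def t1 y3 F)
    have Tm: "T m = - (a * (1 - a * q) / (1 + a)) * (t * (1 - y))"
      by (simp only: T_def t_def y_def)
    have "(1 - a * q) * (q ^ m * gauss_term a m) - q ^ m * gauss_term (a * q) m
        = (1 - a * q) * t - t * ((1 + a * y) * (1 - a^2 * q^2) / ((1 + a) * w))"
      by (simp only: t2, simp only: t_def)
    also have "\<dots> = T (Suc m) - T m"
      unfolding TS Tm by (rule gen[OF E])
    finally show ?thesis .
  qed
  have s1: "(\<lambda>m. q ^ m * gauss_term a m) sums gauss_sum a"
    unfolding gauss_sum_def using a by (intro summable_sums[OF summable_norm_cancel] gauss_summable) simp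
  have s2: "(\<lambda>m. q ^ m * gauss_term (a * q) m) sums gauss_sum (a * q)"
    unfolding gauss_sum_def by (rule summable_sums[OF summable_norm_cancel[OF gauss_summable[OF aq]]])
  have "(\<lambda>m. q ^ m * gauss_term a m) \<longlonglongrightarrow> 0"
    using s1 sums_summable summable_LIMSEQ_zero by blast
  moreover have "(\<lambda>m. q ^ (2 * m)) \<longlonglongrightarrow> 0"
    using LIMSEQ_power_zero[OF nQ] by (simp add: power_mult)
  ultimately have "T \<longlonglongrightarrow> - (a * (1 - a * q) / (1 + a)) * (0 * (1 - 0))"
    unfolding T_def by (intro tendsto_mult tendsto_diff tendsto_const)
  then have "T \<longlonglongrightarrow> 0" by simp
  then have "(\<lambda>m. T (Suc m) - T m) sums (0 - T 0)" by (rule telescope_sums)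
  then have "(\<lambda>m. (1 - a * q) * (q ^ m * gauss_term a m) - q ^ m * gauss_term (a * q) m) sums 0"
    unfolding step by (simp add: T_def)
  moreover have "(\<lambda>m. (1 - a * q) * (q ^ m * gauss_term a m) - q ^ m * gauss_term (a * q) m)
      sums ((1 - a * q) * gauss_sum a - gauss_sum (a * q))"
    by (intro sums_diff sums_mult s1 s2)
  ultimately show ?thesis using sums_unique2 by fastforce
qed

lemma gauss_iterate: "norm a < 1 \<Longrightarrow> qpoch (a * q) q k * gauss_sum a = gauss_sum (a * q ^ k)"
proof (induction k)
  case (Suc k)
  have "norm (a * q ^ k) < 1" using norm_mult_power_less_1[OF q(2) Suc.prems] .
  note step = gauss_step[OF this]
  have "qpoch (a * q) q (Suc k) * gauss_sum a = (1 - a * q ^ k * q) * (qpoch (a * q) q k * gauss_sum a)"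
    by (simp add: qpoch_Suc mult_ac)
  also have "\<dots> = gauss_sum (a * q ^ k * q)" using Suc step by simp
  finally show ?case by (simp add: mult_ac)
qed simp

text \<open>The series \<open>e\<close> satisfies \<open>e (x q^2) = (1 - x) e x\<close>; iterating
  from \<open>x = q\<close> drives the argument to 0, where only the term 1 survives.\<close>

lemma euler_sum: "(\<Sum>m. q ^ m * (1 / qp m)) * qinf q (q^2) = 1"
proof -
  define e where "e x = (\<Sum>m. x ^ m * (1 / qp m))" for x
  obtain D where D: "D > 0" "\<And>n. norm (1 / qp n) \<le> D" using qpoch_inverse_bound[OF nQ nQ] by metis
  have s: "summable (\<lambda>m. x ^ m * (1 / qp m))" if "norm x < 1" for x
  proof (rule summable_comparison_test)
    show "summable (\<lambda>m. norm x ^ m * D)" using that by (intro summable_mult2 summable_geometric) auto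
    have "norm (x ^ m * (1 / qp m)) \<le> norm x ^ m * D" for m
      unfolding norm_mult norm_power using D by (intro mult_left_mono) auto
    then show "\<exists>N. \<forall>m\<ge>N. norm (x ^ m * (1 / qp m)) \<le> norm x ^ m * D" by blast
  qed
  have step: "e (x * q^2) = (1 - x) * e x" if x: "norm x < 1" for x
  proof -
    have x': "norm (x * q^2) < 1" using norm_mult_power_less_1[OF q(2) x] .
    have "e x - e (x * q^2) = (\<Sum>m. x ^ m * (1 / qp m) - (x * q^2) ^ m * (1 / qp m))"
      unfolding e_def by (rule suminf_diff[OF s[OF x] s[OF x']])
    also have "\<dots> = (\<Sum>m. x ^ Suc m * (1 / qp (Suc m)) - (x * q^2) ^ Suc m * (1 / qp (Suc m)))"
      using suminf_split_head[OF summable_diff[OF s[OF x] s[OF x']]] by simp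
    also have "\<dots> = (\<Sum>m. x * (x ^ m * (1 / qp m)))"
    proof (rule suminf_cong)
      fix m
      define z where "z = q ^ (2 * m + 2)"
      have "1 - z \<noteq> 0" using pow_neq_1[of "2 * m + 2"] by (simp add: z_def)
      moreover have "2 * m + 2 = 2 * Suc m" by simp
      then have "(x * q^2) ^ Suc m = x ^ Suc m * z"
        by (simp only: power_mult_distrib power_mult z_def)
      moreover have "u * (1 / (p * (1 - z))) - u * z * (1 / (p * (1 - z))) = u * (1 / p)"
        if "1 - z \<noteq> 0" for u p :: complex
        using that by (simp add: divide_simps) (simp add: algebra_simps)
      ultimately have "x ^ Suc m * (1 / qp (Suc m)) - (x * q^2) ^ Suc m * (1 / qp (Suc m)) = x ^ Suc m * (1 / qp m)"
        by (simp only: qp_Suc z_def not_False_eq_True)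
      then show "x ^ Suc m * (1 / qp (Suc m)) - (x * q^2) ^ Suc m * (1 / qp (Suc m)) = x * (x ^ m * (1 / qp m))"
        by (simp only: power_Suc mult.assoc)
    qed
    also have "\<dots> = x * e x" unfolding e_def by (rule suminf_mult[OF s[OF x]])
    finally show ?thesis by (simp add: algebra_simps)
  qed
  have it: "qpoch q (q^2) k * e q = e (q * (q^2) ^ k)" for k
  proof (induction k)
    case (Suc k)
    have "norm (q * (q^2) ^ k) < 1" using norm_mult_power_less_1[OF nQ q(2)] .
    from step[OF this] Suc show ?case by (simp add: qpoch_Suc mult_ac)
  qed simp
  have "(\<lambda>k. \<Sum>m. q ^ m * (((q^2) ^ k) ^ m * (1 / qp m))) \<longlonglongrightarrow> (\<Sum>m. q ^ m * (if m = 0 then 1 else 0))"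
  proof (rule geometric_tannery[OF q(2)])
    fix m
    show "(\<lambda>k. ((q^2) ^ k) ^ m * (1 / qp m)) \<longlonglongrightarrow> (if m = 0 then 1 else 0)"
    proof (cases "m = 0")
      case False
      have "(\<lambda>k. ((q^2) ^ k) ^ m) \<longlonglongrightarrow> 0 ^ m" by (intro tendsto_power LIMSEQ_power_zero nQ)
      then have "(\<lambda>k. ((q^2) ^ k) ^ m * (1 / qp m)) \<longlonglongrightarrow> 0 ^ m * (1 / qp m)" by (intro tendsto_mult tendsto_const)
      then show ?thesis using False by (simp add: power_0_left)
    qed simp
    fix k
    have "norm (((q^2) ^ k) ^ m) \<le> 1" unfolding norm_power using q by (intro power_le_one) (auto simp: power_le_one)
    then show "norm (((q^2) ^ k) ^ m * (1 / qp m)) \<le> 1 * D"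
      unfolding norm_mult using D by (intro mult_mono) auto
  qed
  moreover have "(\<Sum>m. q ^ m * (((q^2) ^ k) ^ m * (1 / qp m))) = qpoch q (q^2) k * e q" for k
    unfolding it by (simp only: e_def power_mult_distrib mult.assoc)
  moreover have "(\<Sum>m. q ^ m * (if m = 0 then 1 else 0)) = 1"
    by (subst suminf_finite[of "{0}"]) auto
  ultimately have "(\<lambda>k. qpoch q (q^2) k * e q) \<longlonglongrightarrow> 1" by simp
  moreover have "(\<lambda>k. qpoch q (q^2) k * e q) \<longlonglongrightarrow> qinf q (q^2) * e q"
    by (intro tendsto_mult tendsto_const qpoch_tendsto nQ)
  ultimately show ?thesis using LIMSEQ_unique by (fastforce simp: e_def mult.commute)
qed

lemma gauss_sum_eq: "qinf (q ^ Suc s) q * gauss_sum (q ^ s) * qinf q (q^2) = 1" if "s > 0"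
proof -
  have a: "norm (q ^ s) < 1" using norm_power_less_1[OF q(2) that] .
  obtain C where C: "\<And>a m. norm a \<le> 1 \<Longrightarrow> norm (gauss_term a m) \<le> C" using gauss_term_bound by metis
  have z: "(\<lambda>k. q ^ s * q ^ k) \<longlonglongrightarrow> 0"
    using tendsto_mult[OF tendsto_const LIMSEQ_power_zero[OF q(2)], of "q ^ s"] by simp
  have "(\<lambda>k. \<Sum>m. q ^ m * gauss_term (q ^ s * q ^ k) m) \<longlonglongrightarrow> (\<Sum>m. q ^ m * gauss_term 0 m)"
  proof (rule geometric_tannery[OF q(2)])
    fix m
    have qn: "qpoch (0^2 * q^2) (q^2) m \<noteq> 0" by (simp add: qpoch_def)
    show "(\<lambda>k. gauss_term (q ^ s * q ^ k) m) \<longlonglongrightarrow> gauss_term 0 m"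
    proof -
      have "(\<lambda>k. qpoch (- (q ^ s * q ^ k)) q (2 * m)) \<longlonglongrightarrow> qpoch (- 0) q (2 * m)"
        "(\<lambda>k. qpoch ((q ^ s * q ^ k)^2 * q^2) (q^2) m) \<longlonglongrightarrow> qpoch (0^2 * q^2) (q^2) m"
        unfolding qpoch_def
        by (intro tendsto_prod tendsto_diff tendsto_mult tendsto_minus tendsto_power tendsto_const z)+
      then show ?thesis unfolding gauss_term_def using qn
        by (intro tendsto_divide tendsto_mult tendsto_const) auto
    qed
    fix k
    show "norm (gauss_term (q ^ s * q ^ k) m) \<le> C"
      using norm_mult_power_less_1[OF q(2) a, of k] by (intro C) auto
  qed
  moreover have "gauss_term 0 m = 1 / qp m" for m by (simp add: gauss_term_def qpoch_def)
  moreover have "(\<Sum>m. q ^ m * gauss_term (q ^ s * q ^ k) m) = qpoch (q ^ s * q) q k * gauss_sum (q ^ s)" for k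
    using gauss_iterate[OF a, of k] by (simp add: gauss_sum_def)
  ultimately have "(\<lambda>k. qpoch (q ^ s * q) q k * gauss_sum (q ^ s)) \<longlonglongrightarrow> (\<Sum>m. q ^ m * (1 / qp m))" by simp
  moreover have "(\<lambda>k. qpoch (q ^ s * q) q k * gauss_sum (q ^ s)) \<longlonglongrightarrow> qinf (q ^ s * q) q * gauss_sum (q ^ s)"
    by (intro tendsto_mult tendsto_const qpoch_tendsto q)
  ultimately have "(\<Sum>m. q ^ m * (1 / qp m)) = qinf (q ^ Suc s) q * gauss_sum (q ^ s)"
    using LIMSEQ_unique by (fastforce simp: mult.commute)
  then show ?thesis using euler_sum by simp
qed

section \<open>Product forms of theta4\<close>

lemma qinf_neg_relation: "qinf (- q) q * qinf q q = qinf (q^2) (q^2)"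
  using qinf_mult_neg[OF q(2), of q] by (simp only: mult.commute)

lemma qinf_split_2: "qinf q q = qinf q (q^2) * qinf (q^2) (q^2)"
proof -
  have "{..<2::nat} = {0, 1}" by auto
  then show ?thesis using qinf_split[OF q(2), of 2 q] by (simp flip: power2_eq_square)
qed

text \<open>Jacobi's triple product in base \<open>q^2\<close> at \<open>a = - q\<close>, where both
  theta factors coincide.\<close>

lemma theta4_eq_qinf: "theta4 q = qinf q (q^2) ^ 2 * qinf (q^2) (q^2)"
proof -
  have "theta4 q = (\<Sum>n. jj q (int n + 1) + jj q (- int n))"
    unfolding theta4_def by (rule infsum_int[OF jj_summable(1)[OF q]])
  also have "\<dots> = (\<Sum>n. (q^2) ^ tri n * ((- q) ^ Suc n + (1 / - q) ^ n))"
  proof (rule suminf_cong)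
    fix n
    have "q powi ((int n + 1)^2) = q ^ (2 * tri n + Suc n)"
      by (simp only: power_int_of_nat [symmetric] of_nat_add two_tri) (simp add: power2_eq_square algebra_simps)
    moreover have "q ^ (2 * tri n) * (1 / q) ^ n = q powi ((- int n)^2)"
    proof -
      have "2 * tri n = n * n + n" by (simp add: two_tri)
      then have "q ^ (2 * tri n) = q ^ (n * n) * q ^ n" by (simp only: power_add)
      moreover have "(- int n)^2 = int (n * n)" by (simp add: power2_eq_square)
      ultimately show ?thesis using q by (simp only: power_int_of_nat) (simp add: power_one_over)
    qed
    moreover have "(1 / - q) ^ n = (- 1) ^ n * (1 / q) ^ n"
      by (simp flip: power_mult_distrib)
    moreover have "(- q) ^ Suc n = - ((- 1) ^ n * q ^ Suc n)" by (simp add: power_minus[of q])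
    moreover have "(q^2) ^ tri n = q ^ (2 * tri n)" by (rule power_mult [symmetric])
    moreover have "u * (- (w * x) + w * y) = - (w * (u * x)) + w * (u * y)" for u w x y :: complex
      by (simp add: algebra_simps)
    ultimately show "jj q (int n + 1) + jj q (- int n) = (q^2) ^ tri n * ((- q) ^ Suc n + (1 / - q) ^ n)"
      by (simp only: jj_def sg_add sg_1 sg_simps sg_of_nat power_add mult_minus_right mult_minus_left mult_1_right)
  qed
  also have "\<dots> = qinf (- (- q)) (q^2) * qinf (- (q^2) / (- q)) (q^2) * qinf (q^2) (q^2)"
    by (rule jacobi_triple[symmetric]) (use nQ q in auto)
  also have "- (q^2) / (- q) = q" using q by (simp add: power2_eq_square)
  finally show ?thesis by (simp add: power2_eq_square)
qed

lemma theta4_mult_qinf: "theta4 q * qinf (- q) q = qinf q q"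
proof -
  have "theta4 q * qinf (- q) q = qinf q (q^2) * (qinf (- q) q * (qinf q (q^2) * qinf (q^2) (q^2)))"
    by (simp only: theta4_eq_qinf power2_eq_square mult_ac)
  also have "\<dots> = qinf q (q^2) * qinf (q^2) (q^2)"
    using qinf_neg_relation by (simp only: qinf_split_2)
  finally show ?thesis by (simp only: qinf_split_2)
qed

text \<open>Insert \<open>inverse_square_expansion\<close> into \<open>phi\<close> and put
  \<open>n = r + m\<close>. For fixed \<open>r\<close> the sum over \<open>m\<close> is a constant
  times \<open>gauss_sum (q^(2 r + 1))\<close>, whose closed form leaves the term \<open>r\<close>
  of \<open>lambert_sum\<close> times \<open>W = 1 / theta4 q\<close>.\<close>

lemma phi_mult_theta4: "phi q * theta4 q = lambert_sum q"
proof -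
  define g where "g = (\<lambda>(r, m). qpoch (- q) q (2 * (r + m)) * q ^ (r + m + 1) * (alpha r / (qp m * qp (m + 2 * r + 1))))"
  obtain B where B: "B > 0" "\<And>a n. norm a \<le> 1 \<Longrightarrow> norm (qpoch a q n) \<le> B" using qpoch_uniform_bounds[OF q(2)] by metis
  obtain D where D: "D > 0" "\<And>n. norm (1 / qp n) \<le> D" using qpoch_inverse_bound[OF nQ nQ] by metis
  define K where "K = B * (2 / (1 - norm q)) * D * D"
  have alpha: "norm (alpha r) \<le> 2 / (1 - norm q)" for r
  proof -
    have 1: "norm q ^ n \<le> 1" for n using q by (intro power_le_one) auto
    have n: "norm q ^ (2 * r + 1) \<le> norm q ^ 1" using q by (intro power_decreasing) auto
    have "norm (1 + q ^ (2 * r + 1)) \<le> 1 + norm q ^ (2 * r + 1)"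
      using norm_triangle_ineq[of 1 "q ^ (2 * r + 1)"] by (simp only: norm_power norm_one)
    also have "\<dots> \<le> 2" using 1[of "2 * r + 1"] by simp
    finally have "norm (q ^ (r^2 + r)) * norm (1 + q ^ (2 * r + 1)) \<le> 1 * 2"
      using 1[of "r^2 + r"] by (intro mult_mono) (auto simp: norm_power)
    moreover have "1 - norm q \<le> norm (1 - q ^ (2 * r + 1))"
      using norm_triangle_ineq2[of 1 "q ^ (2 * r + 1)"] n by (simp only: norm_power norm_one power_one_right)
    ultimately show ?thesis unfolding alpha_def norm_divide norm_mult using q
      by (intro frac_le) (auto simp: norm_power)
  qed
  have g: "g norm_summable_on UNIV"
  proof (rule Infinite_Sum.abs_summable_on_comparison_test)
    have "(\<lambda>r. q ^ r) norm_summable_on UNIV"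
      using q by (intro summable_norm_imp_summable_on) (simp add: norm_power summable_geometric)
    from summable_on_cmult_right[OF abs_summable_prod[OF this this], of "norm (of_real K :: complex)"]
    show "(\<lambda>p. of_real K * (case p of (r, m) \<Rightarrow> q ^ r * q ^ m)) norm_summable_on UNIV" by (simp add: norm_mult)
    fix p :: "nat \<times> nat"
    obtain r m where p: "p = (r, m)" by force
    have K: "K \<ge> 0" using B D q by (simp add: K_def)
    have "norm (g p) = norm (qpoch (- q) q (2 * (r + m))) * norm (alpha r) * norm (1 / qp m) * norm (1 / qp (m + 2 * r + 1)) * norm (q ^ (r + m + 1))"
      by (simp add: g_def p norm_mult norm_divide)
    also have "\<dots> \<le> K * norm (q ^ (r + m))"
      unfolding K_def
    proof (intro mult_mono)
      show "norm (q ^ (r + m + 1)) \<le> norm (q ^ (r + m))"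
        unfolding norm_power using q by (intro power_decreasing) auto
    qed (use B D q alpha in auto)
    finally show "norm (g p) \<le> norm (of_real K * (case p of (r, m) \<Rightarrow> q ^ r * q ^ m))"
      using K by (simp add: p norm_mult power_add norm_power)
  qed
  define W where "W = qinf (- q) q / qinf q q"
  have qq: "qinf q q \<noteq> 0" by (rule qinf_nonzero'[OF q(2) q(2)])
  have inner: "infsum (\<lambda>m. g (r, m)) UNIV = W * ((- 1) ^ r * q ^ ((r + 1)^2) / (1 - q ^ (2 * r + 1)))" for r
  proof -
    define s where "s = 2 * r + 1"
    define c where "c = alpha r * qpoch (- q) q (2 * r) * q ^ (r + 1) / qp s"
    have eq: "g (r, m) = c * (q ^ m * gauss_term (q ^ s) m)" for m
    proof -
      have "qpoch (- q) q (2 * (r + m)) = qpoch (- q) q (2 * r) * qpoch (- (q ^ s)) q (2 * m)"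
        by (simp add: qpoch_add distrib_left s_def)
      moreover have "qp (m + 2 * r + 1) = qp s * qpoch ((q ^ s)^2 * q^2) (q^2) m"
      proof -
        have "m + 2 * r + 1 = s + m" by (simp add: s_def)
        moreover have "q^2 * (q^2) ^ s = (q ^ s)^2 * q^2" by (simp add: power2_eq_square power_mult_distrib)
        ultimately show ?thesis by (simp only: qpoch_add)
      qed
      ultimately show ?thesis by (simp add: g_def c_def gauss_term_def power_add mult_ac)
    qed
    have ns: "norm (q ^ s) \<le> 1" unfolding norm_power using q by (intro power_le_one) auto
    have "infsum (\<lambda>m. g (r, m)) UNIV = c * gauss_sum (q ^ s)"
      unfolding eq infsum_cmult_right' gauss_sum_def using infsum_nat[OF gauss_summable[OF ns]] by simp
    also have "\<dots> = W * ((- 1) ^ r * q ^ ((r + 1)^2) / (1 - q ^ (2 * r + 1)))"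
    proof -
      have gs: "qinf (q ^ Suc s) q * gauss_sum (q ^ s) * qinf q (q^2) = 1"
        by (rule gauss_sum_eq) (simp add: s_def)
      have split: "qinf q q = qpoch q q s * qinf (q ^ Suc s) q"
      proof -
        have "(\<lambda>n. qpoch q q (s + n)) \<longlonglongrightarrow> qinf q q"
          using LIMSEQ_ignore_initial_segment[OF qpoch_tendsto[OF q(2)], of q s] by (simp add: add.commute)
        moreover have "(\<lambda>n. qpoch q q (s + n)) \<longlonglongrightarrow> qpoch q q s * qinf (q ^ Suc s) q"
          unfolding qpoch_add power_Suc by (intro tendsto_mult tendsto_const qpoch_tendsto q)
        ultimately show ?thesis by (rule LIMSEQ_unique)
      qed
      have half: "qinf (- q) q * qinf q (q^2) = 1"
      proof -
        have "qinf (- q) q * qinf q (q^2) * qinf (q^2) (q^2) = qinf (q^2) (q^2)"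
          using qinf_neg_relation by (simp only: qinf_split_2 mult.assoc)
        then show ?thesis using qinf_nonzero'[OF nQ nQ] by simp
      qed
      \<comment> \<open>Of the factors of \<open>qp s\<close>, \<open>qpoch (- q) q (2 * r)\<close>
        cancels against the one in \<open>c\<close>, and \<open>1 + q^s\<close> against the
        numerator of \<open>alpha r\<close>.\<close>
      have qps: "qp s = qpoch q q s * (qpoch (- q) q (2 * r) * (1 + q ^ s))"
        using qpoch_mult_neg[of q q s] by (simp add: s_def qpoch_Suc)
      have nz: "qpoch q q s \<noteq> 0" "qpoch (- q) q (2 * r) \<noteq> 0" "1 + q ^ s \<noteq> 0" "1 - q ^ s \<noteq> 0"
        using qpoch_nonzero[OF q(2), of q] qpoch_nonzero[OF q(2), of "- q"] q pow_neq_m1[of s] pow_neq_1[of s]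
        by (auto simp: s_def add_eq_0_iff)
      have "qinf q q * gauss_sum (q ^ s) = qpoch q q s * qinf (- q) q * (qinf (q ^ Suc s) q * gauss_sum (q ^ s) * qinf q (q^2))"
      proof -
        have "qpoch q q s * qinf (- q) q * (qinf (q ^ Suc s) q * gauss_sum (q ^ s) * qinf q (q^2))
            = (qpoch q q s * qinf (q ^ Suc s) q) * gauss_sum (q ^ s) * (qinf (- q) q * qinf q (q^2))"
          by (simp only: mult_ac)
        then show ?thesis by (simp only: half split mult_1_right)
      qed
      then have "qinf q q * gauss_sum (q ^ s) = qpoch q q s * qinf (- q) q"
        by (simp only: gs mult_1_right)
      then have "gauss_sum (q ^ s) = qpoch q q s * qinf (- q) q / qinf q q"
        using qq by (simp only: nonzero_eq_divide_eq mult.commute[of "gauss_sum _"] not_False_eq_True)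
      then have gs': "gauss_sum (q ^ s) = qpoch q q s * W" by (simp add: W_def)
      have "(r + 1)^2 = r^2 + r + (r + 1)" by (simp add: power2_eq_square)
      then have pw: "q ^ ((r + 1)^2) = q ^ (r^2 + r) * q ^ (r + 1)" by (simp only: power_add)
      have gen: "E * (1 + x) / (1 - x) * u * v / (p * (u * (1 + x))) * (p * W) = W * (E * v / (1 - x))"
        if "p \<noteq> 0" "u \<noteq> 0" "1 + x \<noteq> 0" "1 - x \<noteq> 0" for E x u v p :: complex
        using that by (simp add: divide_simps mult_ac)
      have "c * gauss_sum (q ^ s) = W * ((- 1) ^ r * q ^ (r^2 + r) * q ^ (r + 1) / (1 - q ^ s))"
        unfolding c_def qps alpha_def s_def [symmetric] gs' by (rule gen[OF nz])
      then show ?thesis unfolding pw s_def by (simp only: mult.assoc)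
    qed
    finally show ?thesis .
  qed
  have s: "(\<lambda>r. infsum (\<lambda>m. g (r, m)) UNIV) summable_on UNIV"
    using summable_on_Sigma_banach[of "\<lambda>r m. g (r, m)" UNIV "\<lambda>_. UNIV"] abs_summable_summable[OF g] by simp
  have "summable (\<lambda>r. norm (infsum (\<lambda>m. g (r, m)) UNIV))"
    by (intro summable_on_imp_summable iffD1[OF summable_on_iff_abs_summable_on_complex] s)
  then have "infsum (\<lambda>r. infsum (\<lambda>m. g (r, m)) UNIV) UNIV = (\<Sum>r. infsum (\<lambda>m. g (r, m)) UNIV)"
    by (rule infsum_nat)
  also have "\<dots> = W * lambert_sum q"
  proof -
    have "summable (\<lambda>r. W * ((- 1) ^ r * q ^ ((r + 1)^2) / (1 - q ^ (2 * r + 1))))"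
      using summable_on_imp_summable[OF s] unfolding inner .
    moreover have "W \<noteq> 0" unfolding W_def using qinf_nonzero'[OF q(2), of "- q"] q qq by simp
    ultimately have "summable (\<lambda>r. (- 1) ^ r * q ^ ((r + 1)^2) / (1 - q ^ (2 * r + 1)))"
      by (simp only: summable_cmult_iff) simp
    then show ?thesis unfolding inner lambert_sum_def by (rule suminf_mult)
  qed
  also have "infsum (\<lambda>r. infsum (\<lambda>m. g (r, m)) UNIV) UNIV = infsum (\<lambda>n. \<Sum>j\<le>n. g (n - j, j)) UNIV"
    by (rule infsum_triangle[OF g])
  also have "\<dots> = infsum (\<lambda>n. qpoch (- q) q (2 * n) * q ^ (n + 1) / (qpoch q (q^2) (n + 1))^2) UNIV"
  proof (rule infsum_cong)
    fix n
    have "(\<Sum>j\<le>n. g (n - j, j)) = (\<Sum>r\<le>n. g (r, n - r))"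
      using sum.nat_diff_reindex[of "\<lambda>r. g (r, n - r)" "Suc n"] by (simp add: lessThan_Suc_atMost)
    also have "\<dots> = (\<Sum>r\<le>n. qpoch (- q) q (2 * n) * q ^ (n + 1) * (alpha r / (qp (n - r) * qp (n + r + 1))))"
    proof (intro sum.cong refl)
      fix r assume "r \<in> {..n}"
      then have "r + (n - r) = n" "n - r + 2 * r + 1 = n + r + 1" by auto
      then show "g (r, n - r) = qpoch (- q) q (2 * n) * q ^ (n + 1) * (alpha r / (qp (n - r) * qp (n + r + 1)))"
        by (simp only: g_def case_prod_conv)
    qed
    also have "\<dots> = qpoch (- q) q (2 * n) * q ^ (n + 1) * (1 / (qpoch q (q^2) (n + 1))^2)"
      by (simp only: sum_distrib_left [symmetric] inverse_square_expansion)
    finally show "(\<Sum>j\<le>n. g (n - j, j)) = qpoch (- q) q (2 * n) * q ^ (n + 1) / (qpoch q (q^2) (n + 1))^2" by simp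
  qed
  also have "\<dots> = phi q"
  proof -
    obtain C where C: "C > 0" "\<And>n. norm (1 / qpoch q (q^2) n) \<le> C" using qpoch_inverse_bound[OF nQ q(2)] by metis
    have "summable (\<lambda>n. norm (qpoch (- q) q (2 * n) * q ^ (n + 1) / (qpoch q (q^2) (n + 1))^2))"
    proof (rule summable_comparison_test)
      show "summable (\<lambda>n. B * C * C * norm q ^ n)" using q by (intro summable_mult summable_geometric) auto
      have "norm (qpoch (- q) q (2 * n) * q ^ (n + 1) / (qpoch q (q^2) (n + 1))^2) \<le> B * C * C * norm q ^ n" for n
      proof -
        have "norm (qpoch (- q) q (2 * n) * q ^ (n + 1) / (qpoch q (q^2) (n + 1))^2)
            = norm (qpoch (- q) q (2 * n)) * norm (1 / qpoch q (q^2) (n + 1)) * norm (1 / qpoch q (q^2) (n + 1)) * norm q ^ (n + 1)"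
          by (simp add: norm_mult norm_divide norm_power power2_eq_square)
        also have "\<dots> \<le> B * C * C * norm q ^ n"
        proof (intro mult_mono)
          show "norm q ^ (n + 1) \<le> norm q ^ n" using q by (intro power_decreasing) auto
        qed (use B C q in auto)
        finally show ?thesis .
      qed
      then show "\<exists>N. \<forall>n\<ge>N. norm (norm (qpoch (- q) q (2 * n) * q ^ (n + 1) / (qpoch q (q^2) (n + 1))^2)) \<le> B * C * C * norm q ^ n"
        by auto
    qed
    then show ?thesis by (simp only: infsum_nat phi_def)
  qed
  finally have "phi q = W * lambert_sum q" by simp
  moreover have "W * theta4 q = 1"
    unfolding W_def using theta4_mult_qinf qq by (simp add: mult.commute)
  ultimately show ?thesis by (simp add: mult.commute mult.left_commute)
qed

end

section \<open>Five-dissections of theta functions\<close>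

definition psi :: "complex \<Rightarrow> complex" where "psi q = (\<Sum>n. q ^ tri n)"

definition eu :: "complex \<Rightarrow> complex" where "eu q = qinf q q"

text \<open>Triangular numbers at all integers: \<open>2 * psi q\<close> becomes a bilateral series,
  on which linear substitutions can act.\<close>

definition itri :: "int \<Rightarrow> int" where "itri k = k * (k + 1) div 2"

lemma two_itri: "2 * itri k = k * (k + 1)"
  by (simp add: itri_def)

lemma itri_eqI: "2 * x = k * (k + 1) \<Longrightarrow> itri k = x"
  by (simp add: itri_def)

lemma itri_reflect: "itri (- 1 - k) = itri k"
  by (rule itri_eqI) (simp only: two_itri, simp add: algebra_simps)

lemma itri_of_nat: "itri (int n) = int (tri n)"
  by (rule itri_eqI) (metis two_tri of_nat_mult of_nat_numeral of_nat_add of_nat_1)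

lemma infsum_mod5:
  fixes f :: "int \<Rightarrow> complex"
  assumes "f norm_summable_on UNIV"
  shows "infsum f UNIV = (\<Sum>i<5. \<Sum>\<^sub>\<infinity>s. f (5 * s + int i))"
    and "(\<lambda>s. f (5 * s + j)) norm_summable_on UNIV"
proof -
  have inj: "inj (\<lambda>s::int. 5 * s + j)" for j by (auto simp: inj_on_def)
  show "(\<lambda>s. f (5 * s + j)) norm_summable_on UNIV" for j
    using summable_on_reindex[OF inj, of "\<lambda>x. norm (f x)" j] summable_on_subset_banach[OF assms, of "range (\<lambda>s. 5 * s + j)"]
    by (simp add: o_def)
  have b: "bij_betw (\<lambda>(i, s). 5 * s + int i) ({..<5} \<times> UNIV) UNIV"
    by (rule bij_betwI[where g = "\<lambda>x. (nat (x mod 5), x div 5)"]) (auto simp: nat_less_iff)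
  have f: "(\<lambda>(i, s). f (5 * s + int i)) summable_on ({..<5} \<times> UNIV)"
    using summable_on_reindex_bij_betw[OF b, of f] abs_summable_summable[OF assms] by (simp add: case_prod_unfold)
  have "infsum f UNIV = (\<Sum>\<^sub>\<infinity>(i, s)\<in>{..<5} \<times> UNIV. f (5 * s + int i))"
    using infsum_reindex_bij_betw[OF b, of f] by (simp add: case_prod_unfold)
  also have "\<dots> = (\<Sum>\<^sub>\<infinity>i\<in>{..<5}. \<Sum>\<^sub>\<infinity>s. f (5 * s + int i))"
    using infsum_Sigma'_banach[OF f] by simp
  finally show "infsum f UNIV = (\<Sum>i<5. \<Sum>\<^sub>\<infinity>s. f (5 * s + int i))" by simp
qed

text \<open>The five cosets of the index-5 sublattice of the Gaussian integers generated by \<open>2 + i\<close>.\<close>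

lemma infsum_gauss_cosets:
  fixes F :: "int \<times> int \<Rightarrow> complex"
  assumes "F norm_summable_on UNIV"
  shows "infsum F UNIV = (\<Sum>i<5. \<Sum>\<^sub>\<infinity>(s, t). F (2 * s + t, s - 2 * t + int i))"
proof -
  have b: "bij_betw (\<lambda>(i, s, t). (2 * s + t, s - 2 * t + int i)) ({..<5} \<times> UNIV) UNIV"
  proof (rule bij_betwI[where g = "\<lambda>(u, v). let i = (3 * (2 * v - u)) mod 5 in (nat i, (2 * u + v - i) div 5, (u - 2 * v + 2 * i) div 5)"])
    fix x :: "nat \<times> int \<times> int" assume "x \<in> {..<5} \<times> UNIV"
    then obtain i s t where x: "x = (i, s, t)" "i < 5" by auto
    have "3 * (2 * (s - 2 * t + int i) - (2 * s + t)) = int i + 5 * (int i - 3 * t)" by simp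
    then have "(3 * (2 * (s - 2 * t + int i) - (2 * s + t))) mod 5 = int i"
      using x by (simp only: mod_mult_self2) simp
    then show "(\<lambda>(u, v). let i = (3 * (2 * v - u)) mod 5 in (nat i, (2 * u + v - i) div 5, (u - 2 * v + 2 * i) div 5))
        ((\<lambda>(i, s, t). (2 * s + t, s - 2 * t + int i)) x) = x"
      by (simp add: x Let_def)
  next
    fix y :: "int \<times> int"
    obtain u v where y: "y = (u, v)" by force
    define i where "i = (3 * (2 * v - u)) mod 5"
    have i0: "0 \<le> i" by (simp add: i_def)
    define k where "k = (3 * (2 * v - u)) div 5"
    have k: "3 * (2 * v - u) = i + 5 * k"
      unfolding i_def k_def by (rule mod_mult_div_eq [symmetric])
    have 1: "2 * u + v - i = 5 * (u - v + k)" using k by simp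
    have 2: "u - 2 * v + 2 * i = 5 * (2 * v - u - 2 * k)" using k by simp
    show "(\<lambda>(i, s, t). (2 * s + t, s - 2 * t + int i))
      ((\<lambda>(u, v). let i = (3 * (2 * v - u)) mod 5 in (nat i, (2 * u + v - i) div 5, (u - 2 * v + 2 * i) div 5)) y) = y"
      by (simp only: y prod.case Let_def 1 2 i_def [symmetric]) (use i0 k in simp)
  qed (auto simp: nat_less_iff Let_def)
  have f: "(\<lambda>(i, s, t). F (2 * s + t, s - 2 * t + int i)) summable_on ({..<5} \<times> UNIV)"
    using summable_on_reindex_bij_betw[OF b, of F] abs_summable_summable[OF assms] by (simp add: case_prod_unfold)
  have "infsum F UNIV = (\<Sum>\<^sub>\<infinity>(i, s, t)\<in>{..<5} \<times> UNIV. F (2 * s + t, s - 2 * t + int i))"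
    using infsum_reindex_bij_betw[OF b, of F] by (simp add: case_prod_unfold)
  also have "\<dots> = (\<Sum>\<^sub>\<infinity>i\<in>{..<5}. \<Sum>\<^sub>\<infinity>(s, t). F (2 * s + t, s - 2 * t + int i))"
    using infsum_Sigma'_banach[of "\<lambda>i (s, t). F (2 * s + t, s - 2 * t + int i)" "{..<5}" "\<lambda>_. UNIV", OF f] by simp
  finally show ?thesis by simp
qed

text \<open>The bilateral form of \<open>jacobi_triple\<close>; \<open>itri (k - 1)\<close> is
  \<open>k (k - 1) / 2\<close>.\<close>

lemma theta_product:
  assumes "0 < norm Q" "norm Q < 1" "a \<noteq> 0"
    and s: "(\<lambda>k. a powi k * Q powi (itri (k - 1))) norm_summable_on UNIV"
  shows "(\<Sum>\<^sub>\<infinity>k. a powi k * Q powi (itri (k - 1))) = qinf (- a) Q * qinf (- Q / a) Q * qinf Q Q"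
proof -
  note i = itri_of_nat
  have "(\<Sum>\<^sub>\<infinity>k. a powi k * Q powi (itri (k - 1)))
     = (\<Sum>n. a powi (int n + 1) * Q powi (itri (int n + 1 - 1)) + a powi (- int n) * Q powi (itri (- int n - 1)))"
    by (rule infsum_int[OF s])
  also have "\<dots> = (\<Sum>n. Q ^ tri n * (a ^ Suc n + (1 / a) ^ n))"
  proof (rule suminf_cong)
    fix n
    have "itri (- int n - 1) = int (tri n)" using itri_reflect[of "int n"] i[of n] by (metis uminus_add_conv_diff diff_conv_add_uminus add.commute)
    moreover have "a powi (int n + 1) = a ^ Suc n" using power_int_of_nat[of a "Suc n"] by (simp add: add.commute)
    moreover have "a powi (- int n) = (1 / a) ^ n" by (simp add: power_int_minus power_one_over inverse_eq_divide)
    ultimately show "a powi (int n + 1) * Q powi (itri (int n + 1 - 1)) + a powi (- int n) * Q powi (itri (- int n - 1))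
        = Q ^ tri n * (a ^ Suc n + (1 / a) ^ n)"
      by (simp add: i distrib_left mult.commute)
  qed
  also have "\<dots> = qinf (- a) Q * qinf (- Q / a) Q * qinf Q Q"
    by (rule jacobi_triple[symmetric]) (use assms in auto)
  finally show ?thesis .
qed

lemma theta_product_scaled:
  assumes Q: "0 < norm Q" "norm Q < 1" and "a \<noteq> 0" "C \<noteq> 0"
    and e: "\<And>s. u s = C * (a powi s * Q powi (itri (s - 1)))" and u: "u norm_summable_on UNIV"
  shows "infsum u UNIV = C * (qinf (- a) Q * qinf (- Q / a) Q * qinf Q Q)"
proof -
  have "(\<lambda>s. norm C * norm (a powi s * Q powi (itri (s - 1)))) summable_on UNIV"
    using u unfolding e by (simp only: norm_mult)
  then have "(\<lambda>s. a powi s * Q powi (itri (s - 1))) norm_summable_on UNIV"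
    using \<open>C \<noteq> 0\<close> summable_on_cmult_right'[of "norm C" "\<lambda>s. norm (a powi s * Q powi (itri (s - 1)))" UNIV] by simp
  from theta_product[OF Q \<open>a \<noteq> 0\<close> this] show ?thesis
    unfolding e infsum_cmult_right' by simp
qed

lemma shift_bij: "bij (\<lambda>s::int. s + j)" "bij (\<lambda>s::int. j - s)"
  by (rule bij_betwI[where g = "\<lambda>s. s - j"]; simp) (rule bij_betwI[where g = "\<lambda>s. j - s"]; simp)

text \<open>\<open>csum\<close> and \<open>dsum\<close> are the parts of the bilateral series of
  \<open>theta4 q\<close> and \<open>2 * psi q\<close> in which the summation index, not the
  exponent, has a given residue modulo 5.\<close>

definition csum :: "complex \<Rightarrow> int \<Rightarrow> complex" where
  "csum q i = (\<Sum>\<^sub>\<infinity>s. jj q (5 * s + i))"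

definition dsum :: "complex \<Rightarrow> int \<Rightarrow> complex" where
  "dsum q i = (\<Sum>\<^sub>\<infinity>s. q powi itri (5 * s + i))"

lemma csum_shift: "csum q (i + 5) = csum q i"
  unfolding csum_def using infsum_reindex_bij_betw[OF shift_bij(1), of "\<lambda>s. jj q (5 * s + i)" 1]
  by (simp add: algebra_simps)

lemma csum_minus: "csum q (- i) = csum q i"
  unfolding csum_def using infsum_reindex_bij_betw[OF shift_bij(2), of "\<lambda>s. jj q (5 * s + i)" 0]
proof -
  have "jj q (5 * (0 - s) + i) = jj q (5 * s + - i)" for s
  proof -
    have "5 * (0 - s) + i = - (5 * s + - i)" by simp
    then show ?thesis by (simp only: jj_def sg_simps power2_minus)
  qed
  then show "(\<Sum>\<^sub>\<infinity>s. jj q (5 * s + - i)) = (\<Sum>\<^sub>\<infinity>s. jj q (5 * s + i))"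
    using infsum_reindex_bij_betw[OF shift_bij(2), of "\<lambda>s. jj q (5 * s + i)" 0] by simp
qed

lemma dsum_shift: "dsum q (i + 5) = dsum q i"
  unfolding dsum_def using infsum_reindex_bij_betw[OF shift_bij(1), of "\<lambda>s. q powi itri (5 * s + i)" 1]
  by (simp add: algebra_simps)

lemma dsum_reflect: "dsum q (- 1 - i) = dsum q i"
proof -
  have "itri (5 * (0 - s) + i) = itri (5 * s + (- 1 - i))" for s
  proof -
    have "5 * (0 - s) + i = - 1 - (5 * s + (- 1 - i))" by simp
    then show ?thesis by (simp only: itri_reflect)
  qed
  then show ?thesis
    unfolding dsum_def using infsum_reindex_bij_betw[OF shift_bij(2), of "\<lambda>s. q powi itri (5 * s + i)" 0] by simp
qed

context
  fixes q :: complex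
  assumes q: "0 < norm q" "norm q < 1"
begin

lemma q_num: "0 < norm (q ^ numeral k)" "norm (q ^ numeral k) < 1"
  using q norm_power_less_1[OF q(2), of "numeral k"] by auto

lemma psi_summable: "summable (\<lambda>n. norm (q ^ tri n))"
  using summable_power_tri[of "norm q" 1] q by (simp add: norm_power)

lemma itri_summable: "(\<lambda>k. q powi itri k) norm_summable_on UNIV"
  and psi_int: "(\<Sum>\<^sub>\<infinity>k. q powi itri k) = 2 * psi q"
proof -
  have i: "itri (int n) = int (tri n)" "itri (- int n - 1) = int (tri n)" for n
  proof -
    show "itri (int n) = int (tri n)" by (rule itri_of_nat)
    then show "itri (- int n - 1) = int (tri n)" using itri_reflect[of "int n"] by (metis uminus_add_conv_diff diff_conv_add_uminus add.commute)
  qed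
  have s: "(\<lambda>k. q powi itri (k - 1)) norm_summable_on UNIV"
    unfolding int_abs_summable_iff using psi_summable by (simp add: i)
  have b: "bij (\<lambda>k::int. k - 1)" using shift_bij(1)[of "- 1"] by simp
  show "(\<lambda>k. q powi itri k) norm_summable_on UNIV"
    using summable_on_reindex_bij_betw[OF b, of "\<lambda>k. norm (q powi itri k)"] s by simp
  have "(\<Sum>\<^sub>\<infinity>k. q powi itri k) = (\<Sum>\<^sub>\<infinity>k. q powi itri (k - 1))"
    by (rule infsum_reindex_bij_betw[OF b, symmetric])
  also have "\<dots> = (\<Sum>n. 2 * q ^ tri n)"
    unfolding infsum_int[OF s] by (simp add: i)
  also have "\<dots> = 2 * psi q"
    unfolding psi_def by (rule suminf_mult[OF summable_norm_cancel[OF psi_summable]])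
  finally show "(\<Sum>\<^sub>\<infinity>k. q powi itri k) = 2 * psi q" .
qed

end

context
  fixes q :: complex
  assumes q: "0 < norm q" "norm q < 1"
begin

lemma q5: "0 < norm (q ^ 5)" "norm (q ^ 5) < 1"
  and q25: "0 < norm (q ^ 25)" "norm (q ^ 25) < 1"
  and q50: "0 < norm (q ^ 50)" "norm (q ^ 50) < 1"
  by (rule q_num[OF q])+

lemma psi_dissect0: "2 * psi q = 2 * dsum q 0 + 2 * dsum q 1 + dsum q 2"
proof -
  have "dsum q 3 = dsum q 1" "dsum q 4 = dsum q 0"
    using dsum_reflect[of q 1] dsum_reflect[of q 0] dsum_shift[of q "- 1"] dsum_shift[of q "- 2"] by simp_all
  moreover have "{..<5::nat} = {0, 1, 2, 3, 4}" by auto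
  ultimately show ?thesis
    using infsum_mod5(1)[OF itri_summable[OF q]] unfolding psi_int[OF q] dsum_def [symmetric] by simp
qed

lemma csum_summable: "(\<lambda>s. jj q (5 * s + i)) norm_summable_on UNIV"
  by (rule infsum_mod5(2)[OF jj_summable(1)[OF q]])

lemma dsum_summable: "(\<lambda>s. q powi itri (5 * s + i)) norm_summable_on UNIV"
  by (rule infsum_mod5(2)[OF itri_summable[OF q]])

lemma mult_eq_interchange:
  fixes a b :: "'a :: ab_semigroup_mult"
  assumes "a * b = e * f" "x * y = z * w"
  shows "(a * x) * (b * y) = (e * z) * (f * w)"
proof -
  have "(a * x) * (b * y) = (a * b) * (x * y)" by (simp only: mult_ac)
  also have "\<dots> = (e * f) * (z * w)" by (simp only: assms)
  also have "\<dots> = (e * z) * (f * w)" by (simp only: mult_ac)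
  finally show ?thesis .
qed

text \<open>From \<open>5 (x^2 + y^2) = (2 x + y)^2 + (x - 2 y)^2\<close>: on the coset
  \<open>x = 2 s + t\<close>, \<open>y = s - 2 t + i\<close> the two squares are those of
  \<open>5 s + i\<close> and \<open>5 t - 2 i\<close>, so each coset contributes a product of two
  values of \<open>csum\<close>.\<close>

lemma theta4_pow5_sq: "theta4 (q^5)^2 = csum q 0^2 + 4 * csum q 1 * csum q 2"
proof -
  define F where "F = (\<lambda>(u, v). jj (q^5) u * jj (q^5) v)"
  have F: "F norm_summable_on UNIV"
    using abs_summable_prod[OF jj_summable(1)[OF q5] jj_summable(1)[OF q5]] by (simp add: F_def)
  have "theta4 (q^5)^2 = infsum F UNIV"
    using infsum_prod[OF jj_summable(1)[OF q5] jj_summable(1)[OF q5]] by (simp add: F_def theta4_def power2_eq_square)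
  also have "\<dots> = (\<Sum>i<5. \<Sum>\<^sub>\<infinity>(s, t). F (2 * s + t, s - 2 * t + int i))"
    by (rule infsum_gauss_cosets[OF F])
  also have "\<dots> = (\<Sum>i<5. csum q (int i) * csum q (- 2 * int i))"
  proof (intro sum.cong refl)
    fix i :: nat
    have "F (2 * s + t, s - 2 * t + int i) = jj q (5 * s + int i) * jj q (5 * t + - 2 * int i)" for s t
    proof -
      have "5 * (2 * s + t)^2 + 5 * (s - 2 * t + int i)^2 = (5 * s + int i)^2 + (5 * t + - 2 * int i)^2"
        by (simp add: power2_eq_square algebra_simps)
      then have pw: "q powi (5 * (2 * s + t)^2) * q powi (5 * (s - 2 * t + int i)^2)
          = q powi ((5 * s + int i)^2) * q powi ((5 * t + - 2 * int i)^2)"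
        by (simp only: powi_add[OF q, symmetric])
      have sg: "sg (2 * s + t) * sg (s - 2 * t + int i) = sg (5 * s + int i) * sg (5 * t + - 2 * int i)"
        by (simp add: sg_def)
      have p5: "(q^5) powi n = q powi (5 * n)" for n by (simp add: power_int_power)
      show ?thesis unfolding F_def jj_def prod.case p5 by (rule mult_eq_interchange[OF sg pw])
    qed
    then show "(\<Sum>\<^sub>\<infinity>(s, t). F (2 * s + t, s - 2 * t + int i)) = csum q (int i) * csum q (- 2 * int i)"
      using infsum_prod[OF csum_summable[of "int i"] csum_summable[of "- 2 * int i"]] by (simp only: csum_def UNIV_Times_UNIV)
  qed
  also have "\<dots> = csum q 0^2 + 4 * csum q 1 * csum q 2"
  proof -
    have "csum q 3 = csum q 2" "csum q 4 = csum q 1" "csum q (- 2) = csum q 2" "csum q (- 4) = csum q 1" "csum q (- 6) = csum q 1" "csum q (- 8) = csum q 2"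
      using csum_minus[of q 1] csum_minus[of q 2] csum_minus[of q 3] csum_minus[of q 4] csum_minus[of q 6] csum_minus[of q 8] csum_shift[of q "- 2"] csum_shift[of q "- 1"] csum_shift[of q 1] csum_shift[of q 3]
      by simp_all
    moreover have "{..<5::nat} = {0, 1, 2, 3, 4}" by auto
    ultimately show ?thesis by (simp add: power2_eq_square)
  qed
  finally show ?thesis .
qed

text \<open>The same lattice argument for odd numbers, by \<open>8 itri k + 1 = (2 k + 1)^2\<close>.
  It gives \<open>1 + 5 itri x + 5 itri y = itri (2 x + y + 1) + itri (x - 2 y - 1)\<close>, and the
  constant 1 accounts for the factor \<open>q\<close>.\<close>

lemma psi_pow5_sq: "4 * q * psi (q^5)^2 = 4 * dsum q 0 * dsum q 1 + dsum q 2^2"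
proof -
  define F where "F = (\<lambda>(u, v). (q^5) powi itri u * (q^5) powi itri v)"
  have s5: "(\<lambda>k. (q^5) powi itri k) norm_summable_on UNIV" by (rule itri_summable[OF q5])
  have F: "F norm_summable_on UNIV"
    using abs_summable_prod[OF s5 s5] by (simp add: F_def)
  have "4 * q * psi (q^5)^2 = q * infsum F UNIV"
    using infsum_prod[OF s5 s5] psi_int[OF q5] by (simp add: F_def power2_eq_square)
  also have "\<dots> = (\<Sum>i<5. q * (\<Sum>\<^sub>\<infinity>(s, t). F (2 * s + t, s - 2 * t + int i)))"
    by (simp only: infsum_gauss_cosets[OF F] sum_distrib_left)
  also have "\<dots> = (\<Sum>i<5. dsum q (int i + 1) * dsum q (- 2 * int i - 1))"
  proof (intro sum.cong refl)
    fix i :: nat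
    have "q * F (2 * s + t, s - 2 * t + int i) = q powi itri (5 * s + (int i + 1)) * q powi itri (5 * t + (- 2 * int i - 1))" for s t
    proof -
      have "2 * (1 + 5 * itri (2 * s + t) + 5 * itri (s - 2 * t + int i))
          = 2 * (itri (5 * s + (int i + 1)) + itri (5 * t + (- 2 * int i - 1)))"
        by (simp only: distrib_left mult.left_commute[of 2] two_itri) (simp add: algebra_simps)
      then have "1 + 5 * itri (2 * s + t) + 5 * itri (s - 2 * t + int i)
          = itri (5 * s + (int i + 1)) + itri (5 * t + (- 2 * int i - 1))" by simp
      then have "q powi 1 * q powi (5 * itri (2 * s + t)) * q powi (5 * itri (s - 2 * t + int i))
          = q powi itri (5 * s + (int i + 1)) * q powi itri (5 * t + (- 2 * int i - 1))"
        by (simp only: powi_add[OF q, symmetric])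
      moreover have "(q^5) powi n = q powi (5 * n)" for n by (simp add: power_int_power)
      ultimately show ?thesis by (simp add: F_def mult.assoc)
    qed
    then show "q * (\<Sum>\<^sub>\<infinity>(s, t). F (2 * s + t, s - 2 * t + int i)) = dsum q (int i + 1) * dsum q (- 2 * int i - 1)"
      using infsum_prod[OF dsum_summable[of "int i + 1"] dsum_summable[of "- 2 * int i - 1"]]
      by (simp only: UNIV_Times_UNIV dsum_def case_prod_unfold infsum_cmult_right' [symmetric])
  qed
  also have "\<dots> = 4 * dsum q 0 * dsum q 1 + dsum q 2^2"
  proof -
    have "dsum q (- 1) = dsum q 0" "dsum q (- 3) = dsum q 2" "dsum q 3 = dsum q 1" "dsum q (- 5) = dsum q 0" "dsum q 4 = dsum q 0" "dsum q (- 7) = dsum q 1" "dsum q 5 = dsum q 0" "dsum q (- 9) = dsum q 1"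
      using dsum_reflect[of q 0] dsum_reflect[of q 2] dsum_reflect[of q 1] dsum_shift[of q "- 5"] dsum_reflect[of q 6] dsum_reflect[of q 8] dsum_shift[of q 0]
        dsum_shift[of q "- 1"] dsum_shift[of q "- 2"] dsum_shift[of q 1] dsum_shift[of q 3] dsum_reflect[of q 3] dsum_reflect[of q 4]
      by simp_all
    moreover have "{..<5::nat} = {0, 1, 2, 3, 4}" by auto
    ultimately show ?thesis by (simp add: power2_eq_square)
  qed
  finally show ?thesis .
qed

lemma csum_0: "csum q 0 = theta4 (q^25)"
proof -
  have "(q^25) powi n = q powi (25 * n)" for n by (simp add: power_int_power)
  moreover have "(5 * s)^2 = 25 * s^2" for s :: int by (simp add: power_mult_distrib)
  ultimately show ?thesis by (simp add: csum_def theta4_def jj_def [abs_def] sg_def)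
qed

lemma dsum_2: "dsum q 2 = 2 * q^3 * psi (q^25)"
proof -
  have "q powi itri (5 * s + 2) = q^3 * (q^25) powi itri s" for s
  proof -
    have "2 * itri (5 * s + 2) = 2 * (3 + 25 * itri s)"
      by (simp only: distrib_left mult.left_commute[of 2] two_itri) (simp add: algebra_simps)
    then have "itri (5 * s + 2) = 3 + 25 * itri s" by simp
    then have "q powi itri (5 * s + 2) = q powi 3 * q powi (25 * itri s)" by (simp only: powi_add[OF q])
    then show ?thesis by (simp add: power_int_power)
  qed
  then have "dsum q 2 = q^3 * (\<Sum>\<^sub>\<infinity>s. (q^25) powi itri s)"
    by (simp only: dsum_def infsum_cmult_right')
  then show ?thesis using psi_int[OF q25] by simp
qed

lemma dsum_0: "dsum q 0 = qinf (- (q^15)) (q^25) * qinf (- (q^10)) (q^25) * eu (q^25)"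
proof -
  have e: "q powi itri (5 * s + 0) = (q^15) powi s * (q^25) powi itri (s - 1)" for s
  proof -
    have "2 * itri (5 * s + 0) = 2 * (15 * s + 25 * itri (s - 1))"
      by (simp only: distrib_left mult.left_commute[of 2] two_itri) (simp add: algebra_simps)
    then have "itri (5 * s + 0) = 15 * s + 25 * itri (s - 1)" by simp
    then have "q powi itri (5 * s + 0) = q powi (15 * s) * q powi (25 * itri (s - 1))" by (simp only: powi_add[OF q])
    then show ?thesis by (simp add: power_int_power)
  qed
  have "q^15 \<noteq> 0" using q by simp
  from theta_product[OF q25 this] dsum_summable[of 0]
  have "dsum q 0 = qinf (- (q^15)) (q^25) * qinf (- (q^25) / q^15) (q^25) * eu (q^25)"
    unfolding dsum_def e eu_def by blast
  moreover have "- (q^25) / q^15 = - (q^10)" using q power_diff[of q 15 25] by simp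
  ultimately show ?thesis by simp
qed

lemma dsum_1: "dsum q 1 = q * (qinf (- (q^20)) (q^25) * qinf (- (q^5)) (q^25) * eu (q^25))"
proof -
  have e: "q powi itri (5 * s + 1) = q * ((q^20) powi s * (q^25) powi itri (s - 1))" for s
  proof -
    have "2 * itri (5 * s + 1) = 2 * (1 + (20 * s + 25 * itri (s - 1)))"
      by (simp only: distrib_left mult.left_commute[of 2] two_itri) (simp add: algebra_simps)
    then have "itri (5 * s + 1) = 1 + (20 * s + 25 * itri (s - 1))" by simp
    then have "q powi itri (5 * s + 1) = q powi 1 * (q powi (20 * s) * q powi (25 * itri (s - 1)))" by (simp only: powi_add[OF q])
    then show ?thesis by (simp add: power_int_power)
  qed
  have "dsum q 1 = q * (qinf (- (q^20)) (q^25) * qinf (- (q^25) / (q^20)) (q^25) * qinf (q^25) (q^25))"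
    unfolding dsum_def by (rule theta_product_scaled[OF q25 _ _ e dsum_summable]) (use q in auto)
  moreover have "- (q^25) / q^20 = - (q^5)" using q power_diff[of q 20 25] by simp
  ultimately show ?thesis by (simp add: eu_def)
qed

lemma csum_1: "csum q 1 = - q * (qinf (q^35) (q^50) * qinf (q^15) (q^50) * eu (q^50))"
proof -
  have e: "jj q (5 * s + 1) = - q * ((- (q^35)) powi s * (q^50) powi itri (s - 1))" for s
  proof -
    have "2 * (5 * s + 1)^2 = 2 * (1 + (35 * s + 50 * itri (s - 1)))"
      by (simp only: distrib_left mult.left_commute[of 2] two_itri) (simp add: power2_eq_square algebra_simps)
    then have "(5 * s + 1)^2 = 1 + (35 * s + 50 * itri (s - 1))" by simp
    then have "q powi ((5 * s + 1)^2) = q powi 1 * (q powi (35 * s) * q powi (50 * itri (s - 1)))" by (simp only: powi_add[OF q])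
    then show ?thesis by (simp add: jj_def minus_powi power_int_power sg_def)
  qed
  have "csum q 1 = (- q) * (qinf (- (- (q^35))) (q^50) * qinf (- (q^50) / (- (q^35))) (q^50) * qinf (q^50) (q^50))"
    unfolding csum_def by (rule theta_product_scaled[OF q50 _ _ e csum_summable]) (use q in auto)
  moreover have "- (q^50) / - (q^35) = q^15" using q power_diff[of q 35 50] by simp
  ultimately show ?thesis by (simp add: eu_def)
qed

lemma csum_2: "csum q 2 = q^4 * (qinf (q^45) (q^50) * qinf (q^5) (q^50) * eu (q^50))"
proof -
  have e: "jj q (5 * s + 2) = q^4 * ((- (q^45)) powi s * (q^50) powi itri (s - 1))" for s
  proof -
    have "2 * (5 * s + 2)^2 = 2 * (4 + (45 * s + 50 * itri (s - 1)))"
      by (simp only: distrib_left mult.left_commute[of 2] two_itri) (simp add: power2_eq_square algebra_simps)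
    then have "(5 * s + 2)^2 = 4 + (45 * s + 50 * itri (s - 1))" by simp
    then have "q powi ((5 * s + 2)^2) = q powi 4 * (q powi (45 * s) * q powi (50 * itri (s - 1)))" by (simp only: powi_add[OF q])
    then show ?thesis by (simp add: jj_def minus_powi power_int_power sg_def)
  qed
  have "csum q 2 = q^4 * (qinf (- (- (q^45))) (q^50) * qinf (- (q^50) / (- (q^45))) (q^50) * qinf (q^50) (q^50))"
    unfolding csum_def by (rule theta_product_scaled[OF q50 _ _ e csum_summable]) (use q in auto)
  moreover have "- (q^50) / - (q^45) = q^5" using q power_diff[of q 45 50] by simp
  ultimately show ?thesis by (simp add: eu_def)
qed

end

text \<open>In Ramanujan's notation this is \<open>f(q^2, q^3)\<close>, and \<open>psi1\<close> is
  \<open>f(q, q^4)\<close>.\<close>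

definition psi0 :: "complex \<Rightarrow> complex" where
  "psi0 q = qinf (- (q^3)) (q^5) * qinf (- (q^2)) (q^5) * eu (q^5)"

definition psi1 :: "complex \<Rightarrow> complex" where
  "psi1 q = qinf (- (q^4)) (q^5) * qinf (- q) (q^5) * eu (q^5)"

text \<open>At a fifth root \<open>r\<close> of \<open>q\<close> the parts of the dissections are
  functions of \<open>q\<close> times powers of \<open>r\<close>, so the lattice identities at
  \<open>r\<close> become identities in \<open>q\<close>.\<close>

lemma fifth_root:
  fixes Q :: complex
  assumes "0 < norm Q" "norm Q < 1"
  obtains q where "q^5 = Q" "0 < norm q" "norm q < 1"
proof -
  define q where "q = exp (Ln Q / 5)"
  have "q^5 = Q" using assms by (simp add: q_def flip: exp_of_nat_mult)
  moreover have "norm q < 1"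
    using assms \<open>q^5 = Q\<close> by (metis norm_power not_le one_le_power)
  ultimately show ?thesis using that assms by (metis norm_zero power_0_left zero_less_norm_iff zero_neq_numeral)
qed

context
  fixes q :: complex
  assumes q: "0 < norm q" "norm q < 1"
begin

lemma psi_dissection: "psi q = psi0 (q^5) + q * psi1 (q^5) + q^3 * psi (q^25)"
proof -
  have "2 * psi q = 2 * (psi0 (q^5) + q * psi1 (q^5) + q^3 * psi (q^25))"
    using psi_dissect0[OF q] unfolding dsum_0[OF q] dsum_1[OF q] dsum_2[OF q] psi0_def psi1_def
    by (simp add: algebra_simps flip: power_mult)
  then show ?thesis by (metis mult_left_cancel zero_neq_numeral)
qed

lemma psi0_mult_psi1: "psi0 q * psi1 q = psi q^2 - q * psi (q^5)^2"
proof -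
  obtain r where r: "r^5 = q" "0 < norm r" "norm r < 1" using fifth_root[OF q] .
  have r0: "r \<noteq> 0" using r by auto
  have "4 * r * psi q^2 = 4 * psi0 q * (r * psi1 q) + (2 * r^3 * psi (q^5))^2"
    using psi_pow5_sq[OF r(2,3)] unfolding dsum_0[OF r(2,3)] dsum_1[OF r(2,3)] dsum_2[OF r(2,3)] psi0_def psi1_def r(1) [symmetric]
    by (simp flip: power_mult)
  also have "(2 * r^3 * psi (q^5))^2 = 4 * r * (q * psi (q^5)^2)"
    unfolding r(1) [symmetric] by (simp add: power2_eq_square power_numeral_reduce)
  finally have "4 * r * (psi0 q * psi1 q) = 4 * r * (psi q^2 - q * psi (q^5)^2)" by (simp add: algebra_simps)
  then show ?thesis using r0 by simp
qed

lemma theta4_sq_diff: "theta4 q^2 - theta4 (q^5)^2 = - 4 * q * (qinf (q^7) (q^10) * qinf (q^3) (q^10) * qinf (q^9) (q^10) * qinf q (q^10) * eu (q^10)^2)"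
proof -
  obtain r where r: "r^5 = q" "0 < norm r" "norm r < 1" using fifth_root[OF q] .
  have "theta4 q^2 = theta4 (q^5)^2 + 4 * (- r * (qinf (q^7) (q^10) * qinf (q^3) (q^10) * eu (q^10))) * (r^4 * (qinf (q^9) (q^10) * qinf q (q^10) * eu (q^10)))"
    using theta4_pow5_sq[OF r(2,3)] unfolding csum_0[OF r(2,3)] csum_1[OF r(2,3)] csum_2[OF r(2,3)] r(1) [symmetric]
    by (simp flip: power_mult)
  then show ?thesis unfolding r(1) [symmetric] by (simp add: power_numeral_reduce)
qed

end

text \<open>
  Used with \<open>a\<close>, \<open>b\<close>, \<open>c\<close>, \<open>d\<close> equal to \<open>eu\<close> at \<open>q\<close>, \<open>q^2\<close>, \<open>q^5\<close>, \<open>q^10\<close>.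
\<close>

lemma eta_quotients:
  fixes a b c d :: "'a :: field"
  assumes nz: "a \<noteq> 0" "b \<noteq> 0" "c \<noteq> 0" "d \<noteq> 0"
    and e: "s * a = b^2" "t * c = d^2" "u * b = a^2" "v * d = c^2" "w * a * d = b * c^3" "x * b * c = a * d^3"
  shows "w^3 * u = s * t * v^5" "x * w = t^2 * v^2"
proof -
  have 1: "s = b^2 / a" "t = d^2 / c" "u = a^2 / b" "v = c^2 / d" "w = b * c^3 / (a * d)" "x = a * d^3 / (b * c)"
    using nz e by (simp_all add: field_simps)
  show "w^3 * u = s * t * v^5" "x * w = t^2 * v^2"
    unfolding 1 using nz by (simp_all add: field_simps power_mult_distrib power_numeral_reduce)
qed

section \<open>Euler products and the relations between psi and theta4\<close>

lemma nested_five: "{..<5::nat} = {0, 1, 2, 3, 4}" by auto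

context
  fixes q :: complex
  assumes q: "0 < norm q" "norm q < 1"
begin

lemma eu_nonzero: "eu q \<noteq> 0"
  unfolding eu_def by (rule qinf_nonzero') (use q in auto)

lemma eu_sq: "qinf (- q) q * eu q = eu (q^2)"
  unfolding eu_def by (rule qinf_neg_relation[OF q])

lemma psi_mult_eu: "psi q * eu q = eu (q^2)^2"
proof -
  have "qinf (- 1) q * qinf (- q) q * eu q = (\<Sum>n. 2 * q ^ tri n)"
    using jacobi_triple[OF q(2), of 1] by (simp add: eu_def mult.commute)
  also have "\<dots> = 2 * psi q"
    unfolding psi_def by (rule suminf_mult[OF summable_norm_cancel[OF psi_summable[OF q]]])
  also have "qinf (- 1) q = 2 * qinf (- q) q"
    using qinf_step[OF q(2), of "- 1"] by simp
  finally have "psi q = qinf (- q) q * (qinf (- q) q * eu q)" by simp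
  then have "psi q * eu q = (qinf (- q) q * eu q) * (qinf (- q) q * eu q)" by (simp only: mult_ac)
  then show ?thesis by (simp only: eu_sq power2_eq_square)
qed

lemma theta4_mult_eu: "theta4 q * eu (q^2) = eu q^2"
proof -
  have "theta4 q * (qinf (- q) q * eu q) = eu q * eu q"
    using theta4_mult_qinf[OF q] by (simp only: eu_def flip: mult.assoc)
  then show ?thesis by (simp only: eu_sq power2_eq_square)
qed

lemma q_powers: "n > 0 \<Longrightarrow> 0 < norm (q ^ n)" "n > 0 \<Longrightarrow> norm (q ^ n) < 1"
  using q norm_power_less_1[OF q(2)] by auto

end

context
  fixes q :: complex
  assumes q: "0 < norm q" "norm q < 1"
begin

lemma eu_power_nonzero: "n > 0 \<Longrightarrow> eu (q ^ n) \<noteq> 0"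
  using eu_nonzero[OF q_powers[OF q]] .

text \<open>The source of the locale assumption \<open>cubic\<close>: through Jacobi's series for
  the cube of \<open>eu (q^2)\<close> it gives the coefficients of \<open>p^2 * P\<close>.\<close>

lemma psi_sq_mult_theta4: "psi q^2 * theta4 q = eu (q^2)^3"
proof -
  have "psi q^2 * theta4 q * (eu q^2 * eu (q^2)) = (psi q * eu q)^2 * (theta4 q * eu (q^2))"
    by (simp only: power_mult_distrib mult_ac)
  also have "\<dots> = eu (q^2)^3 * (eu q^2 * eu (q^2))"
    unfolding psi_mult_eu[OF q] theta4_mult_eu[OF q] by (simp add: power_numeral_reduce)
  finally show ?thesis using eu_power_nonzero[of 2] eu_nonzero[OF q] by simp
qed

text \<open>Splitting \<open>(- q; q)_inf\<close> modulo 5, the four classes prime to 5 are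
  precisely the factors of \<open>psi0\<close> and \<open>psi1\<close>.\<close>

lemma psi0_psi1_eu: "psi0 q * psi1 q * eu q * eu (q^10) = eu (q^2) * eu (q^5)^3"
proof -
  have "qinf (- q) q = qinf (- q) (q^5) * qinf (- (q^2)) (q^5) * qinf (- (q^3)) (q^5) * qinf (- (q^4)) (q^5) * qinf (- (q^5)) (q^5)"
    using qinf_split[OF q(2), of 5 "- q"]
    by (simp add: nested_five power_numeral_reduce mult.assoc)
  moreover have "qinf (- (q^5)) (q^5) * eu (q^5) = eu (q^10)"
    using eu_sq[OF q5[OF q]] by (simp flip: power_mult)
  moreover have "qinf (- q) q * eu q = eu (q^2)" by (rule eu_sq[OF q])
  ultimately show ?thesis unfolding psi0_def psi1_def by algebra
qed

text \<open>Evaluates the product in \<open>theta4_sq_diff\<close>: it runs over the odd residues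
  modulo 10 other than 5, which are read off from a splitting of
  \<open>(q; q^2)_inf\<close>.\<close>

lemma odd_product_eu:
  "qinf (q^7) (q^10) * qinf (q^3) (q^10) * qinf (q^9) (q^10) * qinf q (q^10) * eu (q^10)^2 * eu (q^2) * eu (q^5) = eu q * eu (q^10)^3"
proof -
  have "qinf q (q^2) = qinf q (q^10) * qinf (q^3) (q^10) * qinf (q^5) (q^10) * qinf (q^7) (q^10) * qinf (q^9) (q^10)"
    using qinf_split[of "q^2" 5 q] norm_power_less_1[OF q(2), of 2]
    by (simp add: nested_five power_numeral_reduce mult.assoc)
  moreover have "eu q = qinf q (q^2) * eu (q^2)"
    using qinf_split_2[OF q] by (simp add: eu_def)
  moreover have "eu (q^5) = qinf (q^5) (q^10) * eu (q^10)"
    using qinf_split_2[OF q5[OF q]] by (simp add: eu_def flip: power_mult)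
  ultimately show ?thesis by algebra
qed

text \<open>The differences of squares on both sides are products (\<open>psi0_mult_psi1\<close>,
  \<open>theta4_sq_diff\<close>), so every function involved is a quotient of values of
  \<open>eu\<close> and only monomials have to be compared.\<close>

lemma theta4_psi_relations:
  defines "w \<equiv> psi q^2 - q * psi (q^5)^2"
  shows "(theta4 q^2 - theta4 (q^5)^2) * w = - 4 * q * psi (q^5)^2 * theta4 (q^5)^2"
    and "w^3 * theta4 q = psi q * psi (q^5) * theta4 (q^5)^5"
proof -
  have w: "w = psi0 q * psi1 q" by (simp add: w_def psi0_mult_psi1[OF q])
  have 5: "psi (q^5) * eu (q^5) = eu (q^10)^2" "theta4 (q^5) * eu (q^10) = eu (q^5)^2"
    using psi_mult_eu[OF q5[OF q]] theta4_mult_eu[OF q5[OF q]] by (simp_all flip: power_mult)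
  have nz: "eu q \<noteq> 0" "eu (q^2) \<noteq> 0" "eu (q^5) \<noteq> 0" "eu (q^10) \<noteq> 0"
    using eu_nonzero[OF q] by (simp_all add: eu_power_nonzero)
  note r = eta_quotients[OF nz psi_mult_eu[OF q] 5(1) theta4_mult_eu[OF q] 5(2) psi0_psi1_eu odd_product_eu]
  show "w^3 * theta4 q = psi q * psi (q^5) * theta4 (q^5)^5" unfolding w by (rule r(1))
  show "(theta4 q^2 - theta4 (q^5)^2) * w = - 4 * q * psi (q^5)^2 * theta4 (q^5)^2"
    unfolding w theta4_sq_diff[OF q] using r(2) by algebra
qed

lemma theta4_mult_minus: "theta4 q * theta4 (- q) = theta4 (q^2)^2"
proof -
  have *: "(A^2 * X) * (B^2 * X) = (C^2 * Y)^2" if "A * B = C" "X = C * Y" for A B C X Y :: complex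
    unfolding that(2) that(1) [symmetric] by (simp add: power2_eq_square mult_ac)
  have "theta4 (- q) = qinf (- q) (q^2)^2 * qinf (q^2) (q^2)"
    using theta4_eq_qinf[OF mq[OF q]] by simp
  then show ?thesis
    unfolding theta4_eq_qinf[OF q] theta4_eq_qinf[OF q2[OF q]]
    using *[OF qinf_mult_neg[OF q2(2)[OF q], of q] qinf_split_2[OF q2[OF q]]] by (simp only:)
qed

lemma J2_eq_eu: "J2 q = eu (q^2)^3"
  using J2_series[OF q] jacobi_cube[OF q2(2)[OF q]] by (simp add: eu_def)

end

text \<open>\<open>lambert_sum_product\<close> with the nonzero factor
  \<open>J2 q = eu (q^2)^3\<close> cancelled: on its right side,
  \<open>J2 (q^2)^2 = eu (q^4)^6 = (psi (q^2) * eu (q^2))^3\<close>.\<close>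

lemma phi_odd_part:
  assumes q: "0 < norm q" "norm q < 1"
  shows "theta4 (q^2)^2 * (phi q - phi (- q)) = 2 * q * psi (q^2)^3"
proof -
  note q2 = q2[OF q]
  have "eu (q^2)^3 * (theta4 (q^2)^2 * (phi q - phi (- q))) = J2 q * (lambert_sum q * theta4 (- q) - lambert_sum (- q) * theta4 q)"
    unfolding J2_eq_eu[OF q] theta4_mult_minus[OF q, symmetric] phi_mult_theta4[OF q, symmetric] phi_mult_theta4[OF mq[OF q], symmetric]
    by (simp add: algebra_simps)
  also have "\<dots> = 2 * q * J2 (q^2)^2" by (rule lambert_sum_product[OF q])
  also have "\<dots> = 2 * q * (psi (q^2) * eu (q^2))^3"
    unfolding J2_eq_eu[OF q2] psi_mult_eu[OF q2] by (simp flip: power_mult)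
  finally have "eu (q^2)^3 * (theta4 (q^2)^2 * (phi q - phi (- q))) = eu (q^2)^3 * (2 * q * psi (q^2)^3)"
    by (simp only: power_mult_distrib mult_ac)
  then show ?thesis using eu_nonzero[OF q2] by (metis mult_left_cancel power_not_zero)
qed

section \<open>Products over the fifth roots of unity\<close>

definition fifth_root_prod :: "complex \<Rightarrow> (complex \<Rightarrow> complex) \<Rightarrow> complex \<Rightarrow> complex" where
  "fifth_root_prod z f x = f x * f (z * x) * f (z^2 * x) * f (z^3 * x) * f (z^4 * x)"

lemma fifth_root_prod_linear:
  assumes "1 + z + z^2 + z^3 + z^4 = 0"
  shows "fifth_root_prod z (\<lambda>x. 1 - x) x = 1 - x^5"
  unfolding fifth_root_prod_def using assms by algebra

lemma fifth_root_prod_qinf: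
  assumes "1 + z + z^2 + z^3 + z^4 = 0" "norm Q < 1"
  shows "fifth_root_prod z (\<lambda>x. qinf x Q) x = qinf (x^5) (Q^5)"
proof (rule LIMSEQ_unique)
  show "(\<lambda>n. fifth_root_prod z (\<lambda>x. qpoch x Q n) x) \<longlonglongrightarrow> fifth_root_prod z (\<lambda>x. qinf x Q) x"
    unfolding fifth_root_prod_def by (intro tendsto_mult qpoch_tendsto assms)
  have "fifth_root_prod z (\<lambda>x. qpoch x Q n) x = qpoch (x^5) (Q^5) n" for n
  proof (induction n)
    case (Suc n)
    have "fifth_root_prod z (\<lambda>x. qpoch x Q (Suc n)) x
        = fifth_root_prod z (\<lambda>x. qpoch x Q n) x * fifth_root_prod z (\<lambda>x. 1 - x) (x * Q ^ n)"
      by (simp only: fifth_root_prod_def qpoch_Suc mult_ac)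
    then show ?case
      by (simp add: Suc fifth_root_prod_linear[OF assms(1)] qpoch_Suc power_mult_distrib power_commutes flip: power_mult)
        (simp add: mult.commute)
  qed (simp add: fifth_root_prod_def)
  then show "(\<lambda>n. fifth_root_prod z (\<lambda>x. qpoch x Q n) x) \<longlonglongrightarrow> qinf (x^5) (Q^5)"
    using qpoch_tendsto[of "Q^5" "x^5"] norm_power_less_1[OF assms(2), of 5] by simp
qed

lemma fifth_root_sum:
  fixes z :: complex
  assumes "1 + z + z^2 + z^3 + z^4 = 0"
  shows "z^5 = 1"
  using assms by algebra

lemma norm_fifth_root: "z^5 = 1 \<Longrightarrow> norm (z :: complex) = 1"
  by (metis norm_power norm_one power_eq_1_iff norm_ge_zero zero_neq_numeral)

lemma fifth_root_powers:
  fixes z :: complex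
  assumes "1 + z + z^2 + z^3 + z^4 = 0"
  shows "z^5 = 1" "z^6 = z" "z^8 = z^3" "z^9 = z^4" "z^10 = 1" "z^12 = z^2" "z^15 = 1" "z^16 = z" "z^20 = 1"
proof -
  have *: "z^(5 * k + r) = z^r" for k r
    using fifth_root_sum[OF assms] by (simp add: power_add power_mult)
  show "z^5 = 1" "z^6 = z" "z^8 = z^3" "z^9 = z^4" "z^10 = 1" "z^12 = z^2" "z^15 = 1" "z^16 = z" "z^20 = 1"
    using *[of 1 0] *[of 1 1] *[of 1 3] *[of 1 4] *[of 2 0] *[of 2 2] *[of 3 0] *[of 3 1] *[of 4 0] by simp_all
qed

text \<open>Split \<open>eu\<close> by residues of the exponent modulo 5. The multiples of 5 do not
  change under \<open>x -> z x\<close> and contribute \<open>eu (q^5)^5\<close>; in the other four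
  classes the product over the roots yields \<open>eu (q^5) / eu (q^25)\<close>.\<close>

lemma fifth_root_prod_eu:
  assumes z: "1 + z + z^2 + z^3 + z^4 = 0" and q: "0 < norm q" "norm q < 1"
  shows "fifth_root_prod z eu q * eu (q^25) = eu (q^5)^6"
proof -
  have z5: "z^5 = 1" by (rule fifth_root_sum[OF z])
  have z1: "norm z = 1" by (rule norm_fifth_root[OF z5])
  have *: "eu x = qinf x (q^5) * qinf (x^2) (q^5) * qinf (x^3) (q^5) * qinf (x^4) (q^5) * eu (q^5)"
    if "x^5 = q^5" "norm x < 1" for x
    using qinf_split[OF that(2), of 5 x] that(1)
    by (simp add: eu_def nested_five mult.assoc flip: power_Suc power_Suc2) (simp add: power_numeral_reduce)
  have 5: "(z * q)^5 = q^5" "(z^2 * q)^5 = q^5" "(z^3 * q)^5 = q^5" "(z^4 * q)^5 = q^5"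
    using z5 by algebra+
  have n: "norm (z * q) < 1" "norm (z^2 * q) < 1" "norm (z^3 * q) < 1" "norm (z^4 * q) < 1"
    using q by (simp_all add: norm_mult norm_power z1)
  have nQ: "norm (q^5) < 1" using norm_power_less_1[OF q(2)] by simp
  have "fifth_root_prod z eu q = fifth_root_prod z (\<lambda>x. qinf x (q^5)) q * fifth_root_prod z (\<lambda>x. qinf x (q^5)) (q^2)
    * fifth_root_prod z (\<lambda>x. qinf x (q^5)) (q^3) * fifth_root_prod z (\<lambda>x. qinf x (q^5)) (q^4) * eu (q^5)^5"
  proof -
    have p: "(z * q)^2 = z^2 * q^2" "(z^2 * q)^2 = z^4 * q^2" "(z^3 * q)^2 = z * q^2" "(z^4 * q)^2 = z^3 * q^2"
      "(z * q)^3 = z^3 * q^3" "(z^2 * q)^3 = z * q^3" "(z^3 * q)^3 = z^4 * q^3" "(z^4 * q)^3 = z^2 * q^3"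
      "(z * q)^4 = z^4 * q^4" "(z^2 * q)^4 = z^3 * q^4" "(z^3 * q)^4 = z^2 * q^4" "(z^4 * q)^4 = z * q^4"
      by (simp_all add: power_mult_distrib fifth_root_powers[OF z] flip: power_mult)
    have e: "eu (q^5)^5 = eu (q^5) * eu (q^5) * eu (q^5) * eu (q^5) * eu (q^5)"
      by (simp add: power_numeral_reduce)
    show ?thesis
      unfolding fifth_root_prod_def *[OF refl q(2)] *[OF 5(1) n(1)] *[OF 5(2) n(2)] *[OF 5(3) n(3)] *[OF 5(4) n(4)] p
      by (simp only: e mult_ac)
  qed
  also have "\<dots> = qinf (q^5) (q^25) * qinf (q^10) (q^25) * qinf (q^15) (q^25) * qinf (q^20) (q^25) * eu (q^5)^5"
    by (simp add: fifth_root_prod_qinf[OF z nQ] flip: power_mult)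
  moreover have "eu (q^5) = qinf (q^5) (q^25) * qinf (q^10) (q^25) * qinf (q^15) (q^25) * qinf (q^20) (q^25) * eu (q^25)"
    using qinf_split[OF nQ, of 5 "q^5"]
    by (simp add: eu_def nested_five mult.assoc flip: power_mult power_add)
  ultimately show ?thesis by algebra
qed

text \<open>The product over the roots is multiplicative, so \<open>psi_mult_eu\<close> reduces the
  claim to \<open>eu\<close>; squaring the argument merely permutes the fifth roots of
  unity.\<close>

lemma fifth_root_prod_psi:
  assumes z: "1 + z + z^2 + z^3 + z^4 = 0" and q: "0 < norm q" "norm q < 1"
  shows "fifth_root_prod z psi q * psi (q^25) = psi (q^5)^6"
proof -
  have z5: "z^5 = 1" by (rule fifth_root_sum[OF z])
  have z1: "norm z = 1" by (rule norm_fifth_root[OF z5])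
  have n: "0 < norm (z * q)" "0 < norm (z^2 * q)" "0 < norm (z^3 * q)" "0 < norm (z^4 * q)"
    "norm (z * q) < 1" "norm (z^2 * q) < 1" "norm (z^3 * q) < 1" "norm (z^4 * q) < 1"
    using q by (simp_all add: norm_mult norm_power z1)
  have p: "(z * q)^2 = z^2 * q^2" "(z^2 * q)^2 = z^4 * q^2" "(z^3 * q)^2 = z * q^2" "(z^4 * q)^2 = z^3 * q^2"
    using z5 by algebra+
  have "fifth_root_prod z psi q * fifth_root_prod z eu q = (fifth_root_prod z eu (q^2))^2"
  proof -
    have "fifth_root_prod z psi q * fifth_root_prod z eu q = (psi q * eu q) * (psi (z * q) * eu (z * q))
        * (psi (z^2 * q) * eu (z^2 * q)) * (psi (z^3 * q) * eu (z^3 * q)) * (psi (z^4 * q) * eu (z^4 * q))"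
      by (simp only: fifth_root_prod_def mult_ac)
    also have "\<dots> = (fifth_root_prod z eu (q^2))^2"
      unfolding psi_mult_eu[OF q] psi_mult_eu[OF n(1,5)] psi_mult_eu[OF n(2,6)] psi_mult_eu[OF n(3,7)] psi_mult_eu[OF n(4,8)] p
      by (simp only: fifth_root_prod_def mult_ac power_mult_distrib)
    finally show ?thesis .
  qed
  moreover have "fifth_root_prod z eu q * eu (q^25) = eu (q^5)^6" by (rule fifth_root_prod_eu[OF z q])
  moreover have "fifth_root_prod z eu (q^2) * eu (q^50) = eu (q^10)^6"
    using fifth_root_prod_eu[OF z q2[OF q]] by (simp flip: power_mult)
  moreover have "psi (q^25) * eu (q^25) = eu (q^50)^2"
    using psi_mult_eu[OF q25[OF q]] by (simp flip: power_mult)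
  moreover have "psi (q^5) * eu (q^5) = eu (q^10)^2"
    using psi_mult_eu[OF q5[OF q]] by (simp flip: power_mult)
  ultimately have "(fifth_root_prod z psi q * psi (q^25)) * (eu (q^5)^6 * eu (q^50)^2) = psi (q^5)^6 * (eu (q^5)^6 * eu (q^50)^2)"
    by algebra
  then show ?thesis using eu_power_nonzero[OF q, of 5] eu_power_nonzero[OF q, of 50] by simp
qed

lemma fifth_root_norm_form:
  fixes x y t z :: complex
  assumes z: "1 + z + z^2 + z^3 + z^4 = 0"
  shows "(x + y + t) * (x + z * y + z^3 * t) * (x + z^2 * y + z * t) * (x + z^3 * y + z^4 * t) * (x + z^4 * y + z^2 * t)
    = x^5 + y^5 + t^5 - 5 * x * y * t^3 + 5 * x^2 * y^2 * t"
  using z by algebra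

lemma fifth_root_of_unity:
  obtains z :: complex where "1 + z + z^2 + z^3 + z^4 = 0"
proof -
  define z where "z = cis (2 * pi / 5)"
  have "real 5 * (2 * pi / 5) = 2 * pi" by simp
  then have "z^5 = 1" using cis_2pi by (simp only: z_def Complex.DeMoivre of_nat_numeral)
  then have "(z - 1) * (1 + z + z^2 + z^3 + z^4) = 0" by algebra
  moreover have "sin (2 * pi / 5) > 0" by (rule sin_gt_zero) auto
  then have "z \<noteq> 1" by (auto simp: z_def complex_eq_iff)
  ultimately show ?thesis using that by simp
qed

text \<open>At \<open>c * q\<close> with \<open>c^5 = 1\<close> the dissection has the same three
  parts with weights 1, \<open>c\<close> and \<open>c^3\<close>; the five values multiply to the
  norm form.\<close>

lemma psi_norm:
  assumes q: "0 < norm q" "norm q < 1"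
  defines "x \<equiv> psi0 (q^5)" and "y \<equiv> q * psi1 (q^5)" and "t \<equiv> q^3 * psi (q^25)"
  shows "(x^5 + y^5 + t^5 - 5 * x * y * t^3 + 5 * x^2 * y^2 * t) * psi (q^25) = psi (q^5)^6"
proof -
  obtain z :: complex where z: "1 + z + z^2 + z^3 + z^4 = 0" by (rule fifth_root_of_unity)
  have z5: "z^5 = 1" by (rule fifth_root_sum[OF z])
  have "psi (c * q) = x + c * y + c^3 * t" if "c^5 = 1" for c
  proof -
    have n: "norm c = 1" by (rule norm_fifth_root[OF that])
    have p: "(c * q)^5 = q^5" "(c * q)^25 = q^25" using that by algebra+
    have "psi (c * q) = psi0 ((c * q)^5) + c * q * psi1 ((c * q)^5) + (c * q)^3 * psi ((c * q)^25)"
      by (rule psi_dissection) (use q n in \<open>auto simp: norm_mult\<close>)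
    then show ?thesis unfolding p by (simp add: x_def y_def t_def power_mult_distrib)
  qed
  from this[of 1] this[of z] this[of "z^2"] this[of "z^3"] this[of "z^4"]
  have "psi q = x + y + t" "psi (z * q) = x + z * y + z^3 * t" "psi (z^2 * q) = x + z^2 * y + z * t"
    "psi (z^3 * q) = x + z^3 * y + z^4 * t" "psi (z^4 * q) = x + z^4 * y + z^2 * t"
    by (simp_all add: fifth_root_powers[OF z] flip: power_mult)
  then show ?thesis
    using fifth_root_prod_psi[OF z q] unfolding fifth_root_prod_def fifth_root_norm_form[OF z, symmetric] by simp
qed

section \<open>Transfer to integral power series\<close>

text \<open>The point 0 is left out because the theta identities are proved for nonzero
  \<open>q\<close>, where integer powers behave; the punctured disc still determines all
  coefficients (\<open>represents_0\<close>).\<close>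

definition represents :: "int fps \<Rightarrow> (complex \<Rightarrow> complex) \<Rightarrow> bool" where
  "represents f g \<longleftrightarrow> (\<forall>q. 0 < norm q \<longrightarrow> norm q < 1 \<longrightarrow> (\<lambda>n. of_int (fps_nth f n) * q ^ n) sums g q)"

lemma representsD:
  "represents f g \<Longrightarrow> 0 < norm q \<Longrightarrow> norm q < 1 \<Longrightarrow> (\<lambda>n. of_int (fps_nth f n) * q ^ n) sums g q"
  by (simp add: represents_def)

lemma represents_cong:
  "represents f g \<Longrightarrow> (\<And>q. 0 < norm q \<Longrightarrow> norm q < 1 \<Longrightarrow> g q = g' q) \<Longrightarrow> represents f g'"
  by (simp add: represents_def)

lemma represents_abs_summable:
  fixes q :: complex
  assumes f: "represents f g" and q: "0 < norm q" "norm q < 1"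
  shows "summable (\<lambda>n. norm (of_int (fps_nth f n) * q ^ n))"
proof -
  \<comment> \<open>A point of larger modulus inside the disc: convergence there gives absolute
    convergence at \<open>q\<close>.\<close>
  define x :: complex where "x = of_real ((1 + norm q) / 2)"
  have x: "norm x = (1 + norm q) / 2" unfolding x_def norm_of_real using q by simp
  have x': "0 < norm x" "norm x < 1" "norm q < norm x"
  proof -
    show "0 < norm x" unfolding x by (simp add: add_pos_nonneg)
    show "norm x < 1" unfolding x using q(2) by simp
    show "norm q < norm x" unfolding x using q(2) by (simp add: field_simps)
  qed
  have "summable (\<lambda>n. of_int (fps_nth f n) * x ^ n)"
    by (rule sums_summable[OF representsD[OF f x'(1,2)]])
  then show ?thesis
    by (rule powser_insidea[of "\<lambda>n. of_int (fps_nth f n)" x q]) (rule x'(3))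
qed

lemma represents_add: "represents f g \<Longrightarrow> represents f' g' \<Longrightarrow> represents (f + f') (\<lambda>q. g q + g' q)"
  unfolding represents_def by (auto simp: distrib_right intro!: sums_add)

lemma represents_diff: "represents f g \<Longrightarrow> represents f' g' \<Longrightarrow> represents (f - f') (\<lambda>q. g q - g' q)"
  unfolding represents_def by (auto simp: left_diff_distrib intro!: sums_diff)

lemma represents_mult:
  assumes "represents f g" "represents f' g'"
  shows "represents (f * f') (\<lambda>q. g q * g' q)"
  unfolding represents_def
proof (intro allI impI)
  fix q :: complex assume q: "0 < norm q" "norm q < 1"
  have "(\<lambda>n. \<Sum>i\<le>n. (of_int (fps_nth f i) * q ^ i) * (of_int (fps_nth f' (n - i)) * q ^ (n - i))) sums
      ((\<Sum>n. of_int (fps_nth f n) * q ^ n) * (\<Sum>n. of_int (fps_nth f' n) * q ^ n))"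
    by (rule Cauchy_product_sums) (rule represents_abs_summable[OF assms(1) q] represents_abs_summable[OF assms(2) q])+
  also have "(\<Sum>n. of_int (fps_nth f n) * q ^ n) * (\<Sum>n. of_int (fps_nth f' n) * q ^ n) = g q * g' q"
    using representsD[OF assms(1) q] representsD[OF assms(2) q] by (simp add: sums_iff)
  also have "(\<lambda>n. \<Sum>i\<le>n. (of_int (fps_nth f i) * q ^ i) * (of_int (fps_nth f' (n - i)) * q ^ (n - i)))
      = (\<lambda>n. of_int (fps_nth (f * f') n) * q ^ n)"
  proof
    fix n
    have "(of_int (fps_nth f i) * q ^ i) * (of_int (fps_nth f' (n - i)) * q ^ (n - i))
        = of_int (fps_nth f i * fps_nth f' (n - i)) * q ^ n" if "i \<le> n" for i
      using power_add[of q i "n - i"] that by (simp add: mult_ac)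
    then show "(\<Sum>i\<le>n. (of_int (fps_nth f i) * q ^ i) * (of_int (fps_nth f' (n - i)) * q ^ (n - i)))
        = of_int (fps_nth (f * f') n) * q ^ n"
      unfolding fps_mult_nth of_int_sum sum_distrib_right atMost_atLeast0
      by (intro sum.cong refl) (simp only: atLeastAtMost_iff)
  qed
  finally show "(\<lambda>n. of_int (fps_nth (f * f') n) * q ^ n) sums (g q * g' q)" .
qed

lemma sums_eq: "f sums s \<Longrightarrow> (\<And>n. f n = g n) \<Longrightarrow> s = t \<Longrightarrow> g sums t"
  using sums_cong by blast

lemma represents_const: "represents (fps_const c) (\<lambda>_. of_int c)"
  unfolding represents_def
proof (intro allI impI)
  fix q :: complex
  show "(\<lambda>n. of_int (fps_nth (fps_const c) n) * q ^ n) sums of_int c"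
    by (rule sums_eq[OF sums_single[of 0 "\<lambda>n. of_int c * q ^ n"]]) auto
qed

lemma represents_1: "represents 1 (\<lambda>_. 1)"
  using represents_const[of 1] by simp

lemma represents_numeral: "represents (numeral k) (\<lambda>_. numeral k)"
  using represents_const[of "numeral k"] by (simp add: numeral_fps_const)

lemma represents_uminus: "represents f g \<Longrightarrow> represents (- f) (\<lambda>q. - g q)"
  unfolding represents_def by (auto intro!: sums_minus)

lemma represents_X: "represents fps_X (\<lambda>q. q)"
  unfolding represents_def
proof (intro allI impI)
  fix q :: complex
  show "(\<lambda>n. of_int (fps_nth fps_X n) * q ^ n) sums q"
    by (rule sums_eq[OF sums_single[of 1 "\<lambda>n. q ^ n"]]) (auto simp: fps_X_nth)
qed

lemma represents_power: "represents f g \<Longrightarrow> represents (f ^ n) (\<lambda>q. g q ^ n)"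
  by (induction n) (auto intro: represents_mult represents_1)

lemma represents_dil:
  assumes "represents f g" "m > 0"
  shows "represents (dil m f) (\<lambda>q. g (q ^ m))"
  unfolding represents_def
proof (intro allI impI)
  fix q :: complex assume q: "0 < norm q" "norm q < 1"
  have "(\<lambda>n. of_int (fps_nth f n) * (q ^ m) ^ n) sums g (q ^ m)"
    using q assms(2) norm_power_less_1[OF q(2)] by (intro representsD[OF assms(1)]) auto
  then have "(\<lambda>n. of_int (fps_nth (dil m f) (m * n)) * q ^ (m * n)) sums g (q ^ m)"
    using assms(2) by (simp add: dil_nth power_mult)
  moreover have "strict_mono (\<lambda>n. m * n)" using assms(2) by (simp add: strict_mono_def)
  ultimately show "(\<lambda>n. of_int (fps_nth (dil m f) n) * q ^ n) sums g (q ^ m)"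
    by (subst (asm) sums_mono_reindex) (auto simp: dil_nth dvd_def)
qed

text \<open>If all earlier coefficients vanish, divide by \<open>q^n\<close> and let
  \<open>q\<close> tend to 0.\<close>

lemma represents_0:
  assumes "represents f g" "\<And>q. 0 < norm q \<Longrightarrow> norm q < 1 \<Longrightarrow> g q = 0"
  shows "f = 0"
proof (rule fps_ext)
  fix n
  show "fps_nth f n = fps_nth 0 n"
  proof (induction n rule: less_induct)
    case (less n)
    have "(\<lambda>k. of_int (fps_nth f (k + n)) * q ^ k) sums 0" if q: "q \<noteq> 0" "norm q < 1" for q :: complex
    proof -
      have "(\<lambda>k. of_int (fps_nth f k) * q ^ k) sums 0"
        using representsD[OF assms(1), of q] assms(2)[of q] q by simp
      from sums_split_initial_segment[OF this, of n]
      have "(\<lambda>k. of_int (fps_nth f (k + n)) * q ^ (k + n)) sums 0"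
        using less by simp
      then have "(\<lambda>k. (of_int (fps_nth f (k + n)) * q ^ k) * q ^ n) sums (0 * q ^ n)"
        by (simp add: power_add mult.assoc)
      then show ?thesis using q sums_mult2_iff[of "q ^ n" "\<lambda>k. of_int (fps_nth f (k + n)) * q ^ k" 0] by simp
    qed
    then have "((\<lambda>_. 0) \<longlongrightarrow> complex_of_int (fps_nth f (0 + n))) (at (0 :: complex))"
      by (intro powser_limit_0_strong[of 1 "\<lambda>k. of_int (fps_nth f (k + n))" "\<lambda>_. 0"]) auto
    then show ?case using LIM_unique[OF _ tendsto_const] by fastforce
  qed
qed

lemma represents_eqI:
  assumes "represents f g" "represents f' g'" "\<And>q. 0 < norm q \<Longrightarrow> norm q < 1 \<Longrightarrow> g q = g' q"
  shows "f = f'"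
  using represents_0[OF represents_diff[OF assms(1,2)]] assms(3) by simp

section \<open>Integral power series of the theta functions\<close>

definition sparse_fps :: "(nat \<Rightarrow> nat) \<Rightarrow> (nat \<Rightarrow> int) \<Rightarrow> int fps" where
  "sparse_fps e c = Abs_fps (\<lambda>n. if n \<in> range e then c (inv e n) else 0)"

lemma represents_sparse:
  assumes e: "strict_mono e" and s: "\<And>q. 0 < norm q \<Longrightarrow> norm q < 1 \<Longrightarrow> (\<lambda>n. of_int (c n) * q ^ e n) sums g q"
  shows "represents (sparse_fps e c) g"
  unfolding represents_def
proof (intro allI impI)
  fix q :: complex assume q: "0 < norm q" "norm q < 1"
  have "inj e" using e by (rule strict_mono_imp_inj_on)
  then have "(\<lambda>n. of_int (fps_nth (sparse_fps e c) (e n)) * q ^ e n) sums g q"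
    using s[OF q] by (simp add: sparse_fps_def)
  then show "(\<lambda>n. of_int (fps_nth (sparse_fps e c) n) * q ^ n) sums g q"
    using e by (subst (asm) sums_mono_reindex) (auto simp: sparse_fps_def)
qed

lemma sparse_nth_0: "strict_mono e \<Longrightarrow> e 0 = 0 \<Longrightarrow> fps_nth (sparse_fps e c) 0 = c 0"
  using inv_f_f[OF strict_mono_imp_inj_on, of e 0] range_eqI[of 0 e 0] by (simp add: sparse_fps_def)

lemma represents_psi: "represents (sparse_fps tri (\<lambda>_. 1)) psi"
proof (rule represents_sparse[OF strict_mono_tri])
  fix q :: complex assume q: "0 < norm q" "norm q < 1"
  show "(\<lambda>n. of_int 1 * q ^ tri n) sums psi q"
    unfolding psi_def using summable_sums[OF summable_norm_cancel[OF psi_summable[OF q]]] by simp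
qed

text \<open>The two halves \<open>- n\<close> and \<open>n + 1\<close> of the bilateral series have
  strictly increasing exponents, so each is a sparse series with coefficients \<open>1\<close> or
  \<open>- 1\<close>; they are combined only afterwards.\<close>

lemma represents_theta4:
  "represents (sparse_fps (\<lambda>n. n^2) (\<lambda>n. (- 1) ^ n) - sparse_fps (\<lambda>n. (n + 1)^2) (\<lambda>n. (- 1) ^ n)) theta4"
proof -
  have j: "jj q (int n + 1) = - (of_int ((- 1) ^ n) * q ^ ((n + 1)^2))" "jj q (- int n) = of_int ((- 1) ^ n) * q ^ (n^2)" for q n
  proof -
    have "(int n + 1)^2 = int ((n + 1)^2)" "(- int n)^2 = int (n^2)" by simp_all
    then show "jj q (int n + 1) = - (of_int ((- 1) ^ n) * q ^ ((n + 1)^2))" "jj q (- int n) = of_int ((- 1) ^ n) * q ^ (n^2)"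
      unfolding jj_def sg_def by (simp_all only: power_int_of_nat) auto
  qed
  have m: "strict_mono (\<lambda>n::nat. n^2)" "strict_mono (\<lambda>n::nat. (n + 1)^2)"
    by (auto simp: strict_mono_def power_strict_mono)
  define g where "g = (\<lambda>q::complex. \<Sum>n. of_int ((- 1) ^ n) * q ^ (n^2))"
  define h where "h = (\<lambda>q::complex. \<Sum>n. of_int ((- 1) ^ n) * q ^ ((n + 1)^2))"
  have s: "summable (\<lambda>n. of_int ((- 1) ^ n) * q ^ (n^2))" "summable (\<lambda>n. of_int ((- 1) ^ n) * q ^ ((n + 1)^2))"
    and theta4: "theta4 q = g q - h q" if q: "0 < norm q" "norm q < 1" for q
  proof -
    have n: "summable (\<lambda>n. norm (of_int ((- 1) ^ n) * q ^ (n^2)))" "summable (\<lambda>n. norm (of_int ((- 1) ^ n) * q ^ ((n + 1)^2)))"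
      using jj_summable(1)[OF q] unfolding int_abs_summable_iff j norm_minus_cancel by blast+
    show s: "summable (\<lambda>n. of_int ((- 1) ^ n) * q ^ (n^2))" "summable (\<lambda>n. of_int ((- 1) ^ n) * q ^ ((n + 1)^2))"
      by (rule summable_norm_cancel[OF n(1)], rule summable_norm_cancel[OF n(2)])
    have "theta4 q = (\<Sum>n. of_int ((- 1) ^ n) * q ^ (n^2) - of_int ((- 1) ^ n) * q ^ ((n + 1)^2))"
      unfolding theta4_def infsum_int[OF jj_summable(1)[OF q]] j by (simp only: minus_add uminus_add_conv_diff)
    then show "theta4 q = g q - h q" unfolding g_def h_def by (simp only: suminf_diff[OF s])
  qed
  have "represents (sparse_fps (\<lambda>n. n^2) (\<lambda>n. (- 1) ^ n) - sparse_fps (\<lambda>n. (n + 1)^2) (\<lambda>n. (- 1) ^ n)) (\<lambda>q. g q - h q)"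
    by (intro represents_diff represents_sparse m) (simp_all only: g_def h_def s summable_sums)
  then show ?thesis by (rule represents_cong) (rule theta4 [symmetric])
qed

text \<open>Supplies integral series for \<open>psi0\<close> (\<open>j = 3\<close>) and
  \<open>psi1\<close> (\<open>j = 4\<close>). The exponents \<open>e\<close> and \<open>e'\<close>
  come from the two halves of \<open>jacobi_triple\<close> in base \<open>q^5\<close> at
  \<open>a = q^j\<close>; \<open>j < 5\<close> makes them natural numbers and strictly
  increasing.\<close>

lemma represents_triple:
  assumes "0 < j" "j < 5"
  shows "\<exists>f. represents f (\<lambda>q. qinf (- (q ^ j)) (q^5) * qinf (- (q ^ (5 - j))) (q^5) * eu (q^5))"
proof -
  define e where "e = (\<lambda>n. 5 * tri n + j * Suc n)"
  define e' where "e' = (\<lambda>n. 5 * tri n - j * n)"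
  have jn: "j * n \<le> 5 * tri n" for n
    using mult_le_mono[of j 5 n "tri n"] assms tri_ge by simp
  have m: "strict_mono e" "strict_mono e'"
    unfolding strict_mono_Suc_iff using assms jn
    by (auto simp: e_def e'_def less_diff_conv2 algebra_simps)
  have ge: "n \<le> e n" "n \<le> e' n" for n
    using m by (simp_all add: strict_mono_imp_increasing)
  define g where "g = (\<lambda>q::complex. \<Sum>n. q ^ e n)"
  define h where "h = (\<lambda>q::complex. \<Sum>n. q ^ e' n)"
  have s: "summable (\<lambda>n. q ^ e n)" "summable (\<lambda>n. q ^ e' n)"
    if q: "0 < norm q" "norm q < 1" for q :: complex
  proof -
    have "summable (\<lambda>n. norm q ^ n)" using q by (simp add: summable_geometric)
    moreover have "norm (q ^ k) \<le> norm q ^ n" if "n \<le> k" for n k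
      unfolding norm_power using power_decreasing[OF that, of "norm q"] q by simp
    ultimately show "summable (\<lambda>n. q ^ e n)" "summable (\<lambda>n. q ^ e' n)"
      using ge by (blast intro: summable_comparison_test'[where N = 0])+
  qed
  have eq: "qinf (- (q ^ j)) (q^5) * qinf (- (q ^ (5 - j))) (q^5) * eu (q^5) = g q + h q"
    if q: "0 < norm q" "norm q < 1" for q
  proof -
    have q0: "q \<noteq> 0" using q by auto
    have d: "- (q^5) / q ^ j = - (q ^ (5 - j))" using q0 assms by (simp add: power_diff)
    have "(q^5) ^ tri n * ((q ^ j) ^ Suc n + (1 / q ^ j) ^ n) = q ^ e n + q ^ e' n" for n
    proof -
      have "(q^5) ^ tri n * (q ^ j) ^ Suc n = q ^ e n"
        unfolding e_def by (simp only: power_add power_mult)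
      moreover have "(q^5) ^ tri n * (1 / q ^ j) ^ n = q ^ e' n"
        unfolding e'_def using power_diff[OF q0 jn[of n]] by (simp add: power_one_over power_mult)
      ultimately show ?thesis by (simp only: distrib_left)
    qed
    then have "qinf (- (q ^ j)) (q^5) * qinf (- (q ^ (5 - j))) (q^5) * eu (q^5) = (\<Sum>n. q ^ e n + q ^ e' n)"
      using jacobi_triple[OF q5(2)[OF q], of "q ^ j"] q0 unfolding d eu_def by simp
    then show ?thesis using s[OF q] by (simp add: g_def h_def suminf_add)
  qed
  have "represents (sparse_fps e (\<lambda>_. 1) + sparse_fps e' (\<lambda>_. 1)) (\<lambda>q. g q + h q)"
    by (intro represents_add represents_sparse m) (simp_all add: g_def h_def s summable_sums)
  then show ?thesis by (intro exI) (erule represents_cong, rule eq [symmetric])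
qed

lemma represents_eu_cube:
  "represents (sparse_fps (\<lambda>n. 2 * tri n) (\<lambda>n. (- 1) ^ n * (2 * int n + 1))) (\<lambda>q. eu (q^2)^3)"
proof (rule represents_sparse)
  show "strict_mono (\<lambda>n. 2 * tri n)" using strict_mono_tri by (simp add: strict_mono_def)
  fix q :: complex assume q: "0 < norm q" "norm q < 1"
  have q2: "norm (q^2) < 1" using norm_power_less_1[OF q(2)] by simp
  have "(\<lambda>n. (q^2) ^ tri n * ((- 1) ^ n * (2 * of_nat n + 1))) sums eu (q^2)^3"
    unfolding eu_def jacobi_cube[OF q2] by (rule summable_sums[OF summable_norm_cancel[OF summable_odd_tri[OF q2]]])
  then show "(\<lambda>n. of_int ((- 1) ^ n * (2 * int n + 1)) * q ^ (2 * tri n)) sums eu (q^2)^3"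
    by (rule sums_eq) (simp_all add: mult.commute flip: power_mult)
qed

text \<open>For \<open>k = 0, ..., 4\<close> the residues of \<open>k (k + 1)\<close> modulo 5 are
  0, 2, 1, 2, 0. Of the classes 1, 3, 4 only 1 occurs, and only for \<open>k\<close> congruent to 2,
  where 5 divides \<open>2 k + 1\<close>.\<close>

lemma eu_cube_coefficients:
  assumes "r \<in> {1, 3, 4}"
  shows "fcong 5 (sect r (sparse_fps (\<lambda>n. 2 * tri n) (\<lambda>n. (- 1) ^ n * (2 * int n + 1)))) 0"
proof -
  have d: "5 dvd 2 * int k + 1" if "5 * n + r = 2 * tri k" for n k
  proof -
    have "k * (k + 1) mod 5 = r"
      using that assms unfolding two_tri [symmetric] by (auto simp: mod_simps simp flip: that)
    moreover have "k mod 5 \<in> {0, 1, 2, 3, 4}" by (simp only: insert_iff empty_iff) presburger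
    then have "k mod 5 = 2 \<or> k * (k + 1) mod 5 \<in> {0, 2}"
      by (subst mod_mult_eq [symmetric], subst mod_add_left_eq [symmetric]) auto
    ultimately have "k mod 5 = 2" using assms by auto
    then show ?thesis by presburger
  qed
  have "inj (\<lambda>n. 2 * tri n)"
    using strict_mono_imp_inj_on[OF strict_mono_tri] by (auto simp: inj_on_def)
  note i = inv_f_f[OF this]
  show ?thesis using d
    by (auto simp: fcong_def numeral_dvd_fps_iff sparse_fps_def i)
qed

section \<open>The congruence for the coefficients of phi\<close>

lemma dil_inject: "m > 0 \<Longrightarrow> dil m f = dil m g \<Longrightarrow> f = g"
proof (rule fps_ext)
  fix n assume "m > 0" "dil m f = dil m g"
  then have "fps_nth (dil m f) (m * n) = fps_nth (dil m g) (m * n)" by simp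
  then show "fps_nth f n = fps_nth g n" using \<open>m > 0\<close> by (simp add: dil_nth)
qed

lemma dil_dil: "m > 0 \<Longrightarrow> k > 0 \<Longrightarrow> dil m (dil k f) = dil (m * k) f"
  by (rule fps_ext) (auto simp: dil_nth dvd_def div_mult2_eq)

lemma phi_coefficient_cong:
  fixes a :: "nat \<Rightarrow> int"
  assumes a: "\<And>q :: complex. norm q < 1 \<Longrightarrow> (\<lambda>m. of_int (a (m + 1)) * q ^ (m + 1)) sums phi q"
    and r: "r \<in> {1, 3, 4}"
  shows "125 dvd a (2 * (625 * n + 125 * r + 109) + 1)"
proof -
  define p where "p = sparse_fps tri (\<lambda>_. 1)"
  define P' where "P' = sparse_fps (\<lambda>n. n^2) (\<lambda>n. (- 1) ^ n) - sparse_fps (\<lambda>n. (n + 1)^2) (\<lambda>n. (- 1) ^ n)"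
  obtain D where D: "represents D psi0"
    using represents_triple[of 3] by (auto simp: psi0_def [abs_def])
  obtain E where E: "represents E psi1"
    using represents_triple[of 4] by (auto simp: psi1_def [abs_def])
  have p: "represents p psi" unfolding p_def by (rule represents_psi)
  have P': "represents P' theta4" unfolding P'_def by (rule represents_theta4)
  have p5: "represents (dil 5 p) (\<lambda>q. psi (q^5))" by (rule represents_dil[OF p]) simp
  have p25: "represents (dil 5 (dil 5 p)) (\<lambda>q. psi (q^25))"
    using represents_dil[OF p, of 25] by (simp add: dil_dil)
  have P5: "represents (dil 5 P') (\<lambda>q. theta4 (q^5))" by (rule represents_dil[OF P']) simp
  have D5: "represents (dil 5 D) (\<lambda>q. psi0 (q^5))" by (rule represents_dil[OF D]) simp
  have E5: "represents (dil 5 E) (\<lambda>q. psi1 (q^5))" by (rule represents_dil[OF E]) simp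
  let ?w = "p^2 - fps_X * (dil 5 p)^2"
  have w: "represents ?w (\<lambda>q. psi q^2 - q * psi (q^5)^2)"
    by (rule represents_diff represents_mult represents_power represents_X p p5)+
  \<comment> \<open>Each locale assumption is an identity of functions on the punctured disc,
    carried over to integral series by \<open>represents_eqI\<close>; \<open>cubic\<close> also uses
    \<open>eu_cube_coefficients\<close>.\<close>
  interpret theta_fps p P' D E ?w "dil 5 p" "dil 5 P'"
  proof unfold_locales
    show "fps_nth p 0 = 1" unfolding p_def by (simp add: sparse_nth_0 strict_mono_tri)
    have "strict_mono (\<lambda>n::nat. n^2)" by (auto simp: strict_mono_def power_strict_mono)
    then show "fps_nth P' 0 = 1" unfolding P'_def fps_sub_nth by (subst sparse_nth_0) (auto simp: sparse_fps_def)
    show "p = dil 5 D + fps_X * dil 5 E + fps_X^3 * dil 5 (dil 5 p)"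
      by (rule represents_eqI, rule p, (rule represents_add represents_mult represents_power represents_X D5 E5 p25)+, rule psi_dissection)
    show "D * E = ?w"
      by (rule represents_eqI, (rule represents_mult D E)+, rule w, rule psi0_mult_psi1)
    show "((dil 5 D)^5 + (fps_X * dil 5 E)^5 + (fps_X^3 * dil 5 (dil 5 p))^5
        - 5 * dil 5 D * (fps_X * dil 5 E) * (fps_X^3 * dil 5 (dil 5 p))^3
        + 5 * (dil 5 D)^2 * (fps_X * dil 5 E)^2 * (fps_X^3 * dil 5 (dil 5 p))) * dil 5 (dil 5 p) = dil 5 p^6"
      by (rule represents_eqI, (rule represents_add represents_diff represents_mult represents_power represents_numeral represents_X D5 E5 p25)+,
          (rule represents_power p5)+, rule psi_norm)
    show "(P'^2 - dil 5 P'^2) * ?w = - 4 * fps_X * dil 5 p^2 * dil 5 P'^2"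
      by (rule represents_eqI, (rule w represents_diff represents_mult represents_power P' P5)+,
          (rule represents_uminus represents_numeral represents_X represents_mult represents_power p5 P5)+, rule theta4_psi_relations)
    show "?w^3 * P' = p * dil 5 p * dil 5 P'^5"
      by (rule represents_eqI, (rule w represents_mult represents_power P')+,
          (rule represents_mult p p5 represents_power P5)+, rule theta4_psi_relations)
    have "p^2 * P' = sparse_fps (\<lambda>n. 2 * tri n) (\<lambda>n. (- 1) ^ n * (2 * int n + 1))"
      by (rule represents_eqI, (rule represents_mult represents_power p P')+, rule represents_eu_cube, rule psi_sq_mult_theta4)
    then show "\<And>r. r \<in> {1, 3, 4} \<Longrightarrow> fcong 5 (sect r (p^2 * P')) 0"
      using eu_cube_coefficients by simp
  qed simp_all
  \<comment> \<open>The constant term is set to 0, since the assumption speaks of \<open>a\<close>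
    from index 1 on and \<open>phi\<close> has no constant term. \<open>B\<close> is
    \<open>A\<close> at \<open>- X\<close>, so \<open>A - B\<close> is twice the odd part.\<close>
  define A where "A = Abs_fps (\<lambda>n. if n = 0 then 0 else a n)"
  define B where "B = Abs_fps (\<lambda>n. (- 1) ^ n * fps_nth A n)"
  define F where "F = Abs_fps (\<lambda>n. a (2 * n + 1))"
  have A_sums: "(\<lambda>n. of_int (fps_nth A n) * q ^ n) sums phi q" if "norm q < 1" for q
    using a[OF that] sums_Suc_iff[of "\<lambda>n. of_int (fps_nth A n) * q ^ n" "phi q"] by (simp add: A_def)
  have A: "represents A phi" using A_sums by (simp add: represents_def)
  have B: "represents B (\<lambda>q. phi (- q))"
    unfolding represents_def
  proof (intro allI impI)
    fix q :: complex assume "norm q < 1"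
    then show "(\<lambda>n. of_int (fps_nth B n) * q ^ n) sums phi (- q)"
      using A_sums[of "- q"] by (simp add: B_def power_minus[of q] mult_ac)
  qed
  have AB: "A - B = 2 * fps_X * dil 2 F"
  proof (rule fps_ext)
    fix n show "fps_nth (A - B) n = fps_nth (2 * fps_X * dil 2 F) n"
    proof (cases "even n")
      case True
      then show ?thesis
        by (cases n) (auto simp: A_def B_def dil_nth mult.assoc numeral_fps_const)
    next
      case False
      then obtain k where "n = 2 * k + 1" by (rule oddE)
      then show ?thesis by (auto simp: A_def B_def F_def dil_nth mult.assoc numeral_fps_const)
    qed
  qed
  have "(dil 2 P')^2 * (A - B) = 2 * fps_X * (dil 2 p)^3"
  proof (rule represents_eqI)
    show "represents ((dil 2 P')^2 * (A - B)) (\<lambda>q. theta4 (q^2)^2 * (phi q - phi (- q)))"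
      by (intro represents_mult represents_power represents_diff represents_dil P' A B) simp
    show "represents (2 * fps_X * (dil 2 p)^3) (\<lambda>q. 2 * q * psi (q^2)^3)"
      by (intro represents_mult represents_power represents_numeral represents_X represents_dil p) simp
  qed (rule phi_odd_part)
  then have "2 * fps_X * dil 2 (F * P'^2) = 2 * fps_X * dil 2 (p^3)"
    unfolding AB by (simp add: dil_simps mult_ac)
  then have "dil 2 (F * P'^2) = dil 2 (p^3)" by simp
  then have "F * P'^2 = p^3" by (rule dil_inject[rotated]) simp
  from coefficient_cong[OF this r, of n] show ?thesis by (simp add: F_def)
qed

theorem corollary3p4:
  fixes a :: "nat \<Rightarrow> int" and n r :: nat
  assumes "\<And>q :: complex. norm q < 1 \<Longrightarrow>
             (\<lambda>m. of_int (a (m + 1)) * q ^ (m + 1)) sums phi q"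
    and "r \<in> {1, 3, 4}"
  shows "[a (1250 * n + 250 * r + 219) = 0] (mod 125)"
proof -
  have "2 * (625 * n + 125 * r + 109) + 1 = 1250 * n + 250 * r + 219" by simp
  then show ?thesis
    using phi_coefficient_cong[OF assms, of n] by (simp only: cong_0_iff)
qed

end
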